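(* Assume A1–A5 and $k_n\asymp n^{2-4r}$, where $0<r<1/2$ and $s=\frac{r}{2-4r}$. Then the balls $U=\bar{\mathbb B}^s_{2\infty}(P_0)$, $P_0>0$, are perfect maxisets for the test statistics $T_n(Y_n)$; that is, for every sequence $f_n\in\mathbb L_2(0,1)$ with $cn^{-r}\le\|f_n\|\le Cn^{-r}$ (constants $0<c\le C$): (i) $f_n$ is consistent if and only if there are $\gamma>0$, constants $0<c_2\le C_2$ and a sequence $f_{1n}\in\gamma U$ with $c_2n^{-r}\le\|f_{1n}\|\le C_2n^{-r}$ such that $\|f_n\|^2=\|f_{1n}\|^2+\|f_n-f_{1n}\|^2$; (ii) $f_n$ is inconsistent if and only if for every $\gamma>0$ and every sequence $f_{1n}\in\gamma U$ with $c_2n^{-r}\le\|f_{1n}\|\le C_2n^{-r}$ (for some constants $0<c_2\le C_2$), the sequence of alternatives $f_n+f_{1n}$ is consistent and $\|f_n+f_{1n}\|^2=\|f_n\|^2+\|f_{1n}\|^2+o(n^{-2r})$ as $n\to\infty$.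
   Context: Model: one observes $dY_n(t)=f(t)dt+\frac{\sigma}{\sqrt n}dw(t)$, $t\in[0,1]$, $\sigma>0$, $f\in\mathbb L_2(0,1)$ unknown, $dw$ Gaussian white noise; $\|\cdot\|$ is the $\mathbb L_2(0,1)$ norm. $\phi_j$, $1\le j<\infty$, is an orthonormal basis of $\mathbb L_2(0,1)$, $\theta_j=\int f\phi_j\,dt$, $y_j=\int\phi_j\,dY_n=\theta_j+\frac{\sigma}{\sqrt n}\xi_j$ with $\xi_j$ i.i.d. $N(0,1)$. The hypothesis is $H_0:f=0$. $\alpha(K_n)$ and $\beta(K_n,f)$ are the type I error probability and the type II error probability at $f$ of a test $K_n$. A test is generated by $T_n$ if it rejects $H_0$ when $T_n$ exceeds a threshold. A sequence of alternatives $f_n$ is consistent if there is a sequence of tests $K_n$ generated by $T_n$ with $\limsup_{n\to\infty}(\alpha(K_n)+\beta(K_n,f_n))<1$; it is inconsistent if every sequence of tests $K_n$ generated by $T_n$ satisfies $\liminf_{n\to\infty}(\alpha(K_n)+\beta(K_n,f_n))\ge1$. $a_n\asymp b_n$ means $ca_n\le b_n\le Ca_n$ for all $n$ with constants $0<c\le C$. Test statistics: $T_n(Y_n)=\sum_{j=1}^\infty\kappa_{jn}^2y_j^2-\sigma^2n^{-1}\sum_{j=1}^\infty\kappa_{jn}^2$, with $k_n=\sup\{k:\sum_{j<k}\kappa_{jn}^2\le\frac12\sum_{j=1}^\infty\kappa_{jn}^2\}$. Non-integer indices are replaced by integer parts. Assumptions: A1. For each $n$ the sequence $\kappa^2_{jn}$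 is decreasing in $j$. A2. There are positive constants $C_1,C_2$ with $C_1<A_n=\sigma^{-4}n^2\sum_{j=1}^\infty\kappa_{jn}^4<C_2$ for each $n$. A3. For any $0<\delta<1/2$, $\lim_{n\to\infty}\sup_{\delta k_n<j<\delta^{-1}k_n}\left|\kappa^2_{j+1,n}/\kappa^2_{j,n}-1\right|=0$. A4. For any $\delta>0$ and any $0\le\delta_1<1$ there are constants $C_1>0$ and $C_2<1$ with $C_1<\kappa^2_{(1+\delta)k_n,n}/\kappa^2_{(1-\delta_1)k_n,n}<C_2$. A5. $\lim_{\delta\to0}\lim_{n\to\infty}\frac{\sum_{\delta k_n<j<\delta^{-1}k_n}\kappa_{jn}^2}{\sum_{j=1}^\infty\kappa_{jn}^2}=1$ and $\lim_{\delta\to0}\lim_{n\to\infty}A_n^{-1}\sigma^{-4}n^2\sum_{\delta k_n<j<\delta^{-1}k_n}\kappa_{jn}^4=1$. Balls: $\bar{\mathbb B}^s_{2\infty}(P_0)=\{f=\sum_{j\ge1}\theta_j\phi_j:\ \sup_{\lambda>0}\lambda^{2s}\sum_{j>\lambda}\theta_j^2\le P_0,\ \theta_j\in\mathbb R\}$, and $\gamma U=\{\gamma g:g\in U\}$.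
   Formalization: A4 is required for large n only (for every n it cannot hold), and δ_1 in it may depend on n while (1-δ_1)k_n≥1, so κ²_{1n}≤Cκ²_{k_n,n}; with fixed δ_1 the claim fails when the first coefficient grows slowly. Σ_jκ²_{jn}<∞ is assumed. *)

theory Defs
  imports "HOL-Probability.Probability" "HOL-Library.Landau_Symbols"
begin

text \<open>
  Conventions. Coordinates and sample sizes are indexed by the positive integers: a sequence
  \<open>u :: nat \<Rightarrow> 'a\<close> is used only at indices \<open>\<ge> 1\<close>, and a series over \<open>j \<ge> 1\<close> is written
  \<open>\<Sum>j. u (Suc j)\<close>. Elements of the space L2(0,1) are represented by square integrable functions.
\<close>

subsection \<open>The space L2(0,1)\<close>

definition L2 :: "(real \<Rightarrow> real) set" where
  "L2 = {f. f \<in> borel_measurable (lebesgue_on {0<..<1}) \<and>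
            integrable (lebesgue_on {0<..<1}) (\<lambda>t. (f t)\<^sup>2)}"

definition l2inner :: "(real \<Rightarrow> real) \<Rightarrow> (real \<Rightarrow> real) \<Rightarrow> real" where
  "l2inner f g = (LINT t|lebesgue_on {0<..<1}. f t * g t)"

definition l2norm :: "(real \<Rightarrow> real) \<Rightarrow> real" where
  "l2norm f = sqrt (LINT t|lebesgue_on {0<..<1}. (f t)\<^sup>2)"

definition orthonormal_system :: "(nat \<Rightarrow> real \<Rightarrow> real) \<Rightarrow> bool" where
  "orthonormal_system \<phi> \<longleftrightarrow>
     (\<forall>j\<ge>1. \<phi> j \<in> L2) \<and>
     (\<forall>i\<ge>1. \<forall>j\<ge>1. l2inner (\<phi> i) (\<phi> j) = (if i = j then 1 else 0))"

definition orthonormal_basis :: "(nat \<Rightarrow> real \<Rightarrow> real) \<Rightarrow> bool" where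
  "orthonormal_basis \<phi> \<longleftrightarrow>
     orthonormal_system \<phi> \<and>
     (\<forall>f\<in>L2. (\<lambda>N. l2norm (\<lambda>t. f t - (\<Sum>j=1..N. l2inner f (\<phi> j) * \<phi> j t))) \<longlonglongrightarrow> 0)"

text \<open>
  The supremum is taken in the extended reals, so that it is infinite, and not an arbitrary real
  number, for functions outside all the balls.
\<close>

definition besov_ball ::
    "(nat \<Rightarrow> real \<Rightarrow> real) \<Rightarrow> real \<Rightarrow> real \<Rightarrow> (real \<Rightarrow> real) set" where
  "besov_ball \<phi> s P0 =
     {f \<in> L2. (SUP l\<in>{0<..}. ereal (l powr (2 * s) *
                 (\<Sum>j. if l < real (Suc j) then (l2inner f (\<phi> (Suc j)))\<^sup>2 else 0))) \<le> ereal P0}"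

definition scale_set :: "real \<Rightarrow> (real \<Rightarrow> real) set \<Rightarrow> (real \<Rightarrow> real) set" where
  "scale_set \<gamma> U = (\<lambda>g t. \<gamma> * g t) ` U"

subsection \<open>Gaussian white noise and the observed process\<close>

text \<open>
  White noise is a generalized process: \<open>w g\<close> stands for the stochastic integral of \<open>g\<close> with
  respect to \<open>dw\<close>. It is almost surely linear in \<open>g\<close>, and the integrals of every orthonormal system are
  independent standard normal random variables.
\<close>

definition white_noise :: "'a measure \<Rightarrow> ((real \<Rightarrow> real) \<Rightarrow> 'a \<Rightarrow> real) \<Rightarrow> bool" where
  "white_noise M w \<longleftrightarrow>
     prob_space M \<and>
     (\<forall>g\<in>L2. w g \<in> borel_measurable M) \<and>
     (\<forall>g\<in>L2. \<forall>h\<in>L2. \<forall>a b. AE \<omega> in M. w (\<lambda>t. a * g t + b * h t) \<omega> = a * w g \<omega> + b * w h \<omega>) \<and>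
     (\<forall>e. orthonormal_system e \<longrightarrow>
        prob_space.indep_vars M (\<lambda>_. borel) (\<lambda>j. w (e j)) {1..} \<and>
        (\<forall>j\<ge>1. distributed M lborel (w (e j)) std_normal_density))"

text \<open>
  An observation assigns to \<open>g\<close> the value of the integral of \<open>g\<close> with respect to \<open>dY\<^sub>n\<close>, where
  \<open>dY\<^sub>n(t) = f(t) dt + \<sigma> n\<^sup>-\<^sup>1\<^sup>/\<^sup>2 dw(t)\<close>.
\<close>

type_synonym observation = "(real \<Rightarrow> real) \<Rightarrow> real"

definition observed ::
    "((real \<Rightarrow> real) \<Rightarrow> 'a \<Rightarrow> real) \<Rightarrow> real \<Rightarrow> nat \<Rightarrow> (real \<Rightarrow> real) \<Rightarrow> 'a \<Rightarrow> observation" where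
  "observed w \<sigma> n f \<omega> = (\<lambda>g. l2inner f g + \<sigma> / sqrt (real n) * w g \<omega>)"

subsection \<open>Tests and consistency\<close>

text \<open>A test is given by its rejection rule: \<open>K Y\<close> holds iff the hypothesis \<open>f = 0\<close> is rejected.\<close>

definition type1_error ::
    "'a measure \<Rightarrow> ((real \<Rightarrow> real) \<Rightarrow> 'a \<Rightarrow> real) \<Rightarrow> real \<Rightarrow> nat \<Rightarrow> (observation \<Rightarrow> bool) \<Rightarrow> real" where
  "type1_error M w \<sigma> n K =
     measure M {\<omega> \<in> space M. K (observed w \<sigma> n (\<lambda>_. 0) \<omega>)}"

definition type2_error ::
    "'a measure \<Rightarrow> ((real \<Rightarrow> real) \<Rightarrow> 'a \<Rightarrow> real) \<Rightarrow> real \<Rightarrow> nat \<Rightarrow> (observation \<Rightarrow> bool) \<Rightarrow>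
     (real \<Rightarrow> real) \<Rightarrow> real" where
  "type2_error M w \<sigma> n K f =
     measure M {\<omega> \<in> space M. \<not> K (observed w \<sigma> n f \<omega>)}"

definition generated_by :: "(observation \<Rightarrow> bool) \<Rightarrow> (observation \<Rightarrow> real) \<Rightarrow> bool" where
  "generated_by K T \<longleftrightarrow> (\<exists>c. \<forall>Y. K Y \<longleftrightarrow> T Y > c)"

definition consistent ::
    "'a measure \<Rightarrow> ((real \<Rightarrow> real) \<Rightarrow> 'a \<Rightarrow> real) \<Rightarrow> real \<Rightarrow> (nat \<Rightarrow> observation \<Rightarrow> real) \<Rightarrow>
     (nat \<Rightarrow> real \<Rightarrow> real) \<Rightarrow> bool" where
  "consistent M w \<sigma> T f \<longleftrightarrow>
     (\<exists>K. (\<forall>n\<ge>1. generated_by (K n) (T n)) \<and>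
        limsup (\<lambda>n. ereal (type1_error M w \<sigma> n (K n) + type2_error M w \<sigma> n (K n) (f n))) < 1)"

definition inconsistent ::
    "'a measure \<Rightarrow> ((real \<Rightarrow> real) \<Rightarrow> 'a \<Rightarrow> real) \<Rightarrow> real \<Rightarrow> (nat \<Rightarrow> observation \<Rightarrow> real) \<Rightarrow>
     (nat \<Rightarrow> real \<Rightarrow> real) \<Rightarrow> bool" where
  "inconsistent M w \<sigma> T f \<longleftrightarrow>
     (\<forall>K. (\<forall>n\<ge>1. generated_by (K n) (T n)) \<longrightarrow>
        liminf (\<lambda>n. ereal (type1_error M w \<sigma> n (K n) + type2_error M w \<sigma> n (K n) (f n))) \<ge> 1)"

subsection \<open>Quadratic test statistics\<close>

definition quad_stat ::
    "(nat \<Rightarrow> real \<Rightarrow> real) \<Rightarrow> (nat \<Rightarrow> nat \<Rightarrow> real) \<Rightarrow> real \<Rightarrow> nat \<Rightarrow> observation \<Rightarrow> real" where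
  "quad_stat \<phi> \<kappa> \<sigma> n Y =
     (\<Sum>j. (\<kappa> (Suc j) n)\<^sup>2 * (Y (\<phi> (Suc j)))\<^sup>2) - \<sigma>\<^sup>2 / real n * (\<Sum>j. (\<kappa> (Suc j) n)\<^sup>2)"

definition kn :: "(nat \<Rightarrow> nat \<Rightarrow> real) \<Rightarrow> nat \<Rightarrow> nat" where
  "kn \<kappa> n = Sup {k. (\<Sum>j=1..<k. (\<kappa> j n)\<^sup>2) \<le> 1/2 * (\<Sum>j. (\<kappa> (Suc j) n)\<^sup>2)}"

definition An :: "(nat \<Rightarrow> nat \<Rightarrow> real) \<Rightarrow> real \<Rightarrow> nat \<Rightarrow> real" where
  "An \<kappa> \<sigma> n = (real n)\<^sup>2 / \<sigma>^4 * (\<Sum>j. (\<kappa> (Suc j) n)^4)"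

text \<open>The indices \<open>j\<close> with \<open>\<delta> k\<^sub>n < j < \<delta>\<^sup>-\<^sup>1 k\<^sub>n\<close>.\<close>

definition window :: "(nat \<Rightarrow> nat \<Rightarrow> real) \<Rightarrow> real \<Rightarrow> nat \<Rightarrow> nat set" where
  "window \<kappa> \<delta> n = {j. \<delta> * real (kn \<kappa> n) < real j \<and> real j < real (kn \<kappa> n) / \<delta>}"

definition kappa2 :: "(nat \<Rightarrow> nat \<Rightarrow> real) \<Rightarrow> nat \<Rightarrow> real \<Rightarrow> real" where
  "kappa2 \<kappa> n x = (\<kappa> (nat \<lfloor>x\<rfloor>) n)\<^sup>2"

text \<open>
  Well-definedness of the statistic; it also gives convergence of the fourth power series.
\<close>

definition kappa_summable :: "(nat \<Rightarrow> nat \<Rightarrow> real) \<Rightarrow> bool" where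
  "kappa_summable \<kappa> \<longleftrightarrow> (\<forall>n\<ge>1. summable (\<lambda>j. (\<kappa> (Suc j) n)\<^sup>2))"

definition A1 :: "(nat \<Rightarrow> nat \<Rightarrow> real) \<Rightarrow> bool" where
  "A1 \<kappa> \<longleftrightarrow> (\<forall>n\<ge>1. \<forall>i\<ge>1. \<forall>j\<ge>i. (\<kappa> j n)\<^sup>2 \<le> (\<kappa> i n)\<^sup>2)"

definition A2 :: "(nat \<Rightarrow> nat \<Rightarrow> real) \<Rightarrow> real \<Rightarrow> bool" where
  "A2 \<kappa> \<sigma> \<longleftrightarrow> (\<exists>C1>0. \<exists>C2>0. \<forall>n\<ge>1. C1 < An \<kappa> \<sigma> n \<and> An \<kappa> \<sigma> n < C2)"

definition A3 :: "(nat \<Rightarrow> nat \<Rightarrow> real) \<Rightarrow> bool" where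
  "A3 \<kappa> \<longleftrightarrow> (\<forall>\<delta>. 0 < \<delta> \<and> \<delta> < 1/2 \<longrightarrow>
     (\<lambda>n. SUP j\<in>window \<kappa> \<delta> n. \<bar>(\<kappa> (Suc j) n)\<^sup>2 / (\<kappa> j n)\<^sup>2 - 1\<bar>) \<longlonglongrightarrow> 0)"

text \<open>
  Two points of interpretation.

  The bounds are required for large \<open>n\<close>, as they cannot hold for every \<open>n\<close>: for \<open>\<delta>\<^sub>1 = 0\<close>
  and \<open>\<delta> < 1 / k\<^sub>n\<close> both integer parts are \<open>k\<^sub>n\<close> and the ratio is 1.

  "Any \<open>\<delta>\<^sub>1\<close>" admits \<open>\<delta>\<^sub>1\<close> depending on \<open>n\<close>, so \<open>(1 - \<delta>\<^sub>1) k\<^sub>n\<close> may be any index between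
  1 and \<open>k\<^sub>n\<close>, and in particular the first coefficient is at most of the order of the \<open>k\<^sub>n\<close>-th.
  For fixed \<open>\<delta>\<^sub>1\<close> alone nothing would be said about coefficients with \<open>j = o(k\<^sub>n)\<close>: raising the
  first squared coefficient by a slowly growing factor \<open>L\<^sub>n\<close> makes alternatives detectable through
  a first coordinate of order \<open>n\<^sup>-\<^sup>r / L\<^sub>n\<^sup>1\<^sup>/\<^sup>2\<close>, and the balls are no longer perfect maxisets.
\<close>

definition A4 :: "(nat \<Rightarrow> nat \<Rightarrow> real) \<Rightarrow> bool" where
  "A4 \<kappa> \<longleftrightarrow>
     (\<forall>\<delta>>0. \<forall>\<delta>1::nat \<Rightarrow> real.
        (\<forall>n\<ge>1. 0 \<le> \<delta>1 n \<and> \<delta>1 n < 1) \<and>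
        (\<forall>\<^sub>F n in sequentially. 1 \<le> (1 - \<delta>1 n) * real (kn \<kappa> n)) \<longrightarrow>
        (\<exists>C1>0. \<exists>C2<1. \<forall>\<^sub>F n in sequentially.
           C1 < kappa2 \<kappa> n ((1 + \<delta>) * real (kn \<kappa> n)) / kappa2 \<kappa> n ((1 - \<delta>1 n) * real (kn \<kappa> n)) \<and>
           kappa2 \<kappa> n ((1 + \<delta>) * real (kn \<kappa> n)) / kappa2 \<kappa> n ((1 - \<delta>1 n) * real (kn \<kappa> n)) < C2))"

text \<open>\<open>iterated_limit X l\<close>: the limit of \<open>X \<delta> n\<close>, first \<open>n \<rightarrow> \<infinity>\<close> and then \<open>\<delta> \<rightarrow> 0\<close>, is \<open>l\<close>.\<close>

definition iterated_limit :: "(real \<Rightarrow> nat \<Rightarrow> real) \<Rightarrow> real \<Rightarrow> bool" where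
  "iterated_limit X l \<longleftrightarrow>
     (\<exists>g. (\<forall>\<^sub>F \<delta> in at_right 0. X \<delta> \<longlonglongrightarrow> g \<delta>) \<and> (g \<longlongrightarrow> l) (at_right 0))"

definition A5 :: "(nat \<Rightarrow> nat \<Rightarrow> real) \<Rightarrow> real \<Rightarrow> bool" where
  "A5 \<kappa> \<sigma> \<longleftrightarrow>
     iterated_limit
       (\<lambda>\<delta> n. (\<Sum>j\<in>window \<kappa> \<delta> n. (\<kappa> j n)\<^sup>2) / (\<Sum>j. (\<kappa> (Suc j) n)\<^sup>2)) 1 \<and>
     iterated_limit
       (\<lambda>\<delta> n. inverse (An \<kappa> \<sigma> n) * ((real n)\<^sup>2 / \<sigma>^4) * (\<Sum>j\<in>window \<kappa> \<delta> n. (\<kappa> j n)^4)) 1"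

text \<open>Two-sided bounds with constants, valid for all \<open>n \<ge> 1\<close> and not only asymptotically.\<close>

definition same_order :: "(nat \<Rightarrow> real) \<Rightarrow> (nat \<Rightarrow> real) \<Rightarrow> bool" where
  "same_order a b \<longleftrightarrow> (\<exists>c C. 0 < c \<and> c \<le> C \<and> (\<forall>n\<ge>1. c * a n \<le> b n \<and> b n \<le> C * a n))"

end

theory Submission imports Defs begin

text \<open>
  Up to normalization \<open>T\<^sub>n\<close> is \<open>Z + W + D\<close>, where \<open>Z = \<Sum>\<^sub>j b\<^sub>j (\<xi>\<^sub>j\<^sup>2 - 1)\<close> does not depend on \<open>f\<close>, the
  drift \<open>D\<close> is \<open>n\<^sup>2 \<Sum>\<^sub>j \<kappa>\<^sub>j\<^sub>n\<^sup>2 \<theta>\<^sub>j\<^sup>2\<close>, and \<open>W\<close> is linear in the noise with \<open>Var W \<le> 4 b\<^sub>1 D\<close>, where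
  \<open>b\<^sub>1 \<rightarrow> 0\<close>. If \<open>D\<close> stays away from 0, the tightness of \<open>Z\<close> gives a threshold that separates
  \<open>Z\<close> from \<open>Z + W + D\<close>. If \<open>D \<rightarrow> 0\<close>, no threshold does, because the laws of \<open>Z\<close> do not
  concentrate on short intervals: their characteristic functions have a Gaussian bound near 0.
  Hence a sequence is consistent iff \<open>D\<close> is bounded away from 0, and inconsistent iff \<open>D \<rightarrow> 0\<close>.

  The first \<open>C k\<^sub>n\<close> weights \<open>\<kappa>\<^sub>j\<^sub>n\<^sup>2\<close> are of the same order \<open>n\<^sup>-\<^sup>2\<^sup>+\<^sup>2\<^sup>r\<close> and the later ones are smaller by a
  factor of order \<open>C\<^sup>-\<^sup>1\<^sup>/\<^sup>2\<close>, so that for \<open>\<parallel>f\<parallel>\<close> of order \<open>n\<^sup>-\<^sup>r\<close> these are conditions on the energy of \<open>f\<close> in the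
  first \<open>C k\<^sub>n\<close> coordinates. The projection onto these coordinates lies in a fixed multiple of the
  Besov ball, and functions in a ball have only a small part of their energy beyond them.
\<close>

subsection \<open>Coordinates in L2(0,1)\<close>

text \<open>The errors of a test add up to 1 minus the difference of its acceptance probabilities
  under the hypothesis and under \<open>f\<close>. Thresholds are arbitrary at each n and the
  weights change with n, so the bounds on this difference have to be uniform in thresholds and
  alternatives, with constants independent of n. They come from second moments and from one estimate
  for a single variable \<xi>^2 - 1, without passing to a limit law. That the largest weight
  vanishes, and that the head weights are comparable, rests on A4 with a \<delta>1 tending to 1,
  which compares the first weight with the one at \<open>C * k n\<close>. Consistency is asymptotic,
  whereas \<open>same_order\<close> and membership in a ball are required at every n \<ge> 1. The
  components and perturbations that are constructed must therefore be nonzero and of the right size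
  at exceptional n too. In the converse of (ii) the test perturbation is a projection of
  \<open>f\<close> itself: its inner product with \<open>f\<close> is the head energy, so a
  negligible cross term makes that energy negligible.\<close>

abbreviation unit_leb :: "real measure" where
  "unit_leb \<equiv> lebesgue_on {0<..<1}"

lemma L2_measurable: "f \<in> L2 \<Longrightarrow> f \<in> borel_measurable unit_leb"
  by (simp add: L2_def)

lemma L2_zero: "(\<lambda>_. 0) \<in> L2"
  by (simp add: L2_def)

lemma L2_integrable_mult:
  assumes "f \<in> L2" "g \<in> L2"
  shows "integrable unit_leb (\<lambda>t. f t * g t)"
proof (rule Bochner_Integration.integrable_bound)
  show "integrable unit_leb (\<lambda>t. (f t)\<^sup>2 + (g t)\<^sup>2)"
    using assms by (simp add: L2_def)
  show "(\<lambda>t. f t * g t) \<in> borel_measurable unit_leb"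
    using assms by (intro borel_measurable_times L2_measurable)
  have "\<bar>x * y\<bar> \<le> x\<^sup>2 + y\<^sup>2" for x y :: real
  proof -
    have "2 * \<bar>x\<bar> * \<bar>y\<bar> \<le> \<bar>x\<bar>\<^sup>2 + \<bar>y\<bar>\<^sup>2" by (rule sum_squares_bound)
    moreover have "0 \<le> \<bar>x\<bar> * \<bar>y\<bar>" by simp
    ultimately show ?thesis unfolding abs_mult power2_abs by linarith
  qed
  then show "AE t in unit_leb. norm (f t * g t) \<le> norm ((f t)\<^sup>2 + (g t)\<^sup>2)"
    by (auto intro!: AE_I2)
qed

lemma L2_lincomb:
  assumes "f \<in> L2" "g \<in> L2"
  shows "(\<lambda>t. a * f t + b * g t) \<in> L2"
proof -
  have "(\<lambda>t. (a * f t + b * g t)\<^sup>2) =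
      (\<lambda>t. a\<^sup>2 * (f t * f t) + b\<^sup>2 * (g t * g t) + 2 * a * b * (f t * g t))"
    by (auto simp: power2_eq_square algebra_simps)
  moreover have "integrable unit_leb
      (\<lambda>t. a\<^sup>2 * (f t * f t) + b\<^sup>2 * (g t * g t) + 2 * a * b * (f t * g t))"
    by (intro Bochner_Integration.integrable_add integrable_mult_right L2_integrable_mult assms)
  moreover have "(\<lambda>t. a * f t + b * g t) \<in> borel_measurable unit_leb"
    using assms[THEN L2_measurable] by measurable
  ultimately show ?thesis by (simp add: L2_def)
qed

lemma L2_add: "f \<in> L2 \<Longrightarrow> g \<in> L2 \<Longrightarrow> (\<lambda>t. f t + g t) \<in> L2"
  using L2_lincomb[of f g 1 1] by simp

lemma L2_diff: "f \<in> L2 \<Longrightarrow> g \<in> L2 \<Longrightarrow> (\<lambda>t. f t - g t) \<in> L2"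
  using L2_lincomb[of f g 1 "-1"] by simp

lemma L2_scale: "f \<in> L2 \<Longrightarrow> (\<lambda>t. c * f t) \<in> L2"
  using L2_lincomb[of f f c 0] by simp

lemma l2inner_commute: "l2inner f g = l2inner g f"
  by (simp add: l2inner_def mult.commute)

lemma l2inner_zero_left [simp]: "l2inner (\<lambda>_. 0) g = 0"
  by (simp add: l2inner_def)

lemma l2inner_lincomb:
  assumes "f \<in> L2" "g \<in> L2" "h \<in> L2"
  shows "l2inner (\<lambda>t. a * f t + b * g t) h = a * l2inner f h + b * l2inner g h"
proof -
  have "(\<lambda>t. (a * f t + b * g t) * h t) = (\<lambda>t. a * (f t * h t) + b * (g t * h t))"
    by (auto simp: algebra_simps)
  then show ?thesis
    using assms by (simp add: l2inner_def L2_integrable_mult)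
qed

lemma l2inner_add:
  "f \<in> L2 \<Longrightarrow> g \<in> L2 \<Longrightarrow> h \<in> L2 \<Longrightarrow> l2inner (\<lambda>t. f t + g t) h = l2inner f h + l2inner g h"
  using l2inner_lincomb[of f g h 1 1] by simp

lemma l2inner_diff:
  "f \<in> L2 \<Longrightarrow> g \<in> L2 \<Longrightarrow> h \<in> L2 \<Longrightarrow> l2inner (\<lambda>t. f t - g t) h = l2inner f h - l2inner g h"
  using l2inner_lincomb[of f g h 1 "-1"] by simp

lemma l2inner_scale: "f \<in> L2 \<Longrightarrow> h \<in> L2 \<Longrightarrow> l2inner (\<lambda>t. c * f t) h = c * l2inner f h"
  using l2inner_lincomb[of f f h c 0] by simp

lemma l2norm_nonneg [simp]: "0 \<le> l2norm f"
  by (simp add: l2norm_def)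

lemma l2norm_sq: "(l2norm f)\<^sup>2 = l2inner f f"
  by (simp add: l2norm_def l2inner_def power2_eq_square)

lemma l2norm_add_sq:
  assumes "f \<in> L2" "g \<in> L2"
  shows "(l2norm (\<lambda>t. f t + g t))\<^sup>2 = (l2norm f)\<^sup>2 + (l2norm g)\<^sup>2 + 2 * l2inner f g"
proof -
  let ?h = "\<lambda>t. f t + g t"
  have h: "?h \<in> L2" using assms by (rule L2_add)
  have "(l2norm ?h)\<^sup>2 = l2inner f ?h + l2inner g ?h"
    unfolding l2norm_sq by (rule l2inner_add[OF assms h])
  also have "l2inner f ?h = l2inner f f + l2inner g f"
    unfolding l2inner_commute[of f ?h] by (rule l2inner_add[OF assms assms(1)])
  also have "l2inner g ?h = l2inner f g + l2inner g g"
    unfolding l2inner_commute[of g ?h] by (rule l2inner_add[OF assms assms(2)])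
  finally show ?thesis by (simp add: l2norm_sq l2inner_commute[of g f])
qed

lemma l2norm_diff_sq:
  assumes "f \<in> L2" "g \<in> L2"
  shows "(l2norm (\<lambda>t. f t - g t))\<^sup>2 = (l2norm f)\<^sup>2 + (l2norm g)\<^sup>2 - 2 * l2inner f g"
proof -
  let ?h = "\<lambda>t. f t - g t"
  have h: "?h \<in> L2" using assms by (rule L2_diff)
  have "(l2norm ?h)\<^sup>2 = l2inner f ?h - l2inner g ?h"
    unfolding l2norm_sq by (rule l2inner_diff[OF assms h])
  also have "l2inner f ?h = l2inner f f - l2inner g f"
    unfolding l2inner_commute[of f ?h] by (rule l2inner_diff[OF assms assms(1)])
  also have "l2inner g ?h = l2inner f g - l2inner g g"
    unfolding l2inner_commute[of g ?h] by (rule l2inner_diff[OF assms assms(2)])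
  finally show ?thesis by (simp add: l2norm_sq l2inner_commute[of g f])
qed

lemma l2norm_scale: "f \<in> L2 \<Longrightarrow> l2norm (\<lambda>t. c * f t) = \<bar>c\<bar> * l2norm f"
proof -
  assume f: "f \<in> L2"
  let ?h = "\<lambda>t. c * f t"
  have "(l2norm ?h)\<^sup>2 = c * l2inner f ?h"
    unfolding l2norm_sq by (rule l2inner_scale[OF f L2_scale[OF f]])
  also have "l2inner f ?h = c * (l2norm f)\<^sup>2"
    unfolding l2norm_sq l2inner_commute[of f ?h] by (rule l2inner_scale[OF f f])
  finally have "(l2norm ?h)\<^sup>2 = (\<bar>c\<bar> * l2norm f)\<^sup>2"
    by (simp add: power_mult_distrib) (simp add: power2_eq_square)
  then show ?thesis by (simp add: power2_eq_iff_nonneg)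
qed

text \<open>The squared norm of f - x g is a nonnegative polynomial in x, evaluated at its minimum.
  Functions equal almost everywhere are not identified, so \<open>l2norm g = 0\<close> does not make
  g vanish and is a case of its own.\<close>

lemma l2_Cauchy_Schwarz:
  assumes f: "f \<in> L2" and g: "g \<in> L2"
  shows "\<bar>l2inner f g\<bar> \<le> l2norm f * l2norm g"
proof -
  have quad: "0 \<le> (l2norm f)\<^sup>2 + x\<^sup>2 * (l2norm g)\<^sup>2 - 2 * x * l2inner f g" for x
  proof -
    have "0 \<le> (l2norm (\<lambda>t. f t - x * g t))\<^sup>2" by simp
    also have "\<dots> = (l2norm f)\<^sup>2 + (l2norm (\<lambda>t. x * g t))\<^sup>2 - 2 * l2inner f (\<lambda>t. x * g t)"
      by (rule l2norm_diff_sq[OF f L2_scale[OF g]])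
    also have "\<dots> = (l2norm f)\<^sup>2 + x\<^sup>2 * (l2norm g)\<^sup>2 - 2 * x * l2inner f g"
      using f g by (simp add: l2norm_scale power_mult_distrib
          l2inner_commute[of f "\<lambda>t. x * g t"] l2inner_scale l2inner_commute[of g f])
    finally show ?thesis .
  qed
  have "(l2inner f g)\<^sup>2 \<le> (l2norm f * l2norm g)\<^sup>2"
  proof (cases "l2norm g = 0")
    case True
    have "l2inner f g = 0"
    proof (rule ccontr)
      \<comment> \<open>For \<open>l2norm g = 0\<close> the polynomial is affine in x, and a nonzero
        slope would make it negative at a suitable point.\<close>
      assume nz: "l2inner f g \<noteq> 0"
      have "0 \<le> (l2norm f)\<^sup>2 - 2 * ((l2norm f)\<^sup>2 + 1)"
        using quad[of "((l2norm f)\<^sup>2 + 1) / l2inner f g"] nz True by simp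
      moreover have "\<not> 0 \<le> x - 2 * (x + 1)" if "0 \<le> x" for x :: real using that by simp
      ultimately show False using zero_le_power2 by blast
    qed
    then show ?thesis by simp
  next
    case False
    define G where "G = (l2norm g)\<^sup>2"
    have G: "0 < G" using False by (simp add: G_def)
    have "0 \<le> (l2norm f)\<^sup>2 + (l2inner f g / G)\<^sup>2 * G - 2 * (l2inner f g / G) * l2inner f g"
      unfolding G_def by (rule quad)
    also have "\<dots> = (l2norm f)\<^sup>2 - (l2inner f g)\<^sup>2 / G"
      using G by (simp add: field_simps power2_eq_square)
    finally show ?thesis using G by (simp add: field_simps power_mult_distrib flip: G_def)
  qed
  then show ?thesis
    by (metis abs_le_square_iff abs_of_nonneg l2norm_nonneg mult_nonneg_nonneg)
qed

section \<open>Coefficients, projections and energies in the first coordinates\<close>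

definition coef :: "(nat \<Rightarrow> real \<Rightarrow> real) \<Rightarrow> (real \<Rightarrow> real) \<Rightarrow> nat \<Rightarrow> real" where
  "coef \<phi> f j = l2inner f (\<phi> (Suc j))"

definition energy :: "(nat \<Rightarrow> real \<Rightarrow> real) \<Rightarrow> nat \<Rightarrow> (real \<Rightarrow> real) \<Rightarrow> real" where
  "energy \<phi> m f = (\<Sum>j<m. (coef \<phi> f j)\<^sup>2)"

definition proj :: "(nat \<Rightarrow> real \<Rightarrow> real) \<Rightarrow> nat \<Rightarrow> (real \<Rightarrow> real) \<Rightarrow> real \<Rightarrow> real" where
  "proj \<phi> m f = (\<lambda>t. \<Sum>j<m. coef \<phi> f j * \<phi> (Suc j) t)"

lemma energy_nonneg [simp]: "0 \<le> energy \<phi> m f"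
  by (simp add: energy_def sum_nonneg)

lemma energy_mono: "m \<le> m' \<Longrightarrow> energy \<phi> m f \<le> energy \<phi> m' f"
  unfolding energy_def by (rule sum_mono2) auto

locale onb =
  fixes \<phi> :: "nat \<Rightarrow> real \<Rightarrow> real"
  assumes basis: "orthonormal_basis \<phi>"
begin

lemma phi_L2 [simp, intro]: "\<phi> (Suc j) \<in> L2"
  using basis by (auto simp: orthonormal_basis_def orthonormal_system_def)

lemma phi_inner: "l2inner (\<phi> (Suc i)) (\<phi> (Suc j)) = (if i = j then 1 else 0)"
  using basis by (auto simp: orthonormal_basis_def orthonormal_system_def)

lemma proj_L2 [simp, intro]: "proj \<phi> m f \<in> L2"
proof (induction m)
  case 0 then show ?case by (simp add: proj_def L2_zero)
next
  case (Suc m)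
  then show ?case
    using L2_lincomb[OF Suc phi_L2, of 1 "coef \<phi> f m" m] by (simp add: proj_def)
qed

lemma inner_proj:
  assumes "g \<in> L2"
  shows "l2inner (proj \<phi> m f) g = (\<Sum>j<m. coef \<phi> f j * coef \<phi> g j)"
proof (induction m)
  case 0 then show ?case by (simp add: proj_def)
next
  case (Suc m)
  then show ?case
    using l2inner_lincomb[OF proj_L2 phi_L2 assms, of 1 m f "coef \<phi> f m" m]
    by (simp add: proj_def coef_def l2inner_commute[of g])
qed

lemma coef_proj: "coef \<phi> (proj \<phi> m f) j = (if j < m then coef \<phi> f j else 0)"
proof -
  have "coef \<phi> (proj \<phi> m f) j = (\<Sum>i<m. coef \<phi> f i * coef \<phi> (\<phi> (Suc j)) i)"
    unfolding coef_def[of _ "proj \<phi> m f"] by (rule inner_proj) simp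
  also have "\<dots> = (\<Sum>i<m. if i = j then coef \<phi> f j else 0)"
    by (rule sum.cong) (auto simp: coef_def phi_inner)
  finally show ?thesis by simp
qed

lemma inner_proj_self: "f \<in> L2 \<Longrightarrow> l2inner f (proj \<phi> m f) = energy \<phi> m f"
  by (subst l2inner_commute) (simp add: inner_proj energy_def power2_eq_square)

lemma norm_proj: "(l2norm (proj \<phi> m f))\<^sup>2 = energy \<phi> m f"
  by (simp add: l2norm_sq inner_proj energy_def coef_proj) (simp add: power2_eq_square)

lemma energy_proj: "energy \<phi> l (proj \<phi> m f) = energy \<phi> (min l m) f"
proof -
  have "energy \<phi> l (proj \<phi> m f) = (\<Sum>j\<in>{..<l}. if j \<in> {..<m} then (coef \<phi> f j)\<^sup>2 else 0)"
    unfolding energy_def by (rule sum.cong) (auto simp: coef_proj)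
  also have "\<dots> = (\<Sum>j\<in>{..<l} \<inter> {..<m}. (coef \<phi> f j)\<^sup>2)"
    by (rule sum.inter_restrict[symmetric]) simp
  also have "{..<l} \<inter> {..<m} = {..<min l m}" by auto
  finally show ?thesis by (simp add: energy_def)
qed

lemma norm_sub_proj: "f \<in> L2 \<Longrightarrow> (l2norm (\<lambda>t. f t - proj \<phi> m f t))\<^sup>2 = (l2norm f)\<^sup>2 - energy \<phi> m f"
  by (simp add: l2norm_diff_sq norm_proj inner_proj_self)

lemma energy_le: "f \<in> L2 \<Longrightarrow> energy \<phi> m f \<le> (l2norm f)\<^sup>2"
  using norm_sub_proj[of f m] zero_le_power2[of "l2norm (\<lambda>t. f t - proj \<phi> m f t)"] by linarith

lemma coef_sums:
  assumes "f \<in> L2"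
  shows "(\<lambda>j. (coef \<phi> f j)\<^sup>2) sums (l2norm f)\<^sup>2"
proof -
  have "(\<lambda>N. l2norm (\<lambda>t. f t - (\<Sum>j=1..N. l2inner f (\<phi> j) * \<phi> j t))) \<longlonglongrightarrow> 0"
    using basis assms by (auto simp: orthonormal_basis_def)
  moreover have "(\<Sum>j=1..N. l2inner f (\<phi> j) * \<phi> j t) = proj \<phi> N f t" for N t
    unfolding proj_def coef_def by (induction N) simp_all
  ultimately have "(\<lambda>N. l2norm (\<lambda>t. f t - proj \<phi> N f t)) \<longlonglongrightarrow> 0" by simp
  then have "(\<lambda>N. (l2norm (\<lambda>t. f t - proj \<phi> N f t))\<^sup>2) \<longlonglongrightarrow> 0\<^sup>2" by (rule tendsto_power)
  then have "(\<lambda>N. (l2norm f)\<^sup>2 - ((l2norm f)\<^sup>2 - energy \<phi> N f)) \<longlonglongrightarrow> (l2norm f)\<^sup>2 - 0"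
    using assms by (intro tendsto_diff) (simp_all add: norm_sub_proj)
  then show ?thesis by (simp add: sums_def energy_def)
qed

lemma energy_tendsto: "f \<in> L2 \<Longrightarrow> (\<lambda>m. energy \<phi> m f) \<longlonglongrightarrow> (l2norm f)\<^sup>2"
  using coef_sums[of f] by (simp add: sums_def energy_def)

text \<open>A real \<open>l\<close> matters only through its integer part, so the tail in the ball
  condition is the total minus a finite sum. For negative \<open>l\<close> the truncation by
  \<open>nat\<close> makes that sum empty, and the identity persists.\<close>

lemma tail_series:
  assumes "f \<in> L2"
  shows "(\<Sum>j. if l < real (Suc j) then (l2inner f (\<phi> (Suc j)))\<^sup>2 else 0)
    = (l2norm f)\<^sup>2 - energy \<phi> (nat \<lfloor>l\<rfloor>) f"
proof -
  let ?m = "nat \<lfloor>l\<rfloor>"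
  have iff: "l < real (Suc j) \<longleftrightarrow> \<not> j < ?m" for j
    by linarith
  have "(\<lambda>j. if j \<in> {..<?m} then (coef \<phi> f j)\<^sup>2 else 0) sums energy \<phi> ?m f"
    unfolding energy_def by (rule sums_If_finite_set) simp
  from sums_diff[OF coef_sums[OF assms] this]
  have "(\<lambda>j. (coef \<phi> f j)\<^sup>2 - (if j \<in> {..<?m} then (coef \<phi> f j)\<^sup>2 else 0))
      sums ((l2norm f)\<^sup>2 - energy \<phi> ?m f)" .
  moreover have "(\<lambda>j. (coef \<phi> f j)\<^sup>2 - (if j \<in> {..<?m} then (coef \<phi> f j)\<^sup>2 else 0))
      = (\<lambda>j. if l < real (Suc j) then (l2inner f (\<phi> (Suc j)))\<^sup>2 else 0)"
    unfolding iff by (auto simp: coef_def)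
  ultimately show ?thesis by (simp add: sums_iff)
qed

lemma besov_ball_iff:
  "f \<in> besov_ball \<phi> s P0 \<longleftrightarrow>
    f \<in> L2 \<and> (\<forall>l>0. l powr (2 * s) * ((l2norm f)\<^sup>2 - energy \<phi> (nat \<lfloor>l\<rfloor>) f) \<le> P0)"
proof (cases "f \<in> L2")
  case True
  then show ?thesis
    unfolding besov_ball_def mem_Collect_eq tail_series[OF True] SUP_le_iff by auto
qed (simp add: besov_ball_def)

lemma coef_scale: "f \<in> L2 \<Longrightarrow> coef \<phi> (\<lambda>t. c * f t) j = c * coef \<phi> f j"
  by (simp add: coef_def l2inner_scale)

lemma energy_scale: "f \<in> L2 \<Longrightarrow> energy \<phi> m (\<lambda>t. c * f t) = c\<^sup>2 * energy \<phi> m f"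
  by (simp add: energy_def coef_scale power_mult_distrib sum_distrib_left)

text \<open>Energies scale by \<open>\<gamma>\<^sup>2\<close>, so a multiple of a ball is a ball of
  radius \<open>\<gamma>\<^sup>2 * P0\<close>: the freedom in \<open>\<gamma>\<close> is the freedom
  in the radius.\<close>

lemma scaled_ball_iff:
  assumes "\<gamma> > 0"
  shows "f \<in> scale_set \<gamma> (besov_ball \<phi> s P0) \<longleftrightarrow>
    f \<in> L2 \<and> (\<forall>l>0. l powr (2 * s) * ((l2norm f)\<^sup>2 - energy \<phi> (nat \<lfloor>l\<rfloor>) f) \<le> \<gamma>\<^sup>2 * P0)"
    (is "_ \<longleftrightarrow> ?R")
proof
  assume "f \<in> scale_set \<gamma> (besov_ball \<phi> s P0)"
  then obtain g where g: "g \<in> L2" "\<forall>l>0. l powr (2 * s) * ((l2norm g)\<^sup>2 - energy \<phi> (nat \<lfloor>l\<rfloor>) g) \<le> P0"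
    and f: "f = (\<lambda>t. \<gamma> * g t)"
    by (auto simp: scale_set_def besov_ball_iff)
  have eq: "l powr (2 * s) * ((l2norm f)\<^sup>2 - energy \<phi> (nat \<lfloor>l\<rfloor>) f)
      = \<gamma>\<^sup>2 * (l powr (2 * s) * ((l2norm g)\<^sup>2 - energy \<phi> (nat \<lfloor>l\<rfloor>) g))" for l
    unfolding f l2norm_scale[OF g(1)] energy_scale[OF g(1)] power_mult_distrib power2_abs
    by (simp only: right_diff_distrib mult.left_commute)
  have "f \<in> L2" unfolding f by (rule L2_scale[OF g(1)])
  then show ?R unfolding eq using g(2) by (simp add: mult_left_mono)
next
  assume R: ?R
  define g where "g = (\<lambda>t. (1 / \<gamma>) * f t)"
  have f: "f = (\<lambda>t. \<gamma> * g t)" using assms by (simp add: g_def)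
  have fL: "f \<in> L2" using R by simp
  have eq: "l powr (2 * s) * ((l2norm g)\<^sup>2 - energy \<phi> (nat \<lfloor>l\<rfloor>) g)
      = (1 / \<gamma>)\<^sup>2 * (l powr (2 * s) * ((l2norm f)\<^sup>2 - energy \<phi> (nat \<lfloor>l\<rfloor>) f))" for l
    unfolding g_def l2norm_scale[OF fL] energy_scale[OF fL] power_mult_distrib power2_abs
    by (simp only: right_diff_distrib mult.left_commute)
  have "(1 / \<gamma>)\<^sup>2 * (l powr (2 * s) * ((l2norm f)\<^sup>2 - energy \<phi> (nat \<lfloor>l\<rfloor>) f)) \<le> P0" if "l > 0" for l
  proof -
    have "(1 / \<gamma>)\<^sup>2 * (l powr (2 * s) * ((l2norm f)\<^sup>2 - energy \<phi> (nat \<lfloor>l\<rfloor>) f))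
        \<le> (1 / \<gamma>)\<^sup>2 * (\<gamma>\<^sup>2 * P0)"
      using R that by (intro mult_left_mono) auto
    also have "\<dots> = P0" using assms by (simp add: power_divide)
    finally show ?thesis .
  qed
  then have "g \<in> besov_ball \<phi> s P0"
    unfolding besov_ball_iff eq using L2_scale[OF fL, of "1 / \<gamma>"] by (simp add: g_def)
  then show "f \<in> scale_set \<gamma> (besov_ball \<phi> s P0)"
    unfolding scale_set_def using f by blast
qed

text \<open>Splitting \<open>f = proj f + (f - proj f)\<close>; the second part is orthogonal to \<open>proj g\<close>.\<close>

lemma inner_split_bound:
  assumes f: "f \<in> L2" and g: "g \<in> L2"
  shows "\<bar>l2inner f g\<bar> \<le> sqrt (energy \<phi> m f) * l2norm g
    + l2norm f * sqrt ((l2norm g)\<^sup>2 - energy \<phi> m g)"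
proof -
  let ?f = "\<lambda>t. f t - proj \<phi> m f t" and ?g = "\<lambda>t. g t - proj \<phi> m g t"
  have fp: "?f \<in> L2" and gp: "?g \<in> L2" using f g by (auto intro: L2_diff)
  have "l2inner ?f (proj \<phi> m g) = (\<Sum>j<m. coef \<phi> g j * coef \<phi> f j) - (\<Sum>j<m. coef \<phi> f j * coef \<phi> g j)"
    unfolding l2inner_diff[OF f proj_L2 proj_L2] l2inner_commute[of f]
    by (simp add: inner_proj f coef_proj)
  then have orth: "l2inner (proj \<phi> m g) ?f = 0"
    by (simp add: mult.commute l2inner_commute[of _ ?f])
  have "l2inner ?f ?g = l2inner ?g ?f" by (rule l2inner_commute)
  also have "\<dots> = l2inner g ?f" using orth by (simp add: l2inner_diff[OF g proj_L2 fp])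
  also have "\<dots> = l2inner ?f g" by (rule l2inner_commute)
  also have "\<dots> = l2inner f g - l2inner (proj \<phi> m f) g" by (rule l2inner_diff[OF f proj_L2 g])
  finally have "l2inner f g = l2inner (proj \<phi> m f) g + l2inner ?f ?g" by simp
  then have le: "\<bar>l2inner f g\<bar> \<le> l2norm (proj \<phi> m f) * l2norm g + l2norm ?f * l2norm ?g"
    using l2_Cauchy_Schwarz[OF proj_L2 g, of m f] l2_Cauchy_Schwarz[OF fp gp] by linarith
  have norms: "l2norm (proj \<phi> m f) = sqrt (energy \<phi> m f)"
      "l2norm ?g = sqrt ((l2norm g)\<^sup>2 - energy \<phi> m g)"
    by (simp add: norm_proj[symmetric], simp only: norm_sub_proj[OF g, symmetric] real_sqrt_abs l2norm_nonneg abs_of_nonneg)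
  have "(l2norm ?f)\<^sup>2 \<le> (l2norm f)\<^sup>2" unfolding norm_sub_proj[OF f] by simp
  then have "l2norm ?f \<le> l2norm f" by (rule power2_le_imp_le) simp
  then have "l2norm ?f * l2norm ?g \<le> l2norm f * l2norm ?g" by (rule mult_right_mono) simp
  with le show ?thesis unfolding norms by linarith
qed

text \<open>The triangle inequality for the Euclidean norm of the first m coefficients, applied to g
  = (f + g) - f. It shows that a small head of \<open>f\<close> cannot cancel a large head of
  \<open>g\<close>.\<close>

lemma sqrt_energy_add_ge:
  assumes f: "f \<in> L2" and g: "g \<in> L2"
  shows "sqrt (energy \<phi> m g) \<le> sqrt (energy \<phi> m (\<lambda>t. f t + g t)) + sqrt (energy \<phi> m f)"
proof -
  have "coef \<phi> g j = coef \<phi> (\<lambda>t. f t + g t) j + - coef \<phi> f j" for j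
    using f g by (simp add: coef_def l2inner_add)
  then have "coef \<phi> g = (\<lambda>j. coef \<phi> (\<lambda>t. f t + g t) j + - coef \<phi> f j)" by blast
  then have "L2_set (coef \<phi> g) {..<m} 
      \<le> L2_set (coef \<phi> (\<lambda>t. f t + g t)) {..<m} + L2_set (\<lambda>j. - coef \<phi> f j) {..<m}"
    using L2_set_triangle_ineq by metis
  then show ?thesis by (simp add: L2_set_def energy_def)
qed

end

subsection \<open>Quadratic forms in independent Gaussian variables\<close>

text \<open>Each new summand is centered and independent of the partial sum, which removes the cross
  term. Integrability of the square is carried along because the induction step uses it.\<close>

lemma (in prob_space) expectation_sum_indep_sq:
  fixes X :: "nat \<Rightarrow> 'a \<Rightarrow> real"
  assumes indep: "indep_vars (\<lambda>_. borel) X UNIV"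
    and int: "\<And>j. integrable M (X j)" "\<And>j. integrable M (\<lambda>\<omega>. (X j \<omega>)\<^sup>2)"
    and mean: "\<And>j. expectation (X j) = 0"
  shows "integrable M (\<lambda>\<omega>. (\<Sum>j<N. X j \<omega>)\<^sup>2) \<and>
    expectation (\<lambda>\<omega>. (\<Sum>j<N. X j \<omega>)\<^sup>2) = (\<Sum>j<N. expectation (\<lambda>\<omega>. (X j \<omega>)\<^sup>2))"
proof (induction N)
  case 0 then show ?case by simp
next
  case (Suc N)
  let ?S = "\<lambda>\<omega>. \<Sum>j<N. X j \<omega>"
  have "indep_vars (\<lambda>_. borel) X (insert N {..<N})"
    by (rule indep_vars_subset[OF indep]) simp
  then have iv: "indep_var borel (X N) borel ?S"
    by (intro indep_vars_sum) auto
  have intS: "integrable M ?S" using int by auto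
  have prod: "integrable M (\<lambda>\<omega>. X N \<omega> * ?S \<omega>)"
    by (rule indep_var_integrable[OF iv int(1) intS])
  have prod0: "expectation (\<lambda>\<omega>. X N \<omega> * ?S \<omega>) = 0"
    using indep_var_lebesgue_integral[OF iv int(1) intS] mean by simp
  have eq: "(\<Sum>j<Suc N. X j \<omega>)\<^sup>2 = (?S \<omega>)\<^sup>2 + (X N \<omega>)\<^sup>2 + 2 * (X N \<omega> * ?S \<omega>)" for \<omega>
    by (simp add: power2_eq_square algebra_simps)
  show ?case unfolding eq using Suc int prod prod0 by simp
qed

text \<open>Almost sure convergence and Fatou's lemma carry the variance bound from the partial sums
  to the series, so that no convergence in mean square has to be proved.\<close>

lemma (in prob_space) series_Chebyshev:
  fixes X :: "nat \<Rightarrow> 'a \<Rightarrow> real"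
  assumes indep: "indep_vars (\<lambda>_. borel) X UNIV"
    and int: "\<And>j. integrable M (X j)" "\<And>j. integrable M (\<lambda>\<omega>. (X j \<omega>)\<^sup>2)"
    and mean: "\<And>j. expectation (X j) = 0"
    and var: "\<And>j. expectation (\<lambda>\<omega>. (X j \<omega>)\<^sup>2) = v j" and sv: "summable v"
    and conv: "AE \<omega> in M. summable (\<lambda>j. X j \<omega>)"
    and t: "0 < t"
  shows "prob {\<omega> \<in> space M. t \<le> \<bar>\<Sum>j. X j \<omega>\<bar>} \<le> (\<Sum>j. v j) / t\<^sup>2"
proof -
  have [measurable]: "X j \<in> borel_measurable M" for j using int(1)[of j] by auto
  have v0: "0 \<le> v j" for j unfolding var[symmetric] by (rule integral_nonneg_AE) auto
  have "(\<integral>\<^sup>+\<omega>. ennreal ((\<Sum>j. X j \<omega>)\<^sup>2) \<partial>M)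
      = (\<integral>\<^sup>+\<omega>. liminf (\<lambda>N. ennreal ((\<Sum>j<N. X j \<omega>)\<^sup>2)) \<partial>M)"
  proof (rule nn_integral_cong_AE)
    show "AE \<omega> in M. ennreal ((\<Sum>j. X j \<omega>)\<^sup>2) = liminf (\<lambda>N. ennreal ((\<Sum>j<N. X j \<omega>)\<^sup>2))"
      using conv
    proof eventually_elim
      case (elim \<omega>)
      then have "(\<lambda>N. ennreal ((\<Sum>j<N. X j \<omega>)\<^sup>2)) \<longlonglongrightarrow> ennreal ((\<Sum>j. X j \<omega>)\<^sup>2)"
        by (intro tendsto_ennrealI tendsto_power summable_LIMSEQ)
      then show ?case by (rule lim_imp_Liminf[OF sequentially_bot, symmetric])
    qed
  qed
  also have "\<dots> \<le> liminf (\<lambda>N. \<integral>\<^sup>+\<omega>. ennreal ((\<Sum>j<N. X j \<omega>)\<^sup>2) \<partial>M)"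
    by (rule nn_integral_liminf) measurable
  also have "\<dots> \<le> liminf (\<lambda>N::nat. ennreal (\<Sum>j. v j))"
  proof (intro Liminf_mono always_eventually allI)
    fix N
    have "(\<integral>\<^sup>+\<omega>. ennreal ((\<Sum>j<N. X j \<omega>)\<^sup>2) \<partial>M) = ennreal (\<Sum>j<N. v j)"
      using expectation_sum_indep_sq[OF indep int mean, of N]
      by (subst nn_integral_eq_integral) (auto simp: var)
    then show "(\<integral>\<^sup>+\<omega>. ennreal ((\<Sum>j<N. X j \<omega>)\<^sup>2) \<partial>M) \<le> ennreal (\<Sum>j. v j)"
      using sum_le_suminf[OF sv, of "{..<N}"] v0 by (simp add: ennreal_leI)
  qed
  also have "\<dots> = ennreal (\<Sum>j. v j)" by (simp add: Liminf_const)
  finally have sq: "(\<integral>\<^sup>+\<omega>. ennreal ((\<Sum>j. X j \<omega>)\<^sup>2) \<partial>M) \<le> ennreal (\<Sum>j. v j)" .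
  have "emeasure M {\<omega> \<in> space M. t \<le> \<bar>\<Sum>j. X j \<omega>\<bar>}
      \<le> emeasure M {\<omega> \<in> space M. 1 \<le> ennreal (1 / t\<^sup>2) * ennreal ((\<Sum>j. X j \<omega>)\<^sup>2)}"
  proof (rule emeasure_mono)
    show "{\<omega> \<in> space M. t \<le> \<bar>\<Sum>j. X j \<omega>\<bar>}
        \<subseteq> {\<omega> \<in> space M. 1 \<le> ennreal (1 / t\<^sup>2) * ennreal ((\<Sum>j. X j \<omega>)\<^sup>2)}"
    proof safe
      fix \<omega> assume "t \<le> \<bar>\<Sum>j. X j \<omega>\<bar>"
      then have "t\<^sup>2 \<le> (\<Sum>j. X j \<omega>)\<^sup>2"
        using t by (metis abs_le_square_iff abs_of_pos)
      then have "1 \<le> 1 / t\<^sup>2 * (\<Sum>j. X j \<omega>)\<^sup>2" using t by (simp add: field_simps)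
      then have "ennreal 1 \<le> ennreal (1 / t\<^sup>2 * (\<Sum>j. X j \<omega>)\<^sup>2)" by (rule ennreal_leI)
      then show "1 \<le> ennreal (1 / t\<^sup>2) * ennreal ((\<Sum>j. X j \<omega>)\<^sup>2)"
        by (simp add: ennreal_mult'[symmetric])
    qed
  qed measurable
  also have "\<dots> \<le> ennreal (1 / t\<^sup>2) * (\<integral>\<^sup>+\<omega>. ennreal ((\<Sum>j. X j \<omega>)\<^sup>2) * indicator (space M) \<omega> \<partial>M)"
    by (rule nn_integral_Markov_inequality) measurable
  also have "(\<integral>\<^sup>+\<omega>. ennreal ((\<Sum>j. X j \<omega>)\<^sup>2) * indicator (space M) \<omega> \<partial>M) = (\<integral>\<^sup>+\<omega>. ennreal ((\<Sum>j. X j \<omega>)\<^sup>2) \<partial>M)"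
    by (rule nn_integral_cong) simp
  also have "ennreal (1 / t\<^sup>2) * \<dots> \<le> ennreal (1 / t\<^sup>2) * ennreal (\<Sum>j. v j)"
    by (rule mult_left_mono[OF sq]) simp
  also have "\<dots> = ennreal ((\<Sum>j. v j) / t\<^sup>2)"
    using suminf_nonneg[OF sv v0] t by (simp add: ennreal_mult'[symmetric])
  finally show ?thesis
    using suminf_nonneg[OF sv v0] t by (simp add: emeasure_eq_measure)
qed

section \<open>Weighted sums of Gaussian variables and of their squares\<close>

locale gauss_seq = prob_space M for M :: "'a measure" +
  fixes \<xi> :: "nat \<Rightarrow> 'a \<Rightarrow> real"
  assumes indep: "indep_vars (\<lambda>_. borel) \<xi> UNIV"
    and normal: "\<And>j. distributed M lborel (\<xi> j) std_normal_density"
begin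

lemma rv [measurable]: "\<xi> j \<in> borel_measurable M"
  using normal[of j] distributed_measurable by fastforce

lemma moment_integrable: "integrable M (\<lambda>\<omega>. \<xi> j \<omega> ^ k)"
  using distributed_integrable[OF normal[of j], of "\<lambda>x. x ^ k"] integrable_std_normal_moment[of k]
  by simp

lemma moment: "expectation (\<lambda>\<omega>. \<xi> j \<omega> ^ k) = (\<integral>x. std_normal_density x * x ^ k \<partial>lborel)"
  using distributed_integral[OF normal[of j], of "\<lambda>x. x ^ k"] by simp

lemma mean_xi: "expectation (\<xi> j) = 0"
  using moment[of j 1] integral_std_normal_moment_odd[of 0] by simp

lemma var_xi: "expectation (\<lambda>\<omega>. (\<xi> j \<omega>)\<^sup>2) = 1"
  using moment[of j 2] integral_std_normal_moment_even[of 1] by simp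

lemma fourth_xi: "expectation (\<lambda>\<omega>. \<xi> j \<omega> ^ 4) = 3"
  using moment[of j 4] integral_std_normal_moment_even[of 2] by (simp add: fact_numeral)

lemma centered_sq:
  shows "integrable M (\<lambda>\<omega>. (\<xi> j \<omega>)\<^sup>2 - 1)" "integrable M (\<lambda>\<omega>. ((\<xi> j \<omega>)\<^sup>2 - 1)\<^sup>2)"
    "expectation (\<lambda>\<omega>. (\<xi> j \<omega>)\<^sup>2 - 1) = 0" "expectation (\<lambda>\<omega>. ((\<xi> j \<omega>)\<^sup>2 - 1)\<^sup>2) = 2"
proof -
  have eq: "((\<xi> j \<omega>)\<^sup>2 - 1)\<^sup>2 = \<xi> j \<omega> ^ 4 - 2 * (\<xi> j \<omega>)\<^sup>2 + 1" for \<omega>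
    by (simp add: power2_eq_square power4_eq_xxxx algebra_simps)
  show "integrable M (\<lambda>\<omega>. (\<xi> j \<omega>)\<^sup>2 - 1)" "integrable M (\<lambda>\<omega>. ((\<xi> j \<omega>)\<^sup>2 - 1)\<^sup>2)"
    "expectation (\<lambda>\<omega>. (\<xi> j \<omega>)\<^sup>2 - 1) = 0" "expectation (\<lambda>\<omega>. ((\<xi> j \<omega>)\<^sup>2 - 1)\<^sup>2) = 2"
    unfolding eq by (simp_all add: moment_integrable var_xi fourth_xi prob_space)
qed

lemma indep_compose: "(\<And>j. g j \<in> borel_measurable borel) \<Longrightarrow>
    indep_vars (\<lambda>_. borel) (\<lambda>j \<omega>. g j (\<xi> j \<omega>) :: real) UNIV"
  by (rule indep_vars_compose2[OF indep]) auto

text \<open>The expectation of this nonnegative series is the sum of the weights; since that is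
  finite, so is the series almost surely.\<close>

lemma AE_summable_sq:
  assumes b: "\<And>j. 0 \<le> b j" and sb: "summable b"
  shows "AE \<omega> in M. summable (\<lambda>j. b j * (\<xi> j \<omega>)\<^sup>2)"
proof -
  have "(\<integral>\<^sup>+\<omega>. (\<Sum>j. ennreal (b j * (\<xi> j \<omega>)\<^sup>2)) \<partial>M) = (\<Sum>j. \<integral>\<^sup>+\<omega>. ennreal (b j * (\<xi> j \<omega>)\<^sup>2) \<partial>M)"
    by (rule nn_integral_suminf) measurable
  also have "\<dots> = (\<Sum>j. ennreal (b j))"
    using b by (subst nn_integral_eq_integral) (auto simp: moment_integrable var_xi)
  also have "\<dots> \<noteq> \<infinity>" using b sb by (simp add: suminf_ennreal2)
  finally have "AE \<omega> in M. (\<Sum>j. ennreal (b j * (\<xi> j \<omega>)\<^sup>2)) \<noteq> \<infinity>"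
    by (intro nn_integral_PInf_AE) measurable
  then show ?thesis
  proof eventually_elim
    case (elim \<omega>)
    then show ?case using b by (intro summable_suminf_not_top) auto
  qed
qed

text \<open>In \<open>Zs\<close> the centering stands inside the series, which makes it a sum of
  independent mean zero terms; in \<open>Ss\<close> the two series are separate, as in the test
  statistic. Convergence is only almost sure and \<open>suminf\<close> is unspecified elsewhere, so
  the relations between the three are almost sure ones.\<close>

definition Zs :: "(nat \<Rightarrow> real) \<Rightarrow> 'a \<Rightarrow> real" where
  "Zs b \<omega> = (\<Sum>j. b j * ((\<xi> j \<omega>)\<^sup>2 - 1))"

definition Ws :: "(nat \<Rightarrow> real) \<Rightarrow> (nat \<Rightarrow> real) \<Rightarrow> 'a \<Rightarrow> real" where
  "Ws b x \<omega> = (\<Sum>j. 2 * b j * x j * \<xi> j \<omega>)"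

definition Ss :: "(nat \<Rightarrow> real) \<Rightarrow> (nat \<Rightarrow> real) \<Rightarrow> 'a \<Rightarrow> real" where
  "Ss b x \<omega> = (\<Sum>j. b j * (x j + \<xi> j \<omega>)\<^sup>2) - (\<Sum>j. b j)"

lemma measurable_stats [measurable]:
  "Zs b \<in> borel_measurable M" "Ws b x \<in> borel_measurable M" "Ss b x \<in> borel_measurable M"
  unfolding Zs_def Ws_def Ss_def by measurable

end

text \<open>\<open>\<beta>\<close> bounds the influence of a single coordinate. The error terms in
  the estimates below carry it as a factor, and it tends to 0 in the application.\<close>

locale gauss_weights = gauss_seq +
  fixes b :: "nat \<Rightarrow> real" and \<beta> :: real
  assumes b_nonneg: "\<And>j. 0 \<le> b j" and b_le: "\<And>j. b j \<le> \<beta>" and b_summable: "summable b"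
begin

lemma beta_nonneg: "0 \<le> \<beta>" using b_nonneg[of 0] b_le[of 0] by linarith

lemma summable_b_mult: "summable y \<Longrightarrow> (\<And>j. 0 \<le> y j) \<Longrightarrow> summable (\<lambda>j. b j * y j)"
  by (rule summable_comparison_test'[of "\<lambda>j. \<beta> * y j" 0])
     (auto simp: b_nonneg intro!: mult_right_mono b_le summable_mult)

lemma summable_b_sq: "summable (\<lambda>j. (b j)\<^sup>2)"
  unfolding power2_eq_square by (intro summable_b_mult b_summable b_nonneg)

lemma AE_Zs: "AE \<omega> in M. summable (\<lambda>j. b j * ((\<xi> j \<omega>)\<^sup>2 - 1))"
  using AE_summable_sq[OF b_nonneg b_summable]
proof eventually_elim
  case (elim \<omega>)
  then have sm: "summable (\<lambda>j. b j * (\<xi> j \<omega>)\<^sup>2)" .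
  have "b j * ((\<xi> j \<omega>)\<^sup>2 - 1) = b j * (\<xi> j \<omega>)\<^sup>2 - b j" for j
    by (simp add: right_diff_distrib)
  then show ?case using summable_diff[OF sm b_summable] by presburger
qed

lemma AE_Ws:
  assumes x: "summable (\<lambda>j. (x j)\<^sup>2)"
  shows "AE \<omega> in M. summable (\<lambda>j. 2 * b j * x j * \<xi> j \<omega>)"
  using AE_summable_sq[OF b_nonneg b_summable]
proof eventually_elim
  case (elim \<omega>)
  show ?case
  proof (rule summable_comparison_test')
    show "summable (\<lambda>j. b j * (x j)\<^sup>2 + b j * (\<xi> j \<omega>)\<^sup>2)"
      by (rule summable_add[OF summable_b_mult[OF x] elim]) simp
    fix j
    have "2 * \<bar>x j\<bar> * \<bar>\<xi> j \<omega>\<bar> \<le> (x j)\<^sup>2 + (\<xi> j \<omega>)\<^sup>2"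
      using sum_squares_bound[of "\<bar>x j\<bar>" "\<bar>\<xi> j \<omega>\<bar>"] by simp
    from mult_left_mono[OF this b_nonneg[of j]]
    show "norm (2 * b j * x j * \<xi> j \<omega>) \<le> b j * (x j)\<^sup>2 + b j * (\<xi> j \<omega>)\<^sup>2"
      using b_nonneg[of j] by (simp add: abs_mult algebra_simps)
  qed
qed

lemma AE_summable_shift:
  assumes x: "summable (\<lambda>j. (x j)\<^sup>2)"
  shows "AE \<omega> in M. summable (\<lambda>j. b j * (x j + \<xi> j \<omega>)\<^sup>2)"
  using AE_summable_sq[OF b_nonneg b_summable]
proof eventually_elim
  case (elim \<omega>)
  show ?case
  proof (rule summable_comparison_test')
    show "summable (\<lambda>j. 2 * (b j * (x j)\<^sup>2 + b j * (\<xi> j \<omega>)\<^sup>2))"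
      by (rule summable_mult[OF summable_add[OF summable_b_mult[OF x] elim]]) simp
    fix j
    have "(x j + \<xi> j \<omega>)\<^sup>2 \<le> 2 * ((x j)\<^sup>2 + (\<xi> j \<omega>)\<^sup>2)"
      using sum_squares_bound[of "x j" "\<xi> j \<omega>"] by (simp add: power2_sum)
    from mult_left_mono[OF this b_nonneg[of j]]
    show "norm (b j * (x j + \<xi> j \<omega>)\<^sup>2) \<le> 2 * (b j * (x j)\<^sup>2 + b j * (\<xi> j \<omega>)\<^sup>2)"
      using b_nonneg[of j] by (simp add: abs_mult algebra_simps)
  qed
qed

lemma AE_decomp:
  assumes x: "summable (\<lambda>j. (x j)\<^sup>2)"
  shows "AE \<omega> in M. Ss b x \<omega> = Zs b \<omega> + Ws b x \<omega> + (\<Sum>j. b j * (x j)\<^sup>2)"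
  using AE_summable_sq[OF b_nonneg b_summable] AE_Ws[OF x]
proof eventually_elim
  case (elim \<omega>)
  have D: "summable (\<lambda>j. b j * (x j)\<^sup>2)" by (intro summable_b_mult x) auto
  have "(\<lambda>j. b j * (\<xi> j \<omega>)\<^sup>2 - b j + 2 * b j * x j * \<xi> j \<omega> + b j * (x j)\<^sup>2 + b j) sums
      ((\<Sum>j. b j * (\<xi> j \<omega>)\<^sup>2 - b j) + (\<Sum>j. 2 * b j * x j * \<xi> j \<omega>) + (\<Sum>j. b j * (x j)\<^sup>2) + (\<Sum>j. b j))"
    using elim D b_summable by (intro sums_add summable_sums summable_diff)
  moreover have "b j * (\<xi> j \<omega>)\<^sup>2 - b j + 2 * b j * x j * \<xi> j \<omega> + b j * (x j)\<^sup>2 + b j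
      = b j * (x j + \<xi> j \<omega>)\<^sup>2" for j
    by (simp add: power2_sum algebra_simps)
  ultimately have "(\<Sum>j. b j * (x j + \<xi> j \<omega>)\<^sup>2) = 
      (\<Sum>j. b j * (\<xi> j \<omega>)\<^sup>2 - b j) + (\<Sum>j. 2 * b j * x j * \<xi> j \<omega>) + (\<Sum>j. b j * (x j)\<^sup>2) + (\<Sum>j. b j)"
    by (simp add: sums_iff)
  then show ?case by (simp add: Ss_def Zs_def Ws_def right_diff_distrib)
qed

lemma AE_null: "AE \<omega> in M. Ss b (\<lambda>_. 0) \<omega> = Zs b \<omega>"
  using AE_decomp[of "\<lambda>_. 0"] by (simp add: Ws_def)

lemma prob_Zs_ge:
  assumes "0 < t"
  shows "prob {\<omega> \<in> space M. t \<le> \<bar>Zs b \<omega>\<bar>} \<le> 2 * (\<Sum>j. (b j)\<^sup>2) / t\<^sup>2"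
proof -
  have "prob {\<omega> \<in> space M. t \<le> \<bar>\<Sum>j. b j * ((\<xi> j \<omega>)\<^sup>2 - 1)\<bar>} \<le> (\<Sum>j. 2 * (b j)\<^sup>2) / t\<^sup>2"
  proof (rule series_Chebyshev[OF _ _ _ _ _ _ AE_Zs assms])
    show "indep_vars (\<lambda>_. borel) (\<lambda>j \<omega>. b j * ((\<xi> j \<omega>)\<^sup>2 - 1)) UNIV"
      by (rule indep_compose) measurable
  qed (auto simp: centered_sq power_mult_distrib summable_b_sq)
  then show ?thesis by (simp add: Zs_def suminf_mult[OF summable_b_sq])
qed

text \<open>The variance of \<open>Ws\<close> is 4 times the sum of
  \<open>(b j)\<^sup>2 * (x j)\<^sup>2\<close>. Bounding one factor \<open>b j\<close> by
  \<open>\<beta>\<close> makes it linear in the drift, while a deviation comparable with the drift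
  is divided by the square of the drift: for small \<open>\<beta>\<close> the linear noise cannot
  mask it.\<close>

lemma prob_Ws_ge:
  assumes "0 < t" and x: "summable (\<lambda>j. (x j)\<^sup>2)"
  shows "prob {\<omega> \<in> space M. t \<le> \<bar>Ws b x \<omega>\<bar>} \<le> 4 * \<beta> * (\<Sum>j. b j * (x j)\<^sup>2) / t\<^sup>2"
proof -
  have D: "summable (\<lambda>j. b j * (x j)\<^sup>2)" by (intro summable_b_mult x) auto
  have D2: "summable (\<lambda>j. b j * (b j * (x j)\<^sup>2))"
    by (intro summable_b_mult D) (simp add: b_nonneg)
  have eq: "(2 * b j * x j)\<^sup>2 = 4 * (b j * (b j * (x j)\<^sup>2))" for j
    by (simp add: power2_eq_square)
  have "prob {\<omega> \<in> space M. t \<le> \<bar>\<Sum>j. 2 * b j * x j * \<xi> j \<omega>\<bar>} \<le> (\<Sum>j. 4 * (b j * (b j * (x j)\<^sup>2))) / t\<^sup>2"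
  proof (rule series_Chebyshev[OF _ _ _ _ _ _ AE_Ws[OF x] assms(1)])
    show "indep_vars (\<lambda>_. borel) (\<lambda>j \<omega>. 2 * b j * x j * \<xi> j \<omega>) UNIV"
      by (rule indep_compose) measurable
    show "integrable M (\<lambda>\<omega>. 2 * b j * x j * \<xi> j \<omega>)" for j
      using moment_integrable[of j 1] by simp
    show "integrable M (\<lambda>\<omega>. (2 * b j * x j * \<xi> j \<omega>)\<^sup>2)" for j
      unfolding power_mult_distrib[of _ "\<xi> j _"] using moment_integrable[of j 2] by simp
    show "expectation (\<lambda>\<omega>. 2 * b j * x j * \<xi> j \<omega>) = 0" for j
      by (simp add: mean_xi)
    show "expectation (\<lambda>\<omega>. (2 * b j * x j * \<xi> j \<omega>)\<^sup>2) = 4 * (b j * (b j * (x j)\<^sup>2))" for j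
      unfolding power_mult_distrib[of _ "\<xi> j _"] eq by (simp add: var_xi)
  qed (use D2 in auto)
  also have "(\<Sum>j. 4 * (b j * (b j * (x j)\<^sup>2))) = 4 * (\<Sum>j. b j * (b j * (x j)\<^sup>2))"
    by (rule suminf_mult[OF D2])
  also have "(\<Sum>j. b j * (b j * (x j)\<^sup>2)) \<le> (\<Sum>j. \<beta> * (b j * (x j)\<^sup>2))"
    by (intro suminf_le D2 summable_mult D mult_right_mono b_le) (simp add: b_nonneg)
  also have "\<dots> = \<beta> * (\<Sum>j. b j * (x j)\<^sup>2)" by (rule suminf_mult[OF D])
  finally show ?thesis using assms(1) by (simp add: Ws_def divide_right_mono)
qed

lemma prob_split:
  assumes x: "summable (\<lambda>j. (x j)\<^sup>2)"
    and sub: "\<And>\<omega>. \<omega> \<in> space M \<Longrightarrow> Ss b x \<omega> = Zs b \<omega> + Ws b x \<omega> + (\<Sum>j. b j * (x j)\<^sup>2) \<Longrightarrow> \<omega> \<in> A \<Longrightarrow> \<omega> \<in> B \<union> C"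
    and [measurable]: "A \<in> events" "B \<in> events" "C \<in> events"
  shows "prob A \<le> prob B + prob C"
proof -
  have "prob A \<le> prob (B \<union> C)"
  proof (rule finite_measure_mono_AE)
    show "AE \<omega> in M. \<omega> \<in> A \<longrightarrow> \<omega> \<in> B \<union> C"
      using AE_decomp[OF x] AE_space by eventually_elim (use sub in blast)
  qed measurable
  also have "\<dots> \<le> prob B + prob C" by (rule measure_Un_le) measurable
  finally show ?thesis .
qed

text \<open>By tightness of \<open>Zs\<close> some interval of length \<open>d / 2\<close> in a fixed compact range has a mass
  bounded from below; a shift by at least \<open>d\<close> moves this mass across the threshold.\<close>

lemma separation:
  assumes V: "0 < V" "(\<Sum>j. (b j)\<^sup>2) \<le> V" and d: "0 < d" "d \<le> (\<Sum>j. b j * (x j)\<^sup>2)"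
    and x: "summable (\<lambda>j. (x j)\<^sup>2)"
    and N: "real N \<ge> 4 * sqrt (8 * V) / d" "N > 0"
  shows "\<exists>c. 1 / (2 * real N) - 16 * \<beta> / d
    \<le> prob {\<omega> \<in> space M. Ss b (\<lambda>_. 0) \<omega> \<le> c} - prob {\<omega> \<in> space M. Ss b x \<omega> \<le> c}"
proof -
  \<comment> \<open>The variance of \<open>Zs\<close> is at most 2 V, so Chebyshev leaves mass at
    most 1/4 beyond L. The margin \<open>h\<close> is half of the least drift; the other half is
    left to absorb \<open>Ws\<close>.\<close>
  define L where "L = sqrt (8 * V)"
  define D where "D = (\<Sum>j. b j * (x j)\<^sup>2)"
  define h where "h = d / 2"
  define F where "F c = prob {\<omega> \<in> space M. Zs b \<omega> \<le> c}" for c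
  have L: "0 < L" "L\<^sup>2 = 8 * V" using V by (simp_all add: L_def)
  have tail: "prob {\<omega> \<in> space M. L \<le> \<bar>Zs b \<omega>\<bar>} \<le> 1 / 4"
  proof -
    have "prob {\<omega> \<in> space M. L \<le> \<bar>Zs b \<omega>\<bar>} \<le> 2 * (\<Sum>j. (b j)\<^sup>2) / L\<^sup>2" by (rule prob_Zs_ge[OF L(1)])
    also have "\<dots> \<le> 2 * V / L\<^sup>2" using V by (intro divide_right_mono) auto
    also have "\<dots> = 1 / 4" using V by (simp add: L)
    finally show ?thesis .
  qed
  have lo: "F (- L) \<le> 1 / 4"
    unfolding F_def using L
    by (intro order_trans[OF finite_measure_mono tail]) auto
  have NL: "- L + real N * h \<ge> L"
  proof -
    have "4 * L / d * d \<le> real N * d" using N d unfolding L_def by (intro mult_right_mono) auto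
    then show ?thesis using d by (simp add: h_def)
  qed
  have hi: "1 - 1 / 4 \<le> F (- L + real N * h)"
  proof -
    have "1 = prob ({\<omega> \<in> space M. Zs b \<omega> \<le> - L + real N * h} \<union> {\<omega> \<in> space M. L \<le> \<bar>Zs b \<omega>\<bar>})"
      by (subst prob_space[symmetric], rule arg_cong[where f = prob]) (use NL in auto)
    also have "\<dots> \<le> F (- L + real N * h) + prob {\<omega> \<in> space M. L \<le> \<bar>Zs b \<omega>\<bar>}"
      unfolding F_def by (rule measure_Un_le) measurable
    finally show ?thesis using tail by simp
  qed
  \<comment> \<open>N steps of length \<open>h\<close> lead from -L to at least L, and F rises by at
    least 1/2 on the way. One of the N increments is at least the average.\<close>
  have "\<exists>i<N. 1 / (2 * real N) \<le> F (- L + real (Suc i) * h) - F (- L + real i * h)"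
  proof (rule ccontr)
    assume "\<not> ?thesis"
    then have "(\<Sum>i<N. F (- L + real (Suc i) * h) - F (- L + real i * h)) < (\<Sum>i<N. 1 / (2 * real N))"
      using N by (intro sum_strict_mono) (auto simp: not_le)
    also have "\<dots> = 1 / 2" using N by simp
    finally have "F (- L + real N * h) - F (- L + real 0 * h) < 1 / 2"
      unfolding sum_lessThan_telescope[of "\<lambda>i. F (- L + real i * h)"] .
    then show False using lo hi by simp
  qed
  then obtain i where i: "1 / (2 * real N) \<le> F (- L + real (Suc i) * h) - F (- L + real i * h)" by blast
  define c where "c = - L + real (Suc i) * h"
  have ch: "c - h = - L + real i * h" by (simp add: c_def algebra_simps)
  \<comment> \<open>If \<open>Zs\<close> exceeds c - h while the total is at most c, then
    \<open>Ws\<close> lies below h - D. This is unlikely because D - h is at least D/2.\<close>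
  have "prob {\<omega> \<in> space M. Ss b x \<omega> \<le> c} \<le> F (c - h) + prob {\<omega> \<in> space M. D - h \<le> \<bar>Ws b x \<omega>\<bar>}"
    unfolding F_def by (rule prob_split[OF x]) (auto simp: D_def)
  also have "prob {\<omega> \<in> space M. D - h \<le> \<bar>Ws b x \<omega>\<bar>} \<le> 16 * \<beta> / d"
  proof -
    have Dd: "0 < D" "D / 2 \<le> D - h" "d \<le> D" using d by (auto simp: D_def h_def)
    have "prob {\<omega> \<in> space M. D - h \<le> \<bar>Ws b x \<omega>\<bar>} \<le> prob {\<omega> \<in> space M. D / 2 \<le> \<bar>Ws b x \<omega>\<bar>}"
      using Dd by (intro finite_measure_mono) auto
    also have "\<dots> \<le> 4 * \<beta> * D / (D / 2)\<^sup>2" unfolding D_def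
      by (rule prob_Ws_ge[OF _ x]) (use Dd in \<open>simp add: D_def\<close>)
    also have "\<dots> = 16 * \<beta> / D" using Dd by (simp add: power2_eq_square)
    also have "\<dots> \<le> 16 * \<beta> / d" using Dd d beta_nonneg by (intro divide_left_mono) auto
    finally show ?thesis .
  qed
  finally have "prob {\<omega> \<in> space M. Ss b x \<omega> \<le> c} \<le> F (c - h) + 16 * \<beta> / d" by simp
  moreover have "prob {\<omega> \<in> space M. Ss b (\<lambda>_. 0) \<omega> \<le> c} = F c"
    unfolding F_def by (rule finite_measure_eq_AE) (use AE_null in auto)
  ultimately show ?thesis using i unfolding ch c_def[symmetric] by (intro exI[of _ c]) linarith
qed

text \<open>While \<open>Ws\<close> stays below \<epsilon>/2 and the drift is at most \<epsilon>/2,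
  the statistic gains less than \<epsilon>. Then only outcomes with \<open>Zs\<close> in a window of
  length \<epsilon> below the threshold can turn acceptance into rejection.\<close>

lemma no_separation:
  assumes x: "summable (\<lambda>j. (x j)\<^sup>2)" and D: "(\<Sum>j. b j * (x j)\<^sup>2) \<le> \<epsilon> / 2" and e: "0 < \<epsilon>"
  shows "prob {\<omega> \<in> space M. Ss b (\<lambda>_. 0) \<omega> \<le> c} - prob {\<omega> \<in> space M. Ss b x \<omega> \<le> c}
    \<le> prob {\<omega> \<in> space M. c - \<epsilon> < Zs b \<omega> \<and> Zs b \<omega> \<le> c} + 16 * \<beta> * (\<Sum>j. b j * (x j)\<^sup>2) / \<epsilon>\<^sup>2"
proof -
  let ?A = "{\<omega> \<in> space M. c - \<epsilon> < Zs b \<omega> \<and> Zs b \<omega> \<le> c}"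
  let ?W = "{\<omega> \<in> space M. \<epsilon> / 2 \<le> \<bar>Ws b x \<omega>\<bar>}"
  let ?S = "{\<omega> \<in> space M. Ss b x \<omega> \<le> c}"
  have "prob {\<omega> \<in> space M. Ss b (\<lambda>_. 0) \<omega> \<le> c} = prob {\<omega> \<in> space M. Zs b \<omega> \<le> c}"
    by (rule finite_measure_eq_AE) (use AE_null in auto)
  also have "\<dots> \<le> prob ?S + prob (?A \<union> ?W)"
    by (rule prob_split[OF x]) (use D in auto)
  also have "prob (?A \<union> ?W) \<le> prob ?A + prob ?W" by (rule measure_Un_le) measurable
  also have "prob ?W \<le> 4 * \<beta> * (\<Sum>j. b j * (x j)\<^sup>2) / (\<epsilon> / 2)\<^sup>2"
    using e by (intro prob_Ws_ge x) simp
  finally show ?thesis by (simp add: power2_eq_square)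
qed

end

section \<open>Anti-concentration through characteristic functions\<close>

text \<open>A centered variable of variance 2 has characteristic function 1 - t^2 up to a third
  order term, which for small t is below 1 - t^2/2. One \<open>t0\<close> serves all coordinates
  because they have the same law.\<close>

lemma (in gauss_seq) char_centered_sq:
  "\<exists>t0>0. \<forall>j t. \<bar>t\<bar> \<le> t0 \<longrightarrow>
     cmod (char (distr M borel (\<lambda>\<omega>. (\<xi> j \<omega>)\<^sup>2 - 1)) t) \<le> exp (- t\<^sup>2 / 2)"
proof -
  \<comment> \<open>The summand 1 makes K at least 1, so \<open>1 / K\<close> is at most 1 and 1 -
    t^2 is nonnegative on the range of t considered.\<close>
  define K where "K = 1 + (\<integral>x. std_normal_density x * \<bar>x\<^sup>2 - 1\<bar> ^ 3 \<partial>lborel)"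
  have "0 \<le> (\<integral>x. std_normal_density x * \<bar>x\<^sup>2 - 1\<bar> ^ 3 \<partial>lborel)"
    by (rule integral_nonneg_AE) auto
  then have K: "1 \<le> K" by (simp add: K_def)
  have third: "integrable M (\<lambda>\<omega>. \<bar>(\<xi> j \<omega>)\<^sup>2 - 1\<bar> ^ 3)" for j
  proof (rule Bochner_Integration.integrable_bound)
    show "integrable M (\<lambda>\<omega>. 4 * \<xi> j \<omega> ^ 6 + 4)" by (simp add: moment_integrable)
    have "\<bar>y - 1\<bar> ^ 3 \<le> 4 * y ^ 3 + 4" if "0 \<le> y" for y :: real
    proof -
      have "\<bar>y - 1\<bar> \<le> max y 1" using that by auto
      then have "\<bar>y - 1\<bar> ^ 3 \<le> max y 1 ^ 3" by (rule power_mono) simp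
      also have "\<dots> \<le> 4 * y ^ 3 + 4" using that by (auto simp: max_def)
      finally show ?thesis .
    qed
    from this[of "(\<xi> j _)\<^sup>2"]
    show "AE \<omega> in M. norm (\<bar>(\<xi> j \<omega>)\<^sup>2 - 1\<bar> ^ 3) \<le> norm (4 * \<xi> j \<omega> ^ 6 + 4)"
      by (intro AE_I2) (simp add: power_mult[symmetric])
  qed measurable
  have thirdK: "expectation (\<lambda>\<omega>. \<bar>(\<xi> j \<omega>)\<^sup>2 - 1\<bar> ^ 3) \<le> K" for j
    using distributed_integral[OF normal[of j], of "\<lambda>x. \<bar>x\<^sup>2 - 1\<bar> ^ 3"] by (simp add: K_def)
  show ?thesis
  proof (intro exI[of _ "1 / K"] conjI allI impI)
    show "0 < 1 / K" using K by simp
    fix j t assume t: "\<bar>t\<bar> \<le> 1 / K"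
    let ?X = "\<lambda>\<omega>. (\<xi> j \<omega>)\<^sup>2 - 1"
    let ?c = "char (distr M borel ?X) t"
    \<comment> \<open>The remainder is at most t^2/6 times |t| K, and |t| K is at most 1.\<close>
    have "cmod (?c - of_real (1 - t\<^sup>2 * 2 / 2)) \<le>
        (t\<^sup>2 / 6) * expectation (\<lambda>\<omega>. min (6 * (?X \<omega>)\<^sup>2) (\<bar>t\<bar> * \<bar>?X \<omega>\<bar> ^ 3))"
      using char_approx3'[of ?X 2 "distr M borel ?X" t] centered_sq[of j] by simp
    also have "expectation (\<lambda>\<omega>. min (6 * (?X \<omega>)\<^sup>2) (\<bar>t\<bar> * \<bar>?X \<omega>\<bar> ^ 3)) \<le> expectation (\<lambda>\<omega>. \<bar>t\<bar> * \<bar>?X \<omega>\<bar> ^ 3)"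
      using centered_sq[of j] third[of j]
      by (intro integral_mono Bochner_Integration.integrable_min integrable_mult_right) auto
    also have "\<dots> \<le> \<bar>t\<bar> * K" using thirdK[of j] by (simp add: mult_left_mono)
    also have "\<dots> \<le> 1" using t K by (simp add: field_simps)
    finally have "cmod (?c - of_real (1 - t\<^sup>2)) \<le> t\<^sup>2 / 6" by (simp add: mult_left_mono)
    moreover have "cmod ?c \<le> cmod (of_real (1 - t\<^sup>2)) + cmod (?c - of_real (1 - t\<^sup>2))"
      by (metis add.commute diff_add_cancel norm_triangle_ineq)
    moreover have "cmod (of_real (1 - t\<^sup>2)) = 1 - t\<^sup>2"
    proof -
      have "\<bar>t\<bar> \<le> 1" using t K by (smt (verit) divide_le_eq_1)
      then have "t\<^sup>2 \<le> 1" by (simp add: abs_square_le_1)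
      then show ?thesis by (simp only: norm_of_real abs_of_nonneg diff_ge_0_iff_ge)
    qed
    ultimately have "cmod ?c \<le> 1 + - t\<^sup>2 / 2" using zero_le_power2[of t] by linarith
    also have "\<dots> \<le> exp (- t\<^sup>2 / 2)" by (rule exp_ge_add_one_self)
    finally show "cmod ?c \<le> exp (- t\<^sup>2 / 2)" .
  qed
qed

text \<open>Bounding the standard normal density by its value at 0 leaves an unnormalized Gaussian
  with \<open>s\<^sup>2 = 1 / (2 * q)\<close>, whose mass is read off from
  \<open>normal_density 0 s\<close>.\<close>

lemma gaussian_integral_le:
  assumes "0 < q"
  shows "integrable std_normal_distribution (\<lambda>u. exp (- q * u\<^sup>2))"
    "(LINT u|std_normal_distribution. exp (- q * u\<^sup>2)) \<le> 1 / sqrt (2 * q)"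
proof -
  define s where "s = 1 / sqrt (2 * q)"
  have s: "0 < s" "2 * s\<^sup>2 = 1 / q" using assms by (simp_all add: s_def power_divide)
  have dens: "normal_density 0 s u = exp (- q * u\<^sup>2) / (sqrt (2 * pi) * s)" for u
  proof -
    have "sqrt (2 * pi * s\<^sup>2) = sqrt (2 * pi) * s" using s by (simp add: real_sqrt_mult)
    moreover have "- (u - 0)\<^sup>2 / (2 * s\<^sup>2) = - q * u\<^sup>2" unfolding s(2) by simp
    ultimately show ?thesis unfolding normal_density_def by simp
  qed
  have le: "std_normal_density u * exp (- q * u\<^sup>2) \<le> s * normal_density 0 s u" for u
  proof -
    have "std_normal_density u \<le> 1 / sqrt (2 * pi)"
      by (simp add: std_normal_density_def field_simps)
    from mult_right_mono[OF this, of "exp (- q * u\<^sup>2)"]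
    show ?thesis unfolding dens using s by simp
  qed
  have int: "integrable lborel (\<lambda>u. s * normal_density 0 s u)" using s by simp
  have int2: "integrable lborel (\<lambda>u. std_normal_density u * exp (- q * u\<^sup>2))"
    by (rule Bochner_Integration.integrable_bound[OF int])
      (use le s in \<open>auto intro!: AE_I2 simp: abs_mult\<close>)
  then show "integrable std_normal_distribution (\<lambda>u. exp (- q * u\<^sup>2))"
    by (subst integrable_density) auto
  have "(LINT u|std_normal_distribution. exp (- q * u\<^sup>2)) = (\<integral>u. std_normal_density u * exp (- q * u\<^sup>2) \<partial>lborel)"
    by (subst integral_density) auto
  also have "\<dots> \<le> (\<integral>u. s * normal_density 0 s u \<partial>lborel)"
    by (rule integral_mono[OF int2 int le])
  also have "\<dots> = s" using s by simp
  finally show "(LINT u|std_normal_distribution. exp (- q * u\<^sup>2)) \<le> 1 / sqrt (2 * q)" by (simp add: s_def)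
qed

lemma std_normal_tail:
  assumes "0 < T"
  shows "measure std_normal_distribution {u. T \<le> \<bar>u\<bar>} \<le> 1 / T\<^sup>2"
proof -
  interpret N: prob_space std_normal_distribution
    by (rule prob_space_normal_density) simp
  have int: "integrable std_normal_distribution (\<lambda>u. u\<^sup>2)"
    using integrable_std_normal_moment[of 2] by (subst integrable_density) auto
  have "(LINT u|std_normal_distribution. u\<^sup>2) = 1"
    using integral_std_normal_moment_even[of 1] by (subst integral_density) auto
  then have "measure std_normal_distribution {u \<in> space std_normal_distribution. T\<^sup>2 \<le> u\<^sup>2} \<le> 1 / T\<^sup>2"
    using integral_Markov_inequality_measure[OF int, of UNIV "T\<^sup>2"] assms by simp
  moreover have "T\<^sup>2 \<le> u\<^sup>2 \<longleftrightarrow> T \<le> \<bar>u\<bar>" for u using assms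
    by (metis abs_le_square_iff abs_of_pos)
  ultimately show ?thesis by simp
qed

text \<open>\<open>exp (- y\<^sup>2 / 2)\<close> is the characteristic function of a standard normal variable at \<open>y\<close>;
  integrating it over the law of \<open>X\<close> and exchanging the integrals brings in \<open>char X\<close>.\<close>

lemma (in prob_space) gaussian_smoothing:
  assumes [measurable]: "X \<in> borel_measurable M" and e: "0 < \<epsilon>"
  shows "expectation (\<lambda>\<omega>. exp (- ((X \<omega> - c) / \<epsilon>)\<^sup>2 / 2))
    \<le> (LINT u|std_normal_distribution. cmod (char (distr M borel X) (u / \<epsilon>)))"
proof -
  interpret N: prob_space std_normal_distribution
    by (rule prob_space_normal_density) simp
  interpret P: pair_prob_space M std_normal_distribution ..
  let ?e = "\<lambda>\<omega> u. iexp (((X \<omega> - c) / \<epsilon>) * u)"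
  have [measurable]: "(\<lambda>p. ?e (fst p) (snd p)) \<in> borel_measurable (M \<Otimes>\<^sub>M std_normal_distribution)"
    by measurable
  have int: "integrable (M \<Otimes>\<^sub>M std_normal_distribution) (\<lambda>(\<omega>, u). ?e \<omega> u)"
    by (rule P.integrable_const_bound[where B = 1]) (auto simp: split_beta)
  have "complex_of_real (expectation (\<lambda>\<omega>. exp (- ((X \<omega> - c) / \<epsilon>)\<^sup>2 / 2)))
      = (LINT \<omega>|M. complex_of_real (exp (- ((X \<omega> - c) / \<epsilon>)\<^sup>2 / 2)))"
    by simp
  also have "\<dots> = (LINT \<omega>|M. LINT u|std_normal_distribution. ?e \<omega> u)"
    unfolding fun_cong[OF char_std_normal_distribution, symmetric] char_def ..
  also have "\<dots> = (LINT u|std_normal_distribution. LINT \<omega>|M. ?e \<omega> u)"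
    by (rule P.Fubini_integral[OF int, symmetric])
  also have "cmod \<dots> \<le> (LINT u|std_normal_distribution. cmod (LINT \<omega>|M. ?e \<omega> u))"
    by (rule integral_norm_bound)
  also have "\<dots> = (LINT u|std_normal_distribution. cmod (char (distr M borel X) (u / \<epsilon>)))"
  proof (rule Bochner_Integration.integral_cong[OF refl])
    fix u
    have "(LINT \<omega>|M. ?e \<omega> u) = (LINT \<omega>|M. iexp (- c / \<epsilon> * u) * iexp (u / \<epsilon> * X \<omega>))"
      by (rule Bochner_Integration.integral_cong[OF refl])
        (simp add: exp_add[symmetric] algebra_simps diff_divide_distrib)
    also have "\<dots> = iexp (- c / \<epsilon> * u) * char (distr M borel X) (u / \<epsilon>)"
      by (simp add: char_def integral_distr)
    finally show "cmod (LINT \<omega>|M. ?e \<omega> u) = cmod (char (distr M borel X) (u / \<epsilon>))"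
      by (simp only: norm_mult norm_exp_i_times mult_1_left)
  qed
  finally show ?thesis by (simp add: abs_of_nonneg)
qed

text \<open>A Gaussian bump of width \<epsilon> at the threshold dominates the indicator of the
  window, and its expectation is controlled by the characteristic function. Frequencies t with |t|
  \<beta> \<le> t0 yield the term \<epsilon> / sqrt v; the normal tail of the others yields
  \<open>(\<beta> / \<epsilon>)\<^sup>2\<close>. The weights are quantified after K, since one
  constant must serve all n.\<close>

lemma (in gauss_seq) anti_concentration:
  "\<exists>K>0. \<forall>b \<beta> v \<epsilon> c. gauss_weights M \<xi> b \<beta> \<longrightarrow> 0 < \<beta> \<longrightarrow> 0 < v \<longrightarrow> v \<le> (\<Sum>j. (b j)\<^sup>2) \<longrightarrow> 0 < \<epsilon> \<longrightarrow>
     prob {\<omega> \<in> space M. c - \<epsilon> < Zs b \<omega> \<and> Zs b \<omega> \<le> c} \<le> K * (\<epsilon> / sqrt v + (\<beta> / \<epsilon>)\<^sup>2)"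
proof -
  obtain t0 where t0: "0 < t0" and char: "\<And>j t. \<bar>t\<bar> \<le> t0 \<Longrightarrow>
     cmod (char (distr M borel (\<lambda>\<omega>. (\<xi> j \<omega>)\<^sup>2 - 1)) t) \<le> exp (- t\<^sup>2 / 2)"
    using char_centered_sq by blast
  define K where "K = exp (1/2) * (2 + 1 / t0\<^sup>2)"
  show ?thesis
  proof (intro exI[of _ K] conjI allI impI)
    show "0 < K" by (simp add: K_def add_pos_nonneg)
    fix b :: "nat \<Rightarrow> real" and \<beta> v \<epsilon> c :: real
    assume gw: "gauss_weights M \<xi> b \<beta>" and \<beta>: "0 < \<beta>" and v: "0 < v" "v \<le> (\<Sum>j. (b j)\<^sup>2)" and e: "0 < \<epsilon>"
    interpret gauss_weights M \<xi> b \<beta> by (rule gw)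
    interpret N: prob_space std_normal_distribution
      by (rule prob_space_normal_density) simp
    define B where "B = \<epsilon> * sqrt 2 / sqrt v + (\<beta> / (\<epsilon> * t0))\<^sup>2"
    let ?S = "\<lambda>N \<omega>. \<Sum>j<N. b j * ((\<xi> j \<omega>)\<^sup>2 - 1)"
    let ?g = "\<lambda>y. exp (- ((y - c) / \<epsilon>)\<^sup>2 / 2)"
    \<comment> \<open>The product formula concerns finitely many factors, so the estimate is made
      for partial sums. A long enough one retains half of the lower bound \<open>v\<close> on the
      sum of squares.\<close>
    have chS: "cmod (char (distr M borel (?S N)) t) \<le> exp (- t\<^sup>2 * (v / 2) / 2)"
      if N: "v / 2 \<le> (\<Sum>j<N. (b j)\<^sup>2)" and t: "\<bar>t\<bar> * \<beta> \<le> t0" for N t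
    proof -
      have "indep_vars (\<lambda>_. borel) (\<lambda>j \<omega>. b j * ((\<xi> j \<omega>)\<^sup>2 - 1)) {..<N}"
        by (rule indep_vars_subset[OF indep_compose]) auto
      then have "char (distr M borel (?S N)) t
          = (\<Prod>j<N. char (distr M borel (\<lambda>\<omega>. b j * ((\<xi> j \<omega>)\<^sup>2 - 1))) t)"
        by (rule char_distr_sum)
      also have "cmod \<dots> = (\<Prod>j<N. cmod (char (distr M borel (\<lambda>\<omega>. (\<xi> j \<omega>)\<^sup>2 - 1)) (t * b j)))"
        unfolding prod_norm[symmetric]
        by (simp add: char_def integral_distr mult.assoc mult.left_commute)
      also have "\<dots> \<le> (\<Prod>j<N. exp (- (t * b j)\<^sup>2 / 2))"
      proof (intro prod_mono conjI char)
        fix j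
        have "\<bar>t * b j\<bar> = \<bar>t\<bar> * b j" using b_nonneg[of j] by (simp add: abs_mult)
        also have "\<dots> \<le> \<bar>t\<bar> * \<beta>" by (intro mult_left_mono b_le) simp
        finally show "\<bar>t * b j\<bar> \<le> t0" using t by linarith
      qed simp
      also have "\<dots> = exp (- t\<^sup>2 * (\<Sum>j<N. (b j)\<^sup>2) / 2)"
        by (simp add: exp_sum[symmetric] power_mult_distrib sum_distrib_left sum_negf sum_divide_distrib)
      also have "\<dots> \<le> exp (- t\<^sup>2 * (v / 2) / 2)"
        using mult_left_mono[OF N zero_le_power2[of t]] by (simp add: mult.commute)
      finally show ?thesis .
    qed
    have EN: "expectation (\<lambda>\<omega>. ?g (?S N \<omega>)) \<le> B" if N: "v / 2 \<le> (\<Sum>j<N. (b j)\<^sup>2)" for N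
    proof -
      \<comment> \<open>At |u| = T the frequency u / \<epsilon> leaves the admissible range; q is
        the exponent that t = u / \<epsilon> produces in \<open>chS\<close>.\<close>
      define T where "T = \<epsilon> * t0 / \<beta>"
      define q where "q = v / (4 * \<epsilon>\<^sup>2)"
      have T: "0 < T" and q: "0 < q" using e t0 \<beta> v by (simp_all add: T_def q_def)
      interpret D: real_distribution "distr M borel (?S N)" by (rule real_distribution_distr) measurable
      have "expectation (\<lambda>\<omega>. ?g (?S N \<omega>))
          \<le> (LINT u|std_normal_distribution. cmod (char (distr M borel (?S N)) (u / \<epsilon>)))"
        by (rule gaussian_smoothing[OF _ e]) measurable
      also have "\<dots> \<le> (LINT u|std_normal_distribution. exp (- q * u\<^sup>2) + indicator {u. T \<le> \<bar>u\<bar>} u)"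
      proof (rule integral_mono_AE')
        show "integrable std_normal_distribution (\<lambda>u. exp (- q * u\<^sup>2) + indicator {u. T \<le> \<bar>u\<bar>} u)"
          by (intro Bochner_Integration.integrable_add gaussian_integral_le q) (simp add: N.emeasure_eq_measure)
        have "cmod (char (distr M borel (?S N)) (u / \<epsilon>)) \<le> exp (- q * u\<^sup>2) + indicator {u. T \<le> \<bar>u\<bar>} u" for u
        proof (cases "T \<le> \<bar>u\<bar>")
          case True
          then show ?thesis using D.cmod_char_le_1[of "u / \<epsilon>"] by (simp add: add_increasing)
        next
          case False
          then have "\<bar>u / \<epsilon>\<bar> * \<beta> \<le> t0" using e \<beta> by (simp add: T_def field_simps)
          from chS[OF N this] False show ?thesis using e by (simp add: q_def power_divide field_simps)
        qed
        then show "AE u in std_normal_distribution. cmod (char (distr M borel (?S N)) (u / \<epsilon>))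
            \<le> exp (- q * u\<^sup>2) + indicator {u. T \<le> \<bar>u\<bar>} u" by (rule AE_I2)
      qed auto
      also have "\<dots> = (LINT u|std_normal_distribution. exp (- q * u\<^sup>2)) + measure std_normal_distribution {u. T \<le> \<bar>u\<bar>}"
        using gaussian_integral_le(1)[OF q]
        by (subst Bochner_Integration.integral_add) (auto simp: N.emeasure_eq_measure)
      also have "\<dots> \<le> 1 / sqrt (2 * q) + 1 / T\<^sup>2"
        by (intro add_mono gaussian_integral_le q std_normal_tail T)
      also have "\<dots> = B"
        using e v \<beta> t0 by (simp add: B_def q_def T_def real_sqrt_divide real_sqrt_mult power_divide power_mult_distrib field_simps)
      finally show ?thesis .
    qed
    \<comment> \<open>The bump is bounded and continuous, so a bound for the partial sums passes to
      the series.\<close>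
    have lim: "(\<lambda>N. expectation (\<lambda>\<omega>. ?g (?S N \<omega>))) \<longlonglongrightarrow> expectation (\<lambda>\<omega>. ?g (Zs b \<omega>))"
    proof (rule integral_dominated_convergence[where w = "\<lambda>_. 1"])
      show "AE \<omega> in M. (\<lambda>N. ?g (?S N \<omega>)) \<longlonglongrightarrow> ?g (Zs b \<omega>)"
        using AE_Zs
      proof eventually_elim
        case (elim \<omega>)
        from summable_LIMSEQ[OF this] show ?case
          unfolding Zs_def[symmetric] using e by (intro tendsto_intros) auto
      qed
    qed auto
    have "\<forall>\<^sub>F N in sequentially. v / 2 < (\<Sum>j<N. (b j)\<^sup>2)"
      using v by (intro order_tendstoD(1)[OF summable_LIMSEQ[OF summable_b_sq]]) simp
    then have "\<forall>\<^sub>F N in sequentially. expectation (\<lambda>\<omega>. ?g (?S N \<omega>)) \<le> B"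
      by eventually_elim (rule EN, simp)
    then have EZ: "expectation (\<lambda>\<omega>. ?g (Zs b \<omega>)) \<le> B"
      by (rule tendsto_upperbound[OF lim]) simp
    let ?A = "{\<omega> \<in> space M. c - \<epsilon> < Zs b \<omega> \<and> Zs b \<omega> \<le> c}"
    have "prob ?A = expectation (indicator ?A)" by simp
    \<comment> \<open>Inside the window the bump is at least exp (-1/2), hence the factor exp
      (1/2).\<close>
    also have "\<dots> \<le> expectation (\<lambda>\<omega>. exp (1/2) * ?g (Zs b \<omega>))"
    proof (rule integral_mono)
      show "integrable M (\<lambda>\<omega>. exp (1/2) * ?g (Zs b \<omega>))"
        by (intro integrable_mult_right integrable_const_bound[where B = 1]) auto
      fix \<omega>
      show "indicator ?A \<omega> \<le> exp (1/2) * ?g (Zs b \<omega>)"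
      proof (cases "\<omega> \<in> ?A")
        case True
        then have "\<bar>(Zs b \<omega> - c) / \<epsilon>\<bar> \<le> 1" using e by (simp add: field_simps)
        then have "((Zs b \<omega> - c) / \<epsilon>)\<^sup>2 \<le> 1" by (simp only: abs_square_le_1)
        then have "1 \<le> exp (1/2 + - ((Zs b \<omega> - c) / \<epsilon>)\<^sup>2 / 2)" unfolding one_le_exp_iff by linarith
        then show ?thesis using True by (simp only: exp_add) simp
      qed simp
    qed (simp add: emeasure_eq_measure)
    also have "\<dots> = exp (1/2) * expectation (\<lambda>\<omega>. ?g (Zs b \<omega>))" by simp
    also have "\<dots> \<le> exp (1/2) * B" using EZ by simp
    also have "B \<le> (2 + 1 / t0\<^sup>2) * (\<epsilon> / sqrt v + (\<beta> / \<epsilon>)\<^sup>2)"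
    proof -
      have "sqrt 2 \<le> 2 + 1 / t0\<^sup>2" using real_sqrt_le_mono[of 2 4] by (simp add: add_increasing2)
      then have "sqrt 2 * (\<epsilon> / sqrt v) \<le> (2 + 1 / t0\<^sup>2) * (\<epsilon> / sqrt v)"
        using e v by (intro mult_right_mono) auto
      moreover have "1 / t0\<^sup>2 * (\<beta> / \<epsilon>)\<^sup>2 \<le> (2 + 1 / t0\<^sup>2) * (\<beta> / \<epsilon>)\<^sup>2"
        by (intro mult_right_mono) auto
      ultimately show ?thesis
        by (simp add: B_def power_divide power_mult_distrib distrib_left mult.commute)
    qed
    finally show "prob ?A \<le> K * (\<epsilon> / sqrt v + (\<beta> / \<epsilon>)\<^sup>2)" by (simp add: K_def mult.assoc)
  qed
qed

subsection \<open>The weights of the test statistic\<close>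

text \<open>White noise coordinates are numbered from 1 and the Gaussian sequence from 0;
  independence is carried over along \<open>Suc\<close>. Events of a finite subfamily are relabelled
  by the inverse of the injection.\<close>

lemma (in prob_space) indep_sets_reindex:
  assumes inj: "inj_on f I" and indep: "indep_sets F (f ` I)"
  shows "indep_sets (\<lambda>i. F (f i)) I"
proof (rule indep_setsI)
  show "F (f i) \<subseteq> events" if "i \<in> I" for i
    using indep that unfolding indep_sets_def by blast
  fix A J assume J: "J \<noteq> {}" "J \<subseteq> I" "finite J" and A: "\<forall>j\<in>J. A j \<in> F (f j)"
  have injJ: "inj_on f J" using inj J(2) by (rule inj_on_subset)
  define B where "B i = A (the_inv_into J f i)" for i
  have B: "B (f j) = A j" if "j \<in> J" for j
    using the_inv_into_f_f[OF injJ that] by (simp add: B_def)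
  have "prob (\<Inter>i\<in>f ` J. B i) = (\<Prod>i\<in>f ` J. prob (B i))"
    using J A B by (intro indep_setsD[OF indep]) auto
  then show "prob (\<Inter>j\<in>J. A j) = (\<Prod>j\<in>J. prob (A j))"
    using B by (simp add: prod.reindex[OF injJ])
qed

lemma (in prob_space) indep_vars_reindex:
  assumes "inj_on f I" "indep_vars M' X (f ` I)"
  shows "indep_vars (\<lambda>i. M' (f i)) (\<lambda>i. X (f i)) I"
  using assms(2) indep_sets_reindex[OF assms(1)] unfolding indep_vars_def2 by blast

locale quad_weights =
  fixes \<kappa> :: "nat \<Rightarrow> nat \<Rightarrow> real" and \<sigma> r :: real
  assumes sigma: "\<sigma> > 0" and summ: "kappa_summable \<kappa>" and A1: "A1 \<kappa>" and A2: "A2 \<kappa> \<sigma>"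
    and A4: "A4 \<kappa>" and r: "0 < r" "r < 1/2"
    and kn: "same_order (\<lambda>n. real (kn \<kappa> n)) (\<lambda>n. real n powr (2 - 4 * r))"
begin

definition a :: "nat \<Rightarrow> nat \<Rightarrow> real" where
  "a n j = (\<kappa> (Suc j) n)\<^sup>2"

abbreviation k :: "nat \<Rightarrow> nat" where
  "k n \<equiv> Defs.kn \<kappa> n"

lemma a_nonneg [simp]: "0 \<le> a n j" by (simp add: a_def)

lemma a_decr: "n \<ge> 1 \<Longrightarrow> i \<le> j \<Longrightarrow> a n j \<le> a n i"
  using A1 by (simp add: A1_def a_def)

lemma a_summable: "n \<ge> 1 \<Longrightarrow> summable (a n)"
  using summ by (simp add: kappa_summable_def a_def[abs_def])

lemma a_sq_summable: "n \<ge> 1 \<Longrightarrow> summable (\<lambda>j. (a n j)\<^sup>2)"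
  by (rule summable_comparison_test'[of "\<lambda>j. a n 0 * a n j" 0])
     (auto simp: power2_eq_square intro!: summable_mult a_summable mult_right_mono a_decr)

lemma sum_a_sq: "n \<ge> 1 \<Longrightarrow> (real n)\<^sup>2 * (\<Sum>j. (a n j)\<^sup>2) = \<sigma> ^ 4 * An \<kappa> \<sigma> n"
  using sigma by (simp add: An_def a_def power_mult[symmetric])

lemma An_bounds:
  obtains c C where "0 < c" "0 < C"
    "\<And>n. n \<ge> 1 \<Longrightarrow> c \<le> (real n)\<^sup>2 * (\<Sum>j. (a n j)\<^sup>2)"
    "\<And>n. n \<ge> 1 \<Longrightarrow> (real n)\<^sup>2 * (\<Sum>j. (a n j)\<^sup>2) \<le> C"
proof -
  from A2 obtain C1 C2 where C: "0 < C1" "0 < C2" "\<And>n. n \<ge> 1 \<Longrightarrow> C1 < An \<kappa> \<sigma> n \<and> An \<kappa> \<sigma> n < C2"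
    unfolding A2_def by blast
  show thesis
    by (rule that[of "\<sigma> ^ 4 * C1" "\<sigma> ^ 4 * C2"])
       (use C sigma in \<open>auto simp: sum_a_sq intro!: mult_left_mono less_imp_le\<close>)
qed

lemma kn_bounds:
  obtains c C where "0 < c" "0 < C"
    "\<And>n. n \<ge> 1 \<Longrightarrow> c * real n powr (2 - 4 * r) \<le> real (k n)"
    "\<And>n. n \<ge> 1 \<Longrightarrow> real (k n) \<le> C * real n powr (2 - 4 * r)"
    "\<And>n. n \<ge> 1 \<Longrightarrow> 1 \<le> k n"
proof -
  from kn obtain c C where C: "0 < c" "c \<le> C"
    "\<And>n. n \<ge> 1 \<Longrightarrow> c * real (k n) \<le> real n powr (2 - 4 * r) \<and> real n powr (2 - 4 * r) \<le> C * real (k n)"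
    unfolding same_order_def by blast
  have lo: "1 / C * real n powr (2 - 4 * r) \<le> real (k n)"
    and up: "real (k n) \<le> 1 / c * real n powr (2 - 4 * r)" if "n \<ge> 1" for n
    using C(1,2) C(3)[OF that] by (simp_all add: field_simps)
  have "1 \<le> k n" if "n \<ge> 1" for n
  proof -
    have "0 < 1 / C * real n powr (2 - 4 * r)" using C that by simp
    then show ?thesis using lo[OF that] by linarith
  qed
  with lo up show thesis using C(1,2) by (intro that[of "1 / C" "1 / c"]) auto
qed

lemma kn_pos: "n \<ge> 1 \<Longrightarrow> 1 \<le> k n"
  by (rule kn_bounds) blast

lemma a0_pos: "n \<ge> 1 \<Longrightarrow> 0 < a n 0"
proof (rule ccontr)
  assume n: "n \<ge> 1" and "\<not> 0 < a n 0"
  then have "a n j = 0" for j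
    using a_decr[OF n, of 0 j] a_nonneg[of n j] by (simp add: antisym)
  then have "(real n)\<^sup>2 * (\<Sum>j. (a n j)\<^sup>2) = 0" by simp
  then show False using An_bounds n by (metis less_le_not_le)
qed

text \<open>The set that defines \<open>k n\<close> is bounded, because the partial sums eventually
  pass half of the positive total; hence \<open>Suc (k n)\<close> is not in it. Membership of an
  index concerns only the weights before it, so this speaks of exactly the first \<open>k n\<close>
  weights.\<close>

lemma sum_a_less: "n \<ge> 1 \<Longrightarrow> (\<Sum>j. a n j) < 2 * (\<Sum>j<k n. a n j)"
proof -
  assume n: "n \<ge> 1"
  let ?T = "\<Sum>j. a n j"
  let ?X = "{m. (\<Sum>j=1..<m. (\<kappa> j n)\<^sup>2) \<le> 1/2 * (\<Sum>j. (\<kappa> (Suc j) n)\<^sup>2)}"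
  have shift: "(\<Sum>j=1..<Suc m. (\<kappa> j n)\<^sup>2) = (\<Sum>j<m. a n j)" for m
    by (simp add: a_def sum.shift_bounds_Suc_ivl[of "\<lambda>j. (\<kappa> j n)\<^sup>2" 0, simplified] atLeast0LessThan)
  have T: "0 < ?T"
    using a0_pos[OF n] by (intro suminf_pos2[OF a_summable[OF n], of 0]) auto
  have "\<forall>\<^sub>F m in sequentially. ?T / 2 < (\<Sum>j<m. a n j)"
    using T by (intro order_tendstoD(1)[OF summable_LIMSEQ[OF a_summable[OF n]]]) simp
  then obtain m0 where m0: "\<And>m. m \<ge> m0 \<Longrightarrow> ?T / 2 < (\<Sum>j<m. a n j)"
    unfolding eventually_sequentially by blast
  have "m \<le> Suc m0" if "m \<in> ?X" for m
  proof (rule ccontr)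
    assume "\<not> m \<le> Suc m0"
    then obtain m' where m': "m = Suc m'" "m' \<ge> m0" by (cases m) auto
    show False using that m0[OF m'(2)] shift[of m'] by (simp add: m' a_def)
  qed
  then have bdd: "bdd_above ?X" unfolding bdd_above_def by blast
  have "Suc (k n) \<notin> ?X"
  proof
    assume "Suc (k n) \<in> ?X"
    then have "Suc (k n) \<le> k n" unfolding Defs.kn_def by (rule cSup_upper[OF _ bdd])
    then show False by simp
  qed
  then have "\<not> (\<Sum>j<k n. a n j) \<le> 1/2 * ?T"
    unfolding mem_Collect_eq shift a_def[symmetric] .
  then show ?thesis by linarith
qed

lemma sum_a_sq_le: "n \<ge> 1 \<Longrightarrow> (\<Sum>j. (a n j)\<^sup>2) \<le> 2 * real (k n) * (a n 0)\<^sup>2"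
proof -
  assume n: "n \<ge> 1"
  have "(\<Sum>j. (a n j)\<^sup>2) \<le> (\<Sum>j. a n 0 * a n j)"
    by (intro suminf_le a_sq_summable n summable_mult a_summable)
       (auto simp: power2_eq_square intro!: mult_right_mono a_decr n)
  also have "\<dots> = a n 0 * (\<Sum>j. a n j)" by (rule suminf_mult[OF a_summable[OF n]])
  also have "(\<Sum>j<k n. a n j) \<le> real (k n) * a n 0"
    using sum_bounded_above[of "{..<k n}" "a n" "a n 0"] a_decr[OF n] by simp
  then have "a n 0 * (\<Sum>j. a n j) \<le> a n 0 * (2 * (real (k n) * a n 0))"
    using sum_a_less[OF n] by (intro mult_left_mono) auto
  finally show ?thesis by (simp add: power2_eq_square mult_ac)
qed

section \<open>Orders of magnitude of the weights\<close>

lemma sqrt_powr: "0 \<le> x \<Longrightarrow> sqrt (x powr y) = x powr (y / 2)"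
  by (simp add: powr_half_sqrt[symmetric] powr_powr)

lemma mult_sqrt_divide: "y * sqrt (A / p) = sqrt A * (y / sqrt p)" for y A p :: real
  by (simp add: real_sqrt_divide)

text \<open>The origin of the order n^(2r): if a sum of squares of order n^-2 is spread over about
  n^(2-4r) weights, then n^2 times a typical weight is n divided by the root of their
  number.\<close>

lemma powr_order:
  assumes "n \<ge> (1::nat)" 
  shows "real n / sqrt (real n powr (2 - 4 * r)) = real n powr (2 * r)"
proof -
  have "real n / real n powr (1 - 2 * r) = real n powr (1 - (1 - 2 * r))"
    using assms by (simp add: powr_diff)
  then show ?thesis by (simp add: sqrt_powr diff_divide_distrib)
qed

lemma a0_lower: "\<exists>c>0. \<forall>n\<ge>1. c * real n powr (2 * r) \<le> (real n)\<^sup>2 * a n 0"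
proof -
  obtain c where c: "0 < c" "\<And>n. n \<ge> 1 \<Longrightarrow> c \<le> (real n)\<^sup>2 * (\<Sum>j. (a n j)\<^sup>2)"
    by (rule An_bounds) blast
  obtain C where C: "0 < C" "\<And>n. n \<ge> 1 \<Longrightarrow> real (k n) \<le> C * real n powr (2 - 4 * r)"
    by (rule kn_bounds) blast
  show ?thesis
  proof (intro exI[of _ "sqrt (c / (2 * C))"] conjI allI impI)
    show "0 < sqrt (c / (2 * C))" using c C by simp
    fix n :: nat assume n: "n \<ge> 1"
    let ?p = "real n powr (2 - 4 * r)"
    have p: "0 < ?p" using n by simp
    have "c \<le> (real n)\<^sup>2 * (2 * real (k n) * (a n 0)\<^sup>2)"
      using c(2)[OF n] mult_left_mono[OF sum_a_sq_le[OF n], of "(real n)\<^sup>2"] by simp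
    also have "\<dots> \<le> (real n)\<^sup>2 * (2 * (C * ?p) * (a n 0)\<^sup>2)"
      using C(2)[OF n] by (intro mult_left_mono mult_right_mono) auto
    finally have "c / (2 * C) / ?p \<le> (real n * a n 0)\<^sup>2"
      using C p by (simp add: field_simps power_mult_distrib)
    then have "sqrt (c / (2 * C) / ?p) \<le> real n * a n 0"
      by (intro real_le_lsqrt) auto
    then have "real n * sqrt (c / (2 * C) / ?p) \<le> real n * (real n * a n 0)"
      by (rule mult_left_mono) simp
    also have "real n * sqrt (c / (2 * C) / ?p) = sqrt (c / (2 * C)) * real n powr (2 * r)"
      unfolding powr_order[OF n, symmetric] by (rule mult_sqrt_divide)
    finally show "sqrt (c / (2 * C)) * real n powr (2 * r) \<le> (real n)\<^sup>2 * a n 0"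
      by (simp add: power2_eq_square mult.assoc)
  qed
qed

text \<open>The first \<open>C * k n\<close> weights are all at least the last of them, while their
  squares sum to at most order n^-2. The root of C is the decay that makes coordinates far beyond
  \<open>k n\<close> negligible.\<close>

lemma a_tail_upper:
  "\<exists>B>0. \<forall>n\<ge>1. \<forall>C\<ge>1. (real n)\<^sup>2 * a n (C * k n - 1) \<le> B / sqrt (real C) * real n powr (2 * r)"
proof -
  obtain V where V: "0 < V" "\<And>n. n \<ge> 1 \<Longrightarrow> (real n)\<^sup>2 * (\<Sum>j. (a n j)\<^sup>2) \<le> V"
    by (rule An_bounds) blast
  obtain c where c: "0 < c" "\<And>n. n \<ge> 1 \<Longrightarrow> c * real n powr (2 - 4 * r) \<le> real (k n)"
    by (rule kn_bounds) blast
  show ?thesis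
  proof (intro exI[of _ "sqrt (V / c)"] conjI allI impI)
    show "0 < sqrt (V / c)" using c V by simp
    fix n C :: nat assume n: "n \<ge> 1" and C: "C \<ge> 1"
    let ?p = "real n powr (2 - 4 * r)" and ?m = "C * k n"
    have p: "0 < ?p" using n by simp
    have "real ?m * (a n (?m - 1))\<^sup>2 \<le> (\<Sum>j<?m. (a n j)\<^sup>2)"
      using sum_bounded_below[of "{..<?m}" "(a n (?m - 1))\<^sup>2" "\<lambda>j. (a n j)\<^sup>2"] a_decr[OF n]
      by (auto simp: power_mono)
    also have "\<dots> \<le> (\<Sum>j. (a n j)\<^sup>2)" by (rule sum_le_suminf[OF a_sq_summable[OF n]]) auto
    finally have m: "real ?m * (a n (?m - 1))\<^sup>2 \<le> (\<Sum>j. (a n j)\<^sup>2)" .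
    have "real C * (c * ?p) * (a n (?m - 1))\<^sup>2 \<le> real ?m * (a n (?m - 1))\<^sup>2"
      using c(2)[OF n] by (intro mult_right_mono) (auto intro: mult_left_mono)
    then have "(real n)\<^sup>2 * (real C * (c * ?p) * (a n (?m - 1))\<^sup>2) \<le> (real n)\<^sup>2 * (\<Sum>j. (a n j)\<^sup>2)"
      using m by (intro mult_left_mono) auto
    also have "\<dots> \<le> V" by (rule V(2)[OF n])
    finally have "(real n * a n (?m - 1))\<^sup>2 \<le> V / c / real C / ?p"
      using C c p by (simp add: field_simps power_mult_distrib)
    then have "real n * a n (?m - 1) \<le> sqrt (V / c / real C / ?p)"
      by (rule real_le_rsqrt)
    then have "real n * (real n * a n (?m - 1)) \<le> real n * sqrt (V / c / real C / ?p)"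
      by (rule mult_left_mono) simp
    also have "\<dots> = sqrt (V / c) / sqrt (real C) * real n powr (2 * r)"
      unfolding powr_order[OF n, symmetric] mult_sqrt_divide real_sqrt_divide[of "V / c"] ..
    finally show "(real n)\<^sup>2 * a n (?m - 1) \<le> sqrt (V / c) / sqrt (real C) * real n powr (2 * r)"
      by (simp add: power2_eq_square mult.assoc)
  qed
qed

lemma a_head_lower:
  assumes "C \<ge> (2::nat)"
  shows "\<exists>c>0. \<forall>\<^sub>F n in sequentially. c * a n 0 \<le> a n (C * k n - 1)"
proof -
  \<comment> \<open>With this choice \<open>(1 - \<delta>1 n) * k n\<close> is exactly 1, so A4 with
    \<delta> = C - 1 compares the first weight with the one at \<open>C * k n\<close>. Positivity of
    \<delta> is the reason for C \<ge> 2.\<close>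
  define \<delta>1 where "\<delta>1 n = (if n \<ge> 1 then 1 - 1 / real (k n) else 0)" for n
  have idx: "(1 - \<delta>1 n) * real (k n) = 1" if "n \<ge> 1" for n
    using kn_pos[OF that] that by (simp add: \<delta>1_def)
  have "\<forall>n\<ge>1. 0 \<le> \<delta>1 n \<and> \<delta>1 n < 1"
    using kn_pos by (auto simp: \<delta>1_def Suc_le_eq)
  moreover have "\<forall>\<^sub>F n in sequentially. 1 \<le> (1 - \<delta>1 n) * real (k n)"
    using eventually_ge_at_top[of 1] by eventually_elim (simp add: idx)
  moreover have "0 < real C - 1" using assms by simp
  ultimately obtain c C2 where c: "0 < c" and c2: "\<forall>\<^sub>F n in sequentially.
       c < kappa2 \<kappa> n ((1 + (real C - 1)) * real (k n)) / kappa2 \<kappa> n ((1 - \<delta>1 n) * real (k n)) \<and>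
       kappa2 \<kappa> n ((1 + (real C - 1)) * real (k n)) / kappa2 \<kappa> n ((1 - \<delta>1 n) * real (k n)) < C2"
    using A4[unfolded A4_def, rule_format, of "real C - 1" \<delta>1] by blast
  from c2 have ev: "\<forall>\<^sub>F n in sequentially.
      c < kappa2 \<kappa> n ((1 + (real C - 1)) * real (k n)) / kappa2 \<kappa> n ((1 - \<delta>1 n) * real (k n))"
    by (rule eventually_mono) blast
  show ?thesis
  proof (intro exI[of _ c] conjI c)
    show "\<forall>\<^sub>F n in sequentially. c * a n 0 \<le> a n (C * k n - 1)"
      using ev eventually_ge_at_top[of 1]
    proof eventually_elim
      case (elim n)
      have eq: "(1 + (real C - 1)) * real (k n) = real (C * k n)" by simp
      have "kappa2 \<kappa> n ((1 + (real C - 1)) * real (k n)) = (\<kappa> (C * k n) n)\<^sup>2"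
        unfolding kappa2_def eq floor_of_nat nat_int ..
      then have "kappa2 \<kappa> n ((1 + (real C - 1)) * real (k n)) = a n (C * k n - 1)"
        using kn_pos[OF elim(2)] assms by (simp add: a_def)
      moreover have "kappa2 \<kappa> n ((1 - \<delta>1 n) * real (k n)) = a n 0"
        unfolding idx[OF elim(2)] by (simp add: kappa2_def a_def)
      ultimately show ?case using elim a0_pos[OF elim(2)] by (simp add: field_simps)
    qed
  qed
qed

text \<open>Counting bounds the weight at \<open>2 * k n\<close>, and the first weight is at most a
  constant times that one.\<close>

lemma a0_upper: "\<exists>B>0. \<forall>\<^sub>F n in sequentially. (real n)\<^sup>2 * a n 0 \<le> B * real n powr (2 * r)"
proof -
  obtain B where B: "B > 0" "\<forall>n\<ge>1. \<forall>C\<ge>1. (real n)\<^sup>2 * a n (C * k n - 1) \<le> B / sqrt (real C) * real n powr (2 * r)"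
    using a_tail_upper by blast
  obtain c where c: "c > 0" "\<forall>\<^sub>F n in sequentially. c * a n 0 \<le> a n (2 * k n - 1)"
    using a_head_lower[of 2] by auto
  show ?thesis
  proof (intro exI[of _ "B / sqrt 2 / c"] conjI)
    show "0 < B / sqrt 2 / c" using B c by simp
    show "\<forall>\<^sub>F n in sequentially. (real n)\<^sup>2 * a n 0 \<le> B / sqrt 2 / c * real n powr (2 * r)"
      using c(2) eventually_ge_at_top[of 1]
    proof eventually_elim
      case (elim n)
      have "(real n)\<^sup>2 * (c * a n 0) \<le> (real n)\<^sup>2 * a n (2 * k n - 1)"
        using elim(1) by (rule mult_left_mono) simp
      also have "\<dots> \<le> B / sqrt (real 2) * real n powr (2 * r)" using B(2)[rule_format, OF elim(2), of 2] by simp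
      finally show ?case using c(1) by (simp add: field_simps)
    qed
  qed
qed

text \<open>The exponent 2r - 1 is negative. A vanishing largest weight makes the linear noise
  negligible against the drift and lets the range of usable frequencies grow.\<close>

lemma a0_vanishes: "(\<lambda>n. real n * a n 0) \<longlonglongrightarrow> 0"
proof -
  obtain B where B: "\<forall>\<^sub>F n in sequentially. (real n)\<^sup>2 * a n 0 \<le> B * real n powr (2 * r)"
    using a0_upper by blast
  show ?thesis
  proof (rule tendsto_sandwich[OF _ _ tendsto_const])
    show "\<forall>\<^sub>F n in sequentially. 0 \<le> real n * a n 0" by simp
    show "\<forall>\<^sub>F n in sequentially. real n * a n 0 \<le> B * real n powr (2 * r - 1)"
      using B eventually_ge_at_top[of 1]
      by eventually_elim (simp add: powr_diff field_simps power2_eq_square)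
    have "(\<lambda>n. real n powr (2 * r - 1)) \<longlonglongrightarrow> 0"
      using r by (intro tendsto_neg_powr filterlim_real_sequentially) auto
    from tendsto_mult_left[OF this, of B] show "(\<lambda>n. B * real n powr (2 * r - 1)) \<longlonglongrightarrow> 0" by simp
  qed
qed

end

subsection \<open>Detectable signals\<close>

locale white_noise_model = quad_weights \<kappa> \<sigma> r + onb \<phi>
  for \<kappa> :: "nat \<Rightarrow> nat \<Rightarrow> real" and \<sigma> r :: real and \<phi> :: "nat \<Rightarrow> real \<Rightarrow> real" +
  fixes M :: "'a measure" and w :: "(real \<Rightarrow> real) \<Rightarrow> 'a \<Rightarrow> real"
  assumes noise: "white_noise M w"
begin

definition signal :: "nat \<Rightarrow> (real \<Rightarrow> real) \<Rightarrow> real" where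
  "signal n f = (real n)\<^sup>2 * (\<Sum>j. a n j * (coef \<phi> f j)\<^sup>2)"

lemma signal_summable: "n \<ge> 1 \<Longrightarrow> f \<in> L2 \<Longrightarrow> summable (\<lambda>j. a n j * (coef \<phi> f j)\<^sup>2)"
  by (rule summable_comparison_test'[of "\<lambda>j. a n 0 * (coef \<phi> f j)\<^sup>2" 0])
     (auto intro!: summable_mult mult_right_mono a_decr sums_summable[OF coef_sums])

text \<open>No weight of the head is below the last one there, which is at least a fixed fraction of
  the first. The constant depends on C but not on \<open>f\<close>.\<close>

lemma signal_lower:
  assumes "C \<ge> (2::nat)"
  shows "\<exists>c>0. \<forall>\<^sub>F n in sequentially. \<forall>f\<in>L2.
    c * (real n powr (2 * r) * energy \<phi> (C * k n) f) \<le> signal n f"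
proof -
  obtain c where c: "c > 0" "\<forall>\<^sub>F n in sequentially. c * a n 0 \<le> a n (C * k n - 1)"
    using a_head_lower[OF assms] by blast
  obtain d where d: "d > 0" "\<forall>n\<ge>1. d * real n powr (2 * r) \<le> (real n)\<^sup>2 * a n 0"
    using a0_lower by blast
  show ?thesis
  proof (intro exI[of _ "c * d"] conjI)
    show "0 < c * d" using c d by simp
    show "\<forall>\<^sub>F n in sequentially. \<forall>f\<in>L2. c * d * (real n powr (2 * r) * energy \<phi> (C * k n) f) \<le> signal n f"
      using c(2) eventually_ge_at_top[of 1]
    proof eventually_elim
      case (elim n)
      show ?case
      proof
        fix f assume f: "f \<in> L2"
        have "a n (C * k n - 1) * energy \<phi> (C * k n) f \<le> (\<Sum>j<C * k n. a n j * (coef \<phi> f j)\<^sup>2)"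
          unfolding energy_def sum_distrib_left
          by (intro sum_mono mult_right_mono a_decr elim) auto
        also have "\<dots> \<le> (\<Sum>j. a n j * (coef \<phi> f j)\<^sup>2)"
          by (rule sum_le_suminf[OF signal_summable[OF elim(2) f]]) auto
        finally have 1: "a n (C * k n - 1) * energy \<phi> (C * k n) f \<le> (\<Sum>j. a n j * (coef \<phi> f j)\<^sup>2)" .
        have "c * (d * real n powr (2 * r)) \<le> c * ((real n)\<^sup>2 * a n 0)"
          using c d elim by (intro mult_left_mono) auto
        also have "\<dots> \<le> (real n)\<^sup>2 * a n (C * k n - 1)"
          using mult_left_mono[OF elim(1), of "(real n)\<^sup>2"] by (simp add: mult_ac)
        finally have "c * (d * real n powr (2 * r)) * energy \<phi> (C * k n) f
            \<le> (real n)\<^sup>2 * a n (C * k n - 1) * energy \<phi> (C * k n) f"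
          by (rule mult_right_mono) simp
        also have "\<dots> \<le> signal n f"
          using mult_left_mono[OF 1, of "(real n)\<^sup>2"] by (simp add: signal_def mult_ac)
        finally show "c * d * (real n powr (2 * r) * energy \<phi> (C * k n) f) \<le> signal n f"
          by (simp add: mult_ac)
      qed
    qed
  qed
qed

text \<open>The head is weighted by at most the first weight, the rest by the last head weight,
  which brings in \<open>1 / sqrt C\<close>. One B and one range of n work for all \<open>f\<close>
  and all C, so C can be chosen afterwards.\<close>

lemma signal_upper:
  "\<exists>B>0. \<forall>\<^sub>F n in sequentially. \<forall>f\<in>L2. \<forall>C\<ge>1.
    signal n f \<le> B * (real n powr (2 * r) * energy \<phi> (C * k n) f)
      + B * (real n powr (2 * r) * (l2norm f)\<^sup>2) / sqrt (real C)"
proof -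
  obtain B1 where B1: "B1 > 0" "\<forall>n\<ge>1. \<forall>C\<ge>1. (real n)\<^sup>2 * a n (C * k n - 1) \<le> B1 / sqrt (real C) * real n powr (2 * r)"
    using a_tail_upper by blast
  obtain B2 where B2: "B2 > 0" "\<forall>\<^sub>F n in sequentially. (real n)\<^sup>2 * a n 0 \<le> B2 * real n powr (2 * r)"
    using a0_upper by blast
  define B where "B = max B1 B2"
  show ?thesis
  proof (intro exI[of _ B] conjI)
    show "0 < B" using B1 by (simp add: B_def)
    show "\<forall>\<^sub>F n in sequentially. \<forall>f\<in>L2. \<forall>C\<ge>1.
      signal n f \<le> B * (real n powr (2 * r) * energy \<phi> (C * k n) f)
        + B * (real n powr (2 * r) * (l2norm f)\<^sup>2) / sqrt (real C)"
      using B2(2) eventually_ge_at_top[of 1]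
    proof eventually_elim
      case (elim n)
      show ?case
      proof (intro ballI allI impI)
        fix f and C :: nat assume f: "f \<in> L2" and C: "1 \<le> C"
        let ?m = "C * k n" and ?p = "real n powr (2 * r)"
        have le: "a n j * (coef \<phi> f j)\<^sup>2 
            \<le> a n 0 * (if j \<in> {..<?m} then (coef \<phi> f j)\<^sup>2 else 0) + a n (?m - 1) * (coef \<phi> f j)\<^sup>2" for j
        proof (cases "j < ?m")
          case True
          then show ?thesis using a_decr[OF elim(2), of 0 j] by (simp add: add_increasing2 mult_right_mono)
        next
          case False
          then show ?thesis using a_decr[OF elim(2), of "?m - 1" j] by (simp add: mult_right_mono)
        qed
        have s1: "(\<lambda>j. a n 0 * (if j \<in> {..<?m} then (coef \<phi> f j)\<^sup>2 else 0)) sums (a n 0 * energy \<phi> ?m f)"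
          unfolding energy_def by (intro sums_mult sums_If_finite_set) simp
        have s2: "(\<lambda>j. a n (?m - 1) * (coef \<phi> f j)\<^sup>2) sums (a n (?m - 1) * (l2norm f)\<^sup>2)"
          by (intro sums_mult coef_sums f)
        have "(\<Sum>j. a n j * (coef \<phi> f j)\<^sup>2) \<le> a n 0 * energy \<phi> ?m f + a n (?m - 1) * (l2norm f)\<^sup>2"
          by (rule sums_le[OF le summable_sums[OF signal_summable[OF elim(2) f]] sums_add[OF s1 s2]])
        then have "signal n f \<le> (real n)\<^sup>2 * (a n 0 * energy \<phi> ?m f + a n (?m - 1) * (l2norm f)\<^sup>2)"
          unfolding signal_def by (rule mult_left_mono) simp
        also have "\<dots> = (real n)\<^sup>2 * a n 0 * energy \<phi> ?m f + (real n)\<^sup>2 * a n (?m - 1) * (l2norm f)\<^sup>2"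
          by (simp add: algebra_simps)
        also have "\<dots> \<le> (B * ?p) * energy \<phi> ?m f + (B / sqrt (real C) * ?p) * (l2norm f)\<^sup>2"
        proof (intro add_mono mult_right_mono)
          show "(real n)\<^sup>2 * a n 0 \<le> B * ?p"
            by (rule order_trans[OF elim(1)]) (simp add: B_def mult_right_mono)
          have "B1 / sqrt (real C) * ?p \<le> B / sqrt (real C) * ?p"
            by (intro mult_right_mono divide_right_mono) (auto simp: B_def)
          then show "(real n)\<^sup>2 * a n (?m - 1) \<le> B / sqrt (real C) * ?p"
            using B1(2)[rule_format, OF elim(2) C] by linarith
        qed auto
        finally show "signal n f \<le> B * (?p * energy \<phi> ?m f) + B * (?p * (l2norm f)\<^sup>2) / sqrt (real C)"
          by (simp add: mult_ac)
      qed
    qed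
  qed
qed

section \<open>The normalized statistic\<close>

definition \<xi> :: "nat \<Rightarrow> 'a \<Rightarrow> real" where
  "\<xi> j = w (\<phi> (Suc j))"

text \<open>In the normalization \<open>n\<^sup>2 T\<^sub>n = Ss (b n) (x n f)\<close> the null statistic has a variance bounded
  above and below, and the drift caused by \<open>f\<close> is \<open>signal n f\<close>.\<close>

definition b :: "nat \<Rightarrow> nat \<Rightarrow> real" where
  "b n j = real n * \<sigma>\<^sup>2 * a n j"

definition x :: "nat \<Rightarrow> (real \<Rightarrow> real) \<Rightarrow> nat \<Rightarrow> real" where
  "x n f j = coef \<phi> f j * sqrt (real n) / \<sigma>"

sublocale gauss_seq M \<xi>
proof -
  interpret prob_space M using noise by (simp add: white_noise_def)
  have os: "orthonormal_system \<phi>" using basis by (simp add: orthonormal_basis_def)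
  have "range Suc = {1..}" by (auto simp: image_iff) (metis Suc_le_D One_nat_def)
  then have iv: "indep_vars (\<lambda>_. borel) (\<lambda>j. w (\<phi> j)) (range Suc)"
    using noise os by (simp add: white_noise_def)
  from indep_vars_reindex[OF _ iv] have "indep_vars (\<lambda>_. borel) \<xi> UNIV"
    by (simp add: comp_def \<xi>_def[abs_def])
  moreover have "distributed M lborel (\<xi> j) std_normal_density" for j
    using noise os by (simp add: white_noise_def \<xi>_def)
  ultimately show "gauss_seq M \<xi>" by unfold_locales
qed

lemma weights: "n \<ge> 1 \<Longrightarrow> gauss_weights M \<xi> (b n) (b n 0)"
proof unfold_locales
  assume n: "n \<ge> 1"
  show "0 \<le> b n j" for j by (simp add: b_def)
  show "b n j \<le> b n 0" for j unfolding b_def by (intro mult_left_mono a_decr n) auto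
  show "summable (b n)" unfolding b_def[abs_def] by (rule summable_mult[OF a_summable[OF n]])
qed

lemma x_summable: "f \<in> L2 \<Longrightarrow> summable (\<lambda>j. (x n f j)\<^sup>2)"
  unfolding x_def power_divide power_mult_distrib
  by (rule summable_divide[OF summable_mult2[OF sums_summable[OF coef_sums]]])

lemma b_x_sq: "n \<ge> 1 \<Longrightarrow> f \<in> L2 \<Longrightarrow> (\<Sum>j. b n j * (x n f j)\<^sup>2) = signal n f"
proof -
  assume n: "n \<ge> 1" and f: "f \<in> L2"
  have "b n j * (x n f j)\<^sup>2 = (real n)\<^sup>2 * (a n j * (coef \<phi> f j)\<^sup>2)" for j
    using sigma by (simp add: b_def x_def power_divide power_mult_distrib power2_eq_square)
  then show ?thesis by (simp add: signal_def suminf_mult[OF signal_summable[OF n f]])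
qed

lemma b_sq_bounds:
  obtains v V where "0 < v" "0 < V" "\<And>n. n \<ge> 1 \<Longrightarrow> v \<le> (\<Sum>j. (b n j)\<^sup>2)" "\<And>n. n \<ge> 1 \<Longrightarrow> (\<Sum>j. (b n j)\<^sup>2) \<le> V"
proof -
  obtain c C where cC: "0 < c" "0 < C"
    "\<And>n. n \<ge> 1 \<Longrightarrow> c \<le> (real n)\<^sup>2 * (\<Sum>j. (a n j)\<^sup>2)"
    "\<And>n. n \<ge> 1 \<Longrightarrow> (real n)\<^sup>2 * (\<Sum>j. (a n j)\<^sup>2) \<le> C"
    by (rule An_bounds) blast
  have eq: "(\<Sum>j. (b n j)\<^sup>2) = \<sigma> ^ 4 * ((real n)\<^sup>2 * (\<Sum>j. (a n j)\<^sup>2))" if "n \<ge> 1" for n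
    unfolding b_def power_mult_distrib suminf_mult[OF a_sq_summable[OF that]]
    by (simp add: power_mult[symmetric])
  show thesis
    by (rule that[of "\<sigma> ^ 4 * c" "\<sigma> ^ 4 * C"])
       (use cC sigma in \<open>auto simp: eq intro!: mult_left_mono\<close>)
qed

lemma b0_vanishes: "(\<lambda>n. b n 0) \<longlonglongrightarrow> 0"
  using tendsto_mult_left[OF a0_vanishes, of "\<sigma>\<^sup>2"] by (simp add: b_def mult_ac)

section \<open>Error probabilities and the drift\<close>

text \<open>The errors of the test with normalized threshold \<open>c\<close> add up to 1 minus this
  number, so consistency means that suitable thresholds keep it bounded away from 0.\<close>

definition gap :: "nat \<Rightarrow> (real \<Rightarrow> real) \<Rightarrow> real \<Rightarrow> real" where
  "gap n f c = prob {\<omega> \<in> space M. Ss (b n) (\<lambda>_. 0) \<omega> \<le> c} - prob {\<omega> \<in> space M. Ss (b n) (x n f) \<omega> \<le> c}"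

lemma AE_quad_stat:
  assumes n: "n \<ge> 1" and f: "f \<in> L2"
  shows "AE \<omega> in M. (real n)\<^sup>2 * quad_stat \<phi> \<kappa> \<sigma> n (observed w \<sigma> n f \<omega>) = Ss (b n) (x n f) \<omega>"
proof -
  interpret gauss_weights M \<xi> "b n" "b n 0" by (rule weights[OF n])
  from AE_summable_shift[OF x_summable[OF f], of n] show ?thesis
  proof eventually_elim
    case (elim \<omega>)
    have n0: "0 < real n" using n by simp
    have 1: "a n j * (observed w \<sigma> n f \<omega> (\<phi> (Suc j)))\<^sup>2 = 1 / (real n)\<^sup>2 * (b n j * (x n f j + \<xi> j \<omega>)\<^sup>2)" for j
    proof -
      have "observed w \<sigma> n f \<omega> (\<phi> (Suc j)) = \<sigma> / sqrt (real n) * (x n f j + \<xi> j \<omega>)"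
        using n0 sigma by (simp add: observed_def x_def \<xi>_def coef_def field_simps)
      then show ?thesis using n0
        by (simp add: b_def power_mult_distrib power_divide) (simp add: power2_eq_square)
    qed
    have 2: "\<sigma>\<^sup>2 / real n * a n j = 1 / (real n)\<^sup>2 * b n j" for j
      using n0 by (simp add: b_def power2_eq_square)
    have "\<sigma>\<^sup>2 / real n * (\<Sum>j. a n j) = (\<Sum>j. \<sigma>\<^sup>2 / real n * a n j)"
      by (rule suminf_mult[OF a_summable[OF n], symmetric])
    also have "\<dots> = 1 / (real n)\<^sup>2 * (\<Sum>j. b n j)"
      unfolding 2 by (rule suminf_mult[OF b_summable])
    finally have "quad_stat \<phi> \<kappa> \<sigma> n (observed w \<sigma> n f \<omega>)
       = (\<Sum>j. a n j * (observed w \<sigma> n f \<omega> (\<phi> (Suc j)))\<^sup>2) - 1 / (real n)\<^sup>2 * (\<Sum>j. b n j)"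
      by (simp add: quad_stat_def a_def)
    also have "\<dots> = 1 / (real n)\<^sup>2 * Ss (b n) (x n f) \<omega>"
      unfolding 1 suminf_mult[OF elim] Ss_def by (simp add: right_diff_distrib)
    finally show ?case using n0 by simp
  qed
qed

lemma measurable_quad_stat [measurable]:
  "(\<lambda>\<omega>. quad_stat \<phi> \<kappa> \<sigma> n (observed w \<sigma> n f \<omega>)) \<in> borel_measurable M"
proof -
  have [measurable]: "w (\<phi> (Suc j)) \<in> borel_measurable M" for j
    using rv[of j] by (simp add: \<xi>_def)
  show ?thesis unfolding quad_stat_def observed_def by measurable
qed

lemma errors_eq:
  assumes n: "n \<ge> 1" and f: "f \<in> L2" and K: "\<And>Y. K Y \<longleftrightarrow> quad_stat \<phi> \<kappa> \<sigma> n Y > c"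
  shows "type1_error M w \<sigma> n K + type2_error M w \<sigma> n K f = 1 - gap n f ((real n)\<^sup>2 * c)"
proof -
  let ?c = "(real n)\<^sup>2 * c"
  have pos: "0 < (real n)\<^sup>2" using n by simp
  have iff: "quad_stat \<phi> \<kappa> \<sigma> n Y \<le> c \<longleftrightarrow> (real n)\<^sup>2 * quad_stat \<phi> \<kappa> \<sigma> n Y \<le> ?c" for Y
    using pos by (simp add: mult_le_cancel_left_pos)
  have accept: "prob {\<omega> \<in> space M. quad_stat \<phi> \<kappa> \<sigma> n (observed w \<sigma> n g \<omega>) \<le> c}
      = prob {\<omega> \<in> space M. Ss (b n) (x n g) \<omega> \<le> ?c}" if g: "g \<in> L2" for g
    using AE_quad_stat[OF n g] unfolding iff by (intro finite_measure_eq_AE) auto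
  have zero: "x n (\<lambda>_. 0) = (\<lambda>_. 0)" by (simp add: x_def coef_def fun_eq_iff)
  have "type1_error M w \<sigma> n K
      = 1 - prob {\<omega> \<in> space M. quad_stat \<phi> \<kappa> \<sigma> n (observed w \<sigma> n (\<lambda>_. 0) \<omega>) \<le> c}"
    unfolding type1_error_def K
    by (subst prob_compl[symmetric]) (auto intro!: arg_cong[where f = prob])
  moreover have "type2_error M w \<sigma> n K f
      = prob {\<omega> \<in> space M. quad_stat \<phi> \<kappa> \<sigma> n (observed w \<sigma> n f \<omega>) \<le> c}"
    unfolding type2_error_def K by (simp add: not_less)
  ultimately show ?thesis using accept[OF L2_zero] accept[OF f] by (simp add: gap_def zero)
qed

lemma gap_lower:
  assumes d: "0 < d"
  shows "\<exists>\<eta>>0. \<forall>\<^sub>F n in sequentially. \<forall>f\<in>L2. d \<le> signal n f \<longrightarrow> (\<exists>c. \<eta> \<le> gap n f c)"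
proof -
  obtain V where V: "0 < V" "\<And>n. n \<ge> 1 \<Longrightarrow> (\<Sum>j. (b n j)\<^sup>2) \<le> V"
    by (rule b_sq_bounds) blast
  \<comment> \<open>N meets the requirement of \<open>separation\<close>, which then offers 1 / (2
    N). Half of this is kept back for the loss \<open>16 * b n 0 / d\<close>, which vanishes with
    the largest weight.\<close>
  define N where "N = Suc (nat \<lceil>4 * sqrt (8 * V) / d\<rceil>)"
  have N: "4 * sqrt (8 * V) / d \<le> real N" "0 < N" unfolding N_def by linarith+
  have "\<forall>\<^sub>F n in sequentially. b n 0 < d / 16 * (1 / (4 * real N))"
    using N d by (intro order_tendstoD(2)[OF b0_vanishes]) simp
  then have "\<forall>\<^sub>F n in sequentially. \<forall>f\<in>L2. d \<le> signal n f \<longrightarrow> (\<exists>c. 1 / (4 * real N) \<le> gap n f c)"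
    using eventually_ge_at_top[of 1]
  proof eventually_elim
    case (elim n)
    interpret gauss_weights M \<xi> "b n" "b n 0" by (rule weights[OF elim(2)])
    have "16 * b n 0 / d \<le> 1 / (4 * real N)" using elim(1) d N by (simp add: field_simps)
    moreover have "1 / (2 * real N) = 1 / (4 * real N) + 1 / (4 * real N)" by (simp add: field_simps)
    ultimately have le: "1 / (4 * real N) \<le> 1 / (2 * real N) - 16 * b n 0 / d" by linarith
    show ?case
    proof (intro ballI impI)
      fix f assume f: "f \<in> L2" and sig: "d \<le> signal n f"
      have "d \<le> (\<Sum>j. b n j * (x n f j)\<^sup>2)" using sig by (simp add: b_x_sq[OF elim(2) f])
      from separation[OF V(1) V(2)[OF elim(2)] d this x_summable[OF f] N]
      obtain c where "1 / (2 * real N) - 16 * b n 0 / d \<le> gap n f c" unfolding gap_def by blast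
      with le show "\<exists>c. 1 / (4 * real N) \<le> gap n f c" by (intro exI[of _ c]) linarith
    qed
  qed
  then show ?thesis using N by (intro exI[of _ "1 / (4 * real N)"]) simp
qed

lemma gap_upper:
  assumes eta: "0 < \<eta>"
  shows "\<exists>d>0. \<forall>\<^sub>F n in sequentially. \<forall>f\<in>L2. signal n f \<le> d \<longrightarrow> (\<forall>c. gap n f c \<le> \<eta>)"
proof -
  obtain v where v: "0 < v" "\<And>n. n \<ge> 1 \<Longrightarrow> v \<le> (\<Sum>j. (b n j)\<^sup>2)"
    by (rule b_sq_bounds) blast
  obtain K where K: "0 < K" and conc: "\<And>b \<beta> v \<epsilon> c. gauss_weights M \<xi> b \<beta> \<Longrightarrow> 0 < \<beta> \<Longrightarrow> 0 < v
      \<Longrightarrow> v \<le> (\<Sum>j. (b j)\<^sup>2) \<Longrightarrow> 0 < \<epsilon> \<Longrightarrow>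
     prob {\<omega> \<in> space M. c - \<epsilon> < Zs b \<omega> \<and> Zs b \<omega> \<le> c} \<le> K * (\<epsilon> / sqrt v + (\<beta> / \<epsilon>)\<^sup>2)"
    using anti_concentration by blast
  \<comment> \<open>The window contributes \<open>K * (\<epsilon> / sqrt v)\<close>, set here to
    half of \<eta>; the other terms contain \<open>b n 0\<close> and vanish. The admissible drift
    \<epsilon>/2 is what \<open>no_separation\<close> tolerates.\<close>
  define \<epsilon> where "\<epsilon> = \<eta> / 2 / K * sqrt v"
  have e: "0 < \<epsilon>" "K * (\<epsilon> / sqrt v) = \<eta> / 2" using eta K v by (simp_all add: \<epsilon>_def)
  have "(\<lambda>n. K * (b n 0 / \<epsilon>)\<^sup>2 + 16 * b n 0 * (\<epsilon> / 2) / \<epsilon>\<^sup>2) \<longlonglongrightarrow> K * (0 / \<epsilon>)\<^sup>2 + 16 * 0 * (\<epsilon> / 2) / \<epsilon>\<^sup>2"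
    using e by (intro tendsto_intros b0_vanishes) auto
  then have "\<forall>\<^sub>F n in sequentially. K * (b n 0 / \<epsilon>)\<^sup>2 + 16 * b n 0 * (\<epsilon> / 2) / \<epsilon>\<^sup>2 < \<eta> / 2"
    using eta by (intro order_tendstoD(2)) auto
  then have "\<forall>\<^sub>F n in sequentially. \<forall>f\<in>L2. signal n f \<le> \<epsilon> / 2 \<longrightarrow> (\<forall>c. gap n f c \<le> \<eta>)"
    using eventually_ge_at_top[of 1]
  proof eventually_elim
    case (elim n)
    interpret gauss_weights M \<xi> "b n" "b n 0" by (rule weights[OF elim(2)])
    have b0: "0 < b n 0" using a0_pos[OF elim(2)] elim(2) sigma by (simp add: b_def)
    show ?case
    proof (intro ballI impI allI)
      fix f c assume f: "f \<in> L2" and sig: "signal n f \<le> \<epsilon> / 2"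
      have "gap n f c \<le> K * (\<epsilon> / sqrt v + (b n 0 / \<epsilon>)\<^sup>2) + 16 * b n 0 * signal n f / \<epsilon>\<^sup>2"
        using no_separation[OF x_summable[OF f], of n \<epsilon> c] sig e b_x_sq[OF elim(2) f]
          conc[OF gauss_weights_axioms b0 v(1) v(2)[OF elim(2)] e(1), of c]
        unfolding gap_def by simp
      also have "16 * b n 0 * signal n f / \<epsilon>\<^sup>2 \<le> 16 * b n 0 * (\<epsilon> / 2) / \<epsilon>\<^sup>2"
        using sig b0 by (intro divide_right_mono mult_left_mono) auto
      finally show "gap n f c \<le> \<eta>" using elim(1) e(2) unfolding distrib_left by linarith
    qed
  qed
  then show ?thesis using e by (intro exI[of _ "\<epsilon> / 2"]) simp
qed

lemma errors_gap:
  assumes "n \<ge> 1" "f \<in> L2" "generated_by K (quad_stat \<phi> \<kappa> \<sigma> n)"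
  obtains c where "type1_error M w \<sigma> n K + type2_error M w \<sigma> n K f = 1 - gap n f c"
proof -
  obtain c where "\<And>Y. K Y \<longleftrightarrow> quad_stat \<phi> \<kappa> \<sigma> n Y > c"
    using assms(3) unfolding generated_by_def by blast
  from errors_eq[OF assms(1,2) this] show thesis by (rule that)
qed

text \<open>Thresholds are chosen separately at each n, so one sequence of tests exploits every n at
  which some threshold separates, whether these n are all large ones or only infinitely many.
  Elsewhere the threshold is arbitrary.\<close>

lemma good_tests:
  assumes f: "\<forall>n\<ge>1. f n \<in> L2"
  shows "\<exists>K. (\<forall>n\<ge>1. generated_by (K n) (quad_stat \<phi> \<kappa> \<sigma> n)) \<and>
    (\<forall>n\<ge>1. (\<exists>c. \<eta> \<le> gap n (f n) c) \<longrightarrow>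
      type1_error M w \<sigma> n (K n) + type2_error M w \<sigma> n (K n) (f n) \<le> 1 - \<eta>)"
proof -
  define c where "c n = (SOME c. \<eta> \<le> gap n (f n) c) / (real n)\<^sup>2" for n
  define K where "K n Y \<longleftrightarrow> quad_stat \<phi> \<kappa> \<sigma> n Y > c n" for n Y
  have "type1_error M w \<sigma> n (K n) + type2_error M w \<sigma> n (K n) (f n) \<le> 1 - \<eta>"
    if n: "n \<ge> 1" and ex: "\<exists>c. \<eta> \<le> gap n (f n) c" for n
  proof -
    have "type1_error M w \<sigma> n (K n) + type2_error M w \<sigma> n (K n) (f n) = 1 - gap n (f n) ((real n)\<^sup>2 * c n)"
      using n f by (intro errors_eq) (auto simp: K_def)
    moreover have "(real n)\<^sup>2 * c n = (SOME c. \<eta> \<le> gap n (f n) c)" using n by (simp add: c_def)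
    ultimately show ?thesis using someI_ex[OF ex] by simp
  qed
  then show ?thesis by (intro exI[of _ K]) (auto simp: generated_by_def K_def)
qed

lemma consistent_iff_signal:
  assumes f: "\<forall>n\<ge>1. f n \<in> L2"
  shows "consistent M w \<sigma> (quad_stat \<phi> \<kappa> \<sigma>) f \<longleftrightarrow> (\<exists>d>0. \<forall>\<^sub>F n in sequentially. d \<le> signal n (f n))"
proof
  assume "consistent M w \<sigma> (quad_stat \<phi> \<kappa> \<sigma>) f"
  then obtain K where K: "\<forall>n\<ge>1. generated_by (K n) (quad_stat \<phi> \<kappa> \<sigma> n)"
    and lim: "limsup (\<lambda>n. ereal (type1_error M w \<sigma> n (K n) + type2_error M w \<sigma> n (K n) (f n))) < 1"
    unfolding consistent_def by blast
  from ereal_dense2[OF lim] obtain y where y: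
    "limsup (\<lambda>n. ereal (type1_error M w \<sigma> n (K n) + type2_error M w \<sigma> n (K n) (f n))) < ereal y" "ereal y < 1"
    by blast
  have ev: "\<forall>\<^sub>F n in sequentially. ereal (type1_error M w \<sigma> n (K n) + type2_error M w \<sigma> n (K n) (f n)) < ereal y"
    by (rule Limsup_lessD[OF y(1)])
  \<comment> \<open>Errors below y mean a gap above 1 - y, so a drift that permits only half of that
    is excluded.\<close>
  have "0 < (1 - y) / 2" using y(2) by (simp add: one_ereal_def)
  from gap_upper[OF this] obtain d where d: "d > 0"
    "\<forall>\<^sub>F n in sequentially. \<forall>f\<in>L2. signal n f \<le> d \<longrightarrow> (\<forall>c. gap n f c \<le> (1 - y) / 2)" by blast
  have "\<forall>\<^sub>F n in sequentially. d \<le> signal n (f n)"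
    using ev d(2) eventually_ge_at_top[of 1]
  proof eventually_elim
    case (elim n)
    obtain c where "type1_error M w \<sigma> n (K n) + type2_error M w \<sigma> n (K n) (f n) = 1 - gap n (f n) c"
      using errors_gap[OF elim(3) f[rule_format, OF elim(3)] K[rule_format, OF elim(3)]] by blast
    then have "gap n (f n) c > (1 - y) / 2" using elim(1) y(2) by (simp add: one_ereal_def)
    then have "\<not> signal n (f n) \<le> d" using elim(2,3) f by (auto simp: not_less[symmetric] simp del: not_less)
    then show ?case by simp
  qed
  with d(1) show "\<exists>d>0. \<forall>\<^sub>F n in sequentially. d \<le> signal n (f n)" by blast
next
  assume "\<exists>d>0. \<forall>\<^sub>F n in sequentially. d \<le> signal n (f n)"
  then obtain d where d: "d > 0" "\<forall>\<^sub>F n in sequentially. d \<le> signal n (f n)" by blast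
  obtain \<eta> where eta: "\<eta> > 0" "\<forall>\<^sub>F n in sequentially. \<forall>f\<in>L2. d \<le> signal n f \<longrightarrow> (\<exists>c. \<eta> \<le> gap n f c)"
    using gap_lower[OF d(1)] by blast
  obtain K where K: "\<forall>n\<ge>1. generated_by (K n) (quad_stat \<phi> \<kappa> \<sigma> n)"
    "\<And>n. n \<ge> 1 \<Longrightarrow> (\<exists>c. \<eta> \<le> gap n (f n) c) \<Longrightarrow>
      type1_error M w \<sigma> n (K n) + type2_error M w \<sigma> n (K n) (f n) \<le> 1 - \<eta>"
    using good_tests[OF f, of \<eta>] by blast
  have "\<forall>\<^sub>F n in sequentially. ereal (type1_error M w \<sigma> n (K n) + type2_error M w \<sigma> n (K n) (f n)) \<le> ereal (1 - \<eta>)"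
    using d(2) eta(2) eventually_ge_at_top[of 1] by eventually_elim (use K(2) f in simp)
  then have "limsup (\<lambda>n. ereal (type1_error M w \<sigma> n (K n) + type2_error M w \<sigma> n (K n) (f n))) \<le> ereal (1 - \<eta>)"
    by (rule Limsup_bounded)
  also have "\<dots> < 1" using eta(1) by (simp add: one_ereal_def)
  finally show "consistent M w \<sigma> (quad_stat \<phi> \<kappa> \<sigma>) f" unfolding consistent_def using K(1) by blast
qed

text \<open>Inconsistency concerns all tests, hence also those of \<open>good_tests\<close>. For
  large n with drift at least d, these keep the error sum below 1 by a fixed \<eta>, so this happens
  only finitely often. Conversely, \<open>gap_upper\<close> holds for every threshold and so for
  every test.\<close>

lemma inconsistent_iff_signal:
  assumes f: "\<forall>n\<ge>1. f n \<in> L2"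
  shows "inconsistent M w \<sigma> (quad_stat \<phi> \<kappa> \<sigma>) f \<longleftrightarrow> (\<forall>d>0. \<forall>\<^sub>F n in sequentially. signal n (f n) < d)"
proof
  assume inc: "inconsistent M w \<sigma> (quad_stat \<phi> \<kappa> \<sigma>) f"
  show "\<forall>d>0. \<forall>\<^sub>F n in sequentially. signal n (f n) < d"
  proof (intro allI impI)
    fix d :: real assume d: "0 < d"
    obtain \<eta> where eta0: "\<eta> > 0 \<and> (\<forall>\<^sub>F n in sequentially. \<forall>f\<in>L2. d \<le> signal n f \<longrightarrow> (\<exists>c. \<eta> \<le> gap n f c))"
      using gap_lower[OF d] ..
    note eta = conjunct1[OF eta0] conjunct2[OF eta0]
    obtain K where K: "\<forall>n\<ge>1. generated_by (K n) (quad_stat \<phi> \<kappa> \<sigma> n)"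
      "\<And>n. n \<ge> 1 \<Longrightarrow> (\<exists>c. \<eta> \<le> gap n (f n) c) \<Longrightarrow>
        type1_error M w \<sigma> n (K n) + type2_error M w \<sigma> n (K n) (f n) \<le> 1 - \<eta>"
      using good_tests[OF f, of \<eta>] by blast
    have "ereal (1 - \<eta>) < 1" using eta(1) by (simp add: one_ereal_def)
    also have "\<dots> \<le> liminf (\<lambda>n. ereal (type1_error M w \<sigma> n (K n) + type2_error M w \<sigma> n (K n) (f n)))"
      using inc K(1) unfolding inconsistent_def by blast
    finally have "\<forall>\<^sub>F n in sequentially. ereal (1 - \<eta>) < ereal (type1_error M w \<sigma> n (K n) + type2_error M w \<sigma> n (K n) (f n))"
      by (rule less_LiminfD)
    then show "\<forall>\<^sub>F n in sequentially. signal n (f n) < d"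
      using eta(2) eventually_ge_at_top[of 1]
    proof eventually_elim
      case (elim n)
      show ?case
      proof (rule ccontr)
        assume "\<not> signal n (f n) < d"
        then show False using elim K(2)[OF elim(3)] f by (simp add: not_less)
      qed
    qed
  qed
next
  assume sig: "\<forall>d>0. \<forall>\<^sub>F n in sequentially. signal n (f n) < d"
  show "inconsistent M w \<sigma> (quad_stat \<phi> \<kappa> \<sigma>) f"
    unfolding inconsistent_def
  proof (intro allI impI)
    fix K assume K: "\<forall>n\<ge>1. generated_by (K n) (quad_stat \<phi> \<kappa> \<sigma> n)"
    let ?L = "liminf (\<lambda>n. ereal (type1_error M w \<sigma> n (K n) + type2_error M w \<sigma> n (K n) (f n)))"
    show "1 \<le> ?L"
    proof (rule dense_le)
      fix y :: ereal assume y: "y < 1"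
      then obtain z where z: "y < ereal z" "ereal z < 1" using ereal_dense2 by blast
      then have "0 < 1 - z" by (simp add: one_ereal_def)
      from gap_upper[OF this] obtain d where d: "d > 0"
        "\<forall>\<^sub>F n in sequentially. \<forall>f\<in>L2. signal n f \<le> d \<longrightarrow> (\<forall>c. gap n f c \<le> 1 - z)" by blast
      have "\<forall>\<^sub>F n in sequentially. ereal z \<le> ereal (type1_error M w \<sigma> n (K n) + type2_error M w \<sigma> n (K n) (f n))"
        using d(2) sig[rule_format, OF d(1)] eventually_ge_at_top[of 1]
      proof eventually_elim
        case (elim n)
        obtain c where "type1_error M w \<sigma> n (K n) + type2_error M w \<sigma> n (K n) (f n) = 1 - gap n (f n) c"
          using errors_gap[OF elim(3) f[rule_format, OF elim(3)] K[rule_format, OF elim(3)]] by blast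
        moreover have "gap n (f n) c \<le> 1 - z" using elim f by simp
        ultimately show ?case by simp
      qed
      then have "ereal z \<le> ?L" by (rule Liminf_bounded)
      with z(1) show "y \<le> ?L" by simp
    qed
  qed
qed

end

subsection \<open>Maxisets\<close>

text \<open>The estimates are asymptotic, but \<open>same_order\<close> and membership in a ball are
  needed at every n. Finitely many exceptions only enlarge the constant.\<close>

lemma eventually_bounded_imp_bounded:
  fixes y :: "nat \<Rightarrow> real"
  assumes "\<forall>\<^sub>F n in sequentially. y n \<le> B"
  obtains B' where "0 < B'" "\<And>n. y n \<le> B'"
proof -
  obtain N where N: "\<And>n. n \<ge> N \<Longrightarrow> y n \<le> B"
    using assms unfolding eventually_sequentially by blast
  let ?S = "\<Sum>n<N. \<bar>y n\<bar>"
  have "y n \<le> max 1 B + ?S" for n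
  proof (cases "n < N")
    case True
    have "\<bar>y n\<bar> \<le> ?S" by (rule member_le_sum) (use True in auto)
    then show ?thesis by linarith
  next
    case False
    then have "y n \<le> B" using N by simp
    moreover have "0 \<le> ?S" by (simp add: sum_nonneg)
    ultimately show ?thesis by linarith
  qed
  then show thesis by (intro that[of "max 1 B + ?S"]) (simp_all add: add_pos_nonneg sum_nonneg)
qed

text \<open>A lower constant survives finitely many exceptions only if the values there are
  positive; reciprocals reduce this to an upper bound.\<close>

lemma eventually_bounded_below_imp_bounded_below:
  fixes y :: "nat \<Rightarrow> real"
  assumes "0 < c" "\<forall>\<^sub>F n in sequentially. c \<le> y n" "\<And>n. n \<ge> 1 \<Longrightarrow> 0 < y n"
  obtains c' where "0 < c'" "\<And>n. n \<ge> 1 \<Longrightarrow> c' \<le> y n"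
proof -
  have "\<forall>\<^sub>F n in sequentially. 1 / y n \<le> 1 / c"
    using assms(2) by eventually_elim (use assms(1) in \<open>simp add: frac_le\<close>)
  then obtain B where B: "0 < B" "\<And>n. 1 / y n \<le> B"
    by (rule eventually_bounded_imp_bounded) blast
  have "1 / B \<le> y n" if "n \<ge> 1" for n
    using B(1) B(2)[of n] assms(3)[OF that] by (simp add: field_simps)
  then show thesis using B(1) by (intro that[of "1 / B"]) auto
qed

text \<open>A projection has no tail beyond m. Below m the factor \<open>l powr (2 * s)\<close> is
  at most its value at m and the tail at most the whole energy, so the supremum over
  \<open>l\<close> costs a single inequality.\<close>

lemma (in onb) proj_in_ball:
  assumes f: "f \<in> L2" and "0 < \<gamma>" "0 < s" "0 < P0"
    and le: "real m powr (2 * s) * energy \<phi> m f \<le> \<gamma>\<^sup>2 * P0"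
  shows "proj \<phi> m f \<in> scale_set \<gamma> (besov_ball \<phi> s P0)"
  unfolding scaled_ball_iff[OF assms(2)] norm_proj energy_proj
proof (intro conjI allI impI proj_L2)
  fix l :: real assume l: "0 < l"
  show "l powr (2 * s) * (energy \<phi> m f - energy \<phi> (min (nat \<lfloor>l\<rfloor>) m) f) \<le> \<gamma>\<^sup>2 * P0"
  proof (cases "nat \<lfloor>l\<rfloor> < m")
    case True
    then have "l \<le> real m" by linarith
    then have "l powr (2 * s) * (energy \<phi> m f - energy \<phi> (min (nat \<lfloor>l\<rfloor>) m) f)
        \<le> real m powr (2 * s) * energy \<phi> m f"
      using l assms energy_mono[of "min (nat \<lfloor>l\<rfloor>) m" m \<phi> f]
      by (intro mult_mono powr_mono2) auto
    with le show ?thesis by linarith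
  next
    case False
    then show ?thesis using assms by (simp add: min_absorb2)
  qed
qed

context white_noise_model
begin

section \<open>Consistency in terms of the energy in the head\<close>

definition rate :: "nat \<Rightarrow> real" where
  "rate n = real n powr (- r)"

lemma rate_pos: "n \<ge> 1 \<Longrightarrow> 0 < rate n"
  by (simp add: rate_def)

lemma rate_le_1: "n \<ge> 1 \<Longrightarrow> rate n \<le> 1"
  using r powr_mono[of "- r" 0 "real n"] by (simp add: rate_def)

lemma rate_sq: "(rate n)\<^sup>2 = real n powr (- 2 * r)"
  by (simp add: rate_def power2_eq_square powr_add[symmetric])

lemma powr_rate: "n \<ge> 1 \<Longrightarrow> real n powr (2 * r) = 1 / (rate n)\<^sup>2"
  by (simp add: rate_sq powr_minus field_simps)

text \<open>B is fixed before e, and only C depends on e: the far coordinates can be made to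
  contribute arbitrarily little drift without spoiling the constant in front of the head
  energy.\<close>

lemma signal_upper_rate:
  assumes f: "\<forall>n\<ge>1. f n \<in> L2" and C0: "\<And>n. n \<ge> 1 \<Longrightarrow> l2norm (f n) \<le> C0 * rate n"
  obtains B where "0 < B" "\<And>e. 0 < e \<Longrightarrow> \<exists>C\<ge>2. \<forall>\<^sub>F n in sequentially.
    signal n (f n) \<le> B * (energy \<phi> (C * k n) (f n) / (rate n)\<^sup>2) + e"
proof -
  obtain B where B0: "B > 0 \<and> (\<forall>\<^sub>F n in sequentially. \<forall>f\<in>L2. \<forall>C\<ge>1.
    signal n f \<le> B * (real n powr (2 * r) * energy \<phi> (C * k n) f)
      + B * (real n powr (2 * r) * (l2norm f)\<^sup>2) / sqrt (real C))"
    using signal_upper ..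
  note B = conjunct1[OF B0] conjunct2[OF B0]
  have "\<exists>C\<ge>2. \<forall>\<^sub>F n in sequentially.
    signal n (f n) \<le> B * (energy \<phi> (C * k n) (f n) / (rate n)\<^sup>2) + e" if e: "0 < e" for e
  proof -
    \<comment> \<open>This makes C so large that the tail term
      \<open>B * C0\<^sup>2 / sqrt C\<close> is at most e.\<close>
    obtain m :: nat where m: "(B * C0\<^sup>2 / e)\<^sup>2 \<le> real m" using real_arch_simple by blast
    define C where "C = max 2 m"
    have C: "2 \<le> C" by (simp add: C_def)
    have "(B * C0\<^sup>2 / e)\<^sup>2 \<le> real C" using m by (simp add: C_def)
    then have "B * C0\<^sup>2 / e \<le> sqrt (real C)" by (rule real_le_rsqrt)
    then have Ce: "B * C0\<^sup>2 / sqrt (real C) \<le> e" using e C by (simp add: field_simps)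
    have "\<forall>\<^sub>F n in sequentially.
      signal n (f n) \<le> B * (energy \<phi> (C * k n) (f n) / (rate n)\<^sup>2) + e"
      using B(2) eventually_ge_at_top[of 1]
    proof eventually_elim
      case (elim n)
      note p = rate_pos[OF elim(2)]
      have "(l2norm (f n))\<^sup>2 \<le> (C0 * rate n)\<^sup>2" by (intro power_mono C0 elim) simp
      then have "(l2norm (f n))\<^sup>2 / (rate n)\<^sup>2 \<le> C0\<^sup>2" using p by (simp add: field_simps)
      then have "B * ((l2norm (f n))\<^sup>2 / (rate n)\<^sup>2) / sqrt (real C) \<le> B * C0\<^sup>2 / sqrt (real C)"
        using B(1) by (intro divide_right_mono mult_left_mono) auto
      moreover have "signal n (f n) \<le> B * (real n powr (2 * r) * energy \<phi> (C * k n) (f n))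
          + B * (real n powr (2 * r) * (l2norm (f n))\<^sup>2) / sqrt (real C)"
        using elim f C by simp
      ultimately show ?case using Ce unfolding powr_rate[OF elim(2)] by simp
    qed
    with C show ?thesis by blast
  qed
  with B(1) show thesis by (rule that)
qed

lemma consistentI:
  assumes f: "\<forall>n\<ge>1. f n \<in> L2" and C: "C \<ge> (2::nat)" and c: "0 < c"
    and ev: "\<forall>\<^sub>F n in sequentially. c * (rate n)\<^sup>2 \<le> energy \<phi> (C * k n) (f n)"
  shows "consistent M w \<sigma> (quad_stat \<phi> \<kappa> \<sigma>) f"
proof -
  obtain d where d0: "d > 0 \<and> (\<forall>\<^sub>F n in sequentially. \<forall>f\<in>L2.
      d * (real n powr (2 * r) * energy \<phi> (C * k n) f) \<le> signal n f)"
    using signal_lower[OF C] ..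
  note d = conjunct1[OF d0] conjunct2[OF d0]
  have "\<forall>\<^sub>F n in sequentially. d * c \<le> signal n (f n)"
    using d(2) ev eventually_ge_at_top[of 1]
  proof eventually_elim
    case (elim n)
    have "c \<le> energy \<phi> (C * k n) (f n) / (rate n)\<^sup>2"
      using elim(2) rate_pos[OF elim(3)] by (simp add: field_simps)
    then have "d * c \<le> d * (energy \<phi> (C * k n) (f n) / (rate n)\<^sup>2)"
      using d(1) by (intro mult_left_mono) auto
    also have "\<dots> \<le> signal n (f n)" using elim(1,3) f unfolding powr_rate[OF elim(3)] by auto
    finally show ?case .
  qed
  moreover have "0 < d * c" using c d(1) by simp
  ultimately show ?thesis unfolding consistent_iff_signal[OF f] by blast
qed

text \<open>Of a drift of at least d the tail supplies at most d/2 once C is large, so the head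
  supplies the rest.\<close>

lemma consistentD:
  assumes f: "\<forall>n\<ge>1. f n \<in> L2" and C0: "\<And>n. n \<ge> 1 \<Longrightarrow> l2norm (f n) \<le> C0 * rate n"
    and con: "consistent M w \<sigma> (quad_stat \<phi> \<kappa> \<sigma>) f"
  obtains C c where "C \<ge> (2::nat)" "0 < c"
    "\<forall>\<^sub>F n in sequentially. c * (rate n)\<^sup>2 \<le> energy \<phi> (C * k n) (f n)"
proof -
  obtain d where d: "0 < d" "\<forall>\<^sub>F n in sequentially. d \<le> signal n (f n)"
    using con unfolding consistent_iff_signal[OF f] by blast
  obtain B where B: "0 < B" "\<And>e. 0 < e \<Longrightarrow> \<exists>C\<ge>2. \<forall>\<^sub>F n in sequentially.
    signal n (f n) \<le> B * (energy \<phi> (C * k n) (f n) / (rate n)\<^sup>2) + e"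
    by (rule signal_upper_rate[OF f C0]) auto
  obtain C where C: "C \<ge> 2" "\<forall>\<^sub>F n in sequentially.
    signal n (f n) \<le> B * (energy \<phi> (C * k n) (f n) / (rate n)\<^sup>2) + d / 2"
    using B(2)[of "d / 2"] d(1) by auto
  show thesis
  proof (rule that[OF C(1)])
    show "0 < d / (2 * B)" using d B by simp
    show "\<forall>\<^sub>F n in sequentially. d / (2 * B) * (rate n)\<^sup>2 \<le> energy \<phi> (C * k n) (f n)"
      using d(2) C(2) eventually_ge_at_top[of 1]
    proof eventually_elim
      case (elim n)
      have "d / 2 \<le> B * (energy \<phi> (C * k n) (f n) / (rate n)\<^sup>2)" using elim by linarith
      then show ?case using B(1) rate_pos[OF elim(3)] by (simp add: field_simps)
    qed
  qed
qed

text \<open>A vanishing drift makes the energy of every head negligible, with constants that depend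
  on C. Conversely, each level of drift is excluded through one sufficiently large head.\<close>

lemma inconsistent_iff_energy:
  assumes f: "\<forall>n\<ge>1. f n \<in> L2" and C0: "\<And>n. n \<ge> 1 \<Longrightarrow> l2norm (f n) \<le> C0 * rate n"
  shows "inconsistent M w \<sigma> (quad_stat \<phi> \<kappa> \<sigma>) f \<longleftrightarrow>
    (\<forall>C\<ge>2. \<forall>e>0. \<forall>\<^sub>F n in sequentially. energy \<phi> (C * k n) (f n) < e * (rate n)\<^sup>2)"
  unfolding inconsistent_iff_signal[OF f]
proof (intro iffI allI impI)
  fix C :: nat and e :: real assume sig: "\<forall>d>0. \<forall>\<^sub>F n in sequentially. signal n (f n) < d"
    and C: "2 \<le> C" and e: "0 < e"
  obtain d where d0: "d > 0 \<and> (\<forall>\<^sub>F n in sequentially. \<forall>f\<in>L2.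
      d * (real n powr (2 * r) * energy \<phi> (C * k n) f) \<le> signal n f)"
    using signal_lower[OF C] ..
  note d = conjunct1[OF d0] conjunct2[OF d0]
  have "0 < d * e" using d(1) e by simp
  with sig have "\<forall>\<^sub>F n in sequentially. signal n (f n) < d * e" by blast
  then show "\<forall>\<^sub>F n in sequentially. energy \<phi> (C * k n) (f n) < e * (rate n)\<^sup>2"
    using d(2) eventually_ge_at_top[of 1]
  proof eventually_elim
    case (elim n)
    have "d * (energy \<phi> (C * k n) (f n) / (rate n)\<^sup>2) \<le> signal n (f n)"
      using elim(2,3) f unfolding powr_rate[OF elim(3)] by auto
    then have "d * (energy \<phi> (C * k n) (f n) / (rate n)\<^sup>2) < d * e" using elim(1) by linarith
    then have "energy \<phi> (C * k n) (f n) / (rate n)\<^sup>2 < e"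
      using d(1) by (simp only: mult_less_cancel_left_pos)
    then show ?case using rate_pos[OF elim(3)] by (simp add: field_simps)
  qed
next
  fix d :: real assume en: "\<forall>C\<ge>2. \<forall>e>0. \<forall>\<^sub>F n in sequentially. energy \<phi> (C * k n) (f n) < e * (rate n)\<^sup>2"
    and d: "0 < d"
  obtain B where B: "0 < B" "\<And>e. 0 < e \<Longrightarrow> \<exists>C\<ge>2. \<forall>\<^sub>F n in sequentially.
    signal n (f n) \<le> B * (energy \<phi> (C * k n) (f n) / (rate n)\<^sup>2) + e"
    by (rule signal_upper_rate[OF f C0]) auto
  obtain C where C: "C \<ge> 2" "\<forall>\<^sub>F n in sequentially.
    signal n (f n) \<le> B * (energy \<phi> (C * k n) (f n) / (rate n)\<^sup>2) + d / 2"
    using B(2)[of "d / 2"] d by auto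
  have "0 < d / (2 * B)" using B d by simp
  with en C(1) have "\<forall>\<^sub>F n in sequentially. energy \<phi> (C * k n) (f n) < d / (2 * B) * (rate n)\<^sup>2" by blast
  then show "\<forall>\<^sub>F n in sequentially. signal n (f n) < d"
    using C(2) eventually_ge_at_top[of 1]
  proof eventually_elim
    case (elim n)
    have "energy \<phi> (C * k n) (f n) / (rate n)\<^sup>2 < d / (2 * B)"
      using elim(1) rate_pos[OF elim(3)] by (simp add: field_simps)
    then have "B * (energy \<phi> (C * k n) (f n) / (rate n)\<^sup>2) < B * (d / (2 * B))"
      using B(1) by (simp only: mult_less_cancel_left_pos)
    also have "\<dots> = d / 2" using B(1) by simp
    finally show ?case using elim(2) by linarith
  qed
qed

text \<open>The exponent \<open>s\<close> is the one for which \<open>k\<^sub>n\<^sup>2\<^sup>s\<close> is of the order of \<open>n\<^sup>2\<^sup>r\<close>.\<close>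

lemma powr_exponent:
  assumes s: "s = r / (2 - 4 * r)" and "n \<ge> 1" "0 \<le> c"
  shows "(c * real n powr (2 - 4 * r)) powr (2 * s) = c powr (2 * s) / (rate n)\<^sup>2"
proof -
  have "(2 - 4 * r) * (2 * s) = 2 * r" using r by (simp add: s field_simps)
  then show ?thesis
    using assms by (simp add: powr_mult powr_powr powr_rate)
qed

section \<open>Balls at the scale of \<open>k n\<close>\<close>

text \<open>By the choice of \<open>s\<close>, the ball condition at \<open>l = C * k n\<close>
  bounds the tail by a multiple of the squared rate that decreases in C. So one C serves all n and
  all elements of the ball.\<close>

lemma ball_tail:
  assumes s: "s = r / (2 - 4 * r)" and P0: "0 < P0" and \<gamma>: "0 < \<gamma>" and e: "0 < e"
  obtains C where "C \<ge> (2::nat)" "\<And>n g. n \<ge> 1 \<Longrightarrow> g \<in> scale_set \<gamma> (besov_ball \<phi> s P0) \<Longrightarrow>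
    (l2norm g)\<^sup>2 - energy \<phi> (C * k n) g \<le> e * (rate n)\<^sup>2"
proof -
  have s0: "0 < s" using r by (simp add: s)
  obtain c where c: "0 < c" "\<And>n. n \<ge> 1 \<Longrightarrow> c * real n powr (2 - 4 * r) \<le> real (k n)"
    by (rule kn_bounds) blast
  \<comment> \<open>z solves \<open>z powr (2 * s) = \<gamma>\<^sup>2 * P0 / e\<close>, and C is
    taken so large that C c \<ge> z.\<close>
  define z where "z = (\<gamma>\<^sup>2 * P0 / e) powr (1 / (2 * s))"
  obtain m :: nat where m: "z / c \<le> real m" using real_arch_simple by blast
  define C where "C = max 2 m"
  have C: "2 \<le> C" by (simp add: C_def)
  have "z / c \<le> real C" using m by (simp add: C_def)
  then have "z \<le> real C * c" using c by (simp add: field_simps)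
  then have "z powr (2 * s) \<le> (real C * c) powr (2 * s)"
    using s0 by (intro powr_mono2) (auto simp: z_def)
  moreover have "z powr (2 * s) = \<gamma>\<^sup>2 * P0 / e"
    using s0 \<gamma> P0 e by (simp add: z_def powr_powr)
  ultimately have "\<gamma>\<^sup>2 * P0 / e * e \<le> (real C * c) powr (2 * s) * e"
    using e by (intro mult_right_mono) auto
  then have Cs: "\<gamma>\<^sup>2 * P0 \<le> e * (real C * c) powr (2 * s)" using e by (simp add: mult.commute)
  show thesis
  proof (rule that[OF C])
    fix n :: nat and g assume n: "1 \<le> n" and g: "g \<in> scale_set \<gamma> (besov_ball \<phi> s P0)"
    let ?t = "(l2norm g)\<^sup>2 - energy \<phi> (C * k n) g"
    have gL: "g \<in> L2" and "\<And>l. 0 < l \<Longrightarrow> l powr (2 * s) * ((l2norm g)\<^sup>2 - energy \<phi> (nat \<lfloor>l\<rfloor>) g) \<le> \<gamma>\<^sup>2 * P0"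
      using g unfolding scaled_ball_iff[OF \<gamma>] by auto
    from this(2)[of "real (C * k n)"] have le: "real (C * k n) powr (2 * s) * ?t \<le> \<gamma>\<^sup>2 * P0"
      using C kn_pos[OF n] by (simp only: floor_of_nat nat_int of_nat_0_less_iff) simp
    have t0: "0 \<le> ?t" using energy_le[OF gL] by simp
    have "real C * (c * real n powr (2 - 4 * r)) \<le> real C * real (k n)"
      by (intro mult_left_mono c(2) n) simp
    then have "real C * c * real n powr (2 - 4 * r) \<le> real (C * k n)" by (simp add: mult.assoc)
    then have "(real C * c * real n powr (2 - 4 * r)) powr (2 * s) \<le> real (C * k n) powr (2 * s)"
      using s0 c by (intro powr_mono2) auto
    also have "(real C * c * real n powr (2 - 4 * r)) powr (2 * s) = (real C * c) powr (2 * s) / (rate n)\<^sup>2"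
      using c by (intro powr_exponent[OF s n]) simp
    finally have "(real C * c) powr (2 * s) / (rate n)\<^sup>2 * ?t \<le> real (C * k n) powr (2 * s) * ?t"
      using t0 by (rule mult_right_mono)
    also note le
    also note Cs
    finally have "(real C * c) powr (2 * s) * (?t / (rate n)\<^sup>2) \<le> (real C * c) powr (2 * s) * e"
      by (simp add: mult.commute)
    moreover have "0 < (real C * c) powr (2 * s)" using C c by simp
    ultimately have "?t / (rate n)\<^sup>2 \<le> e" by (simp only: mult_le_cancel_left_pos)
    then show "?t \<le> e * (rate n)\<^sup>2" using rate_pos[OF n] by (simp add: field_simps)
  qed
qed

text \<open>The growth of \<open>k n\<close> to the power 2s is compensated by the decay of the
  squared norm. G depends on C, which is already fixed when the bound is used.\<close>

lemma proj_ball_bound: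
  assumes s: "s = r / (2 - 4 * r)" and f: "\<forall>n\<ge>1. f n \<in> L2"
    and C0: "\<And>n. n \<ge> 1 \<Longrightarrow> l2norm (f n) \<le> C0 * rate n"
  obtains G where "\<And>n. n \<ge> 1 \<Longrightarrow> real (C * k n) powr (2 * s) * energy \<phi> (C * k n) (f n) \<le> G"
proof -
  have s0: "0 < s" using r by (simp add: s)
  obtain c where c: "0 < c" "\<And>n. n \<ge> 1 \<Longrightarrow> real (k n) \<le> c * real n powr (2 - 4 * r)"
    by (rule kn_bounds) blast
  show thesis
  proof (rule that)
    fix n :: nat assume n: "n \<ge> 1"
    have "real C * real (k n) \<le> real C * (c * real n powr (2 - 4 * r))"
      by (intro mult_left_mono c(2) n) simp
    then have "real (C * k n) \<le> real C * c * real n powr (2 - 4 * r)" by (simp add: mult.assoc)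
    then have "real (C * k n) powr (2 * s) \<le> (real C * c * real n powr (2 - 4 * r)) powr (2 * s)"
      using s0 by (intro powr_mono2) auto
    also have "\<dots> = (real C * c) powr (2 * s) / (rate n)\<^sup>2"
      using c by (intro powr_exponent[OF s n]) simp
    finally have 1: "real (C * k n) powr (2 * s) \<le> (real C * c) powr (2 * s) / (rate n)\<^sup>2" .
    have "energy \<phi> (C * k n) (f n) \<le> (l2norm (f n))\<^sup>2" using f n by (intro energy_le) auto
    also have "\<dots> \<le> (C0 * rate n)\<^sup>2" by (intro power_mono C0 n) simp
    finally have "real (C * k n) powr (2 * s) * energy \<phi> (C * k n) (f n)
        \<le> (real C * c) powr (2 * s) / (rate n)\<^sup>2 * (C0 * rate n)\<^sup>2"
      by (intro mult_mono 1) auto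
    also have "\<dots> = (real C * c) powr (2 * s) * C0\<^sup>2"
      using rate_pos[OF n] by (simp add: power_mult_distrib)
    finally show "real (C * k n) powr (2 * s) * energy \<phi> (C * k n) (f n) \<le> (real C * c) powr (2 * s) * C0\<^sup>2" .
  qed
qed

lemma same_order_rateI:
  assumes "0 < c" "\<And>n. n \<ge> 1 \<Longrightarrow> c * (rate n)\<^sup>2 \<le> (l2norm (g n))\<^sup>2"
    "\<And>n. n \<ge> 1 \<Longrightarrow> l2norm (g n) \<le> C * rate n"
  shows "same_order rate (\<lambda>n. l2norm (g n))"
proof -
  have lo: "sqrt c * rate n \<le> l2norm (g n)" if "n \<ge> 1" for n
  proof (rule power2_le_imp_le)
    show "(sqrt c * rate n)\<^sup>2 \<le> (l2norm (g n))\<^sup>2"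
      using assms(1) assms(2)[OF that] by (simp add: power_mult_distrib)
  qed simp
  \<comment> \<open>At n = 1 the rate is 1, which orders the two constants as
    \<open>same_order\<close> demands.\<close>
  have "sqrt c \<le> C" using lo[of 1] assms(3)[of 1] by (simp add: rate_def)
  with lo assms(1,3) show ?thesis unfolding same_order_def
    by (intro exI[of _ "sqrt c"] exI[of _ C]) auto
qed

lemma same_order_rateD:
  assumes "same_order rate (\<lambda>n. l2norm (g n))"
  obtains c C where "0 < c" "0 < C" "\<And>n. n \<ge> 1 \<Longrightarrow> c * rate n \<le> l2norm (g n)"
    "\<And>n. n \<ge> 1 \<Longrightarrow> l2norm (g n) \<le> C * rate n"
proof -
  obtain c C where "0 < c" "c \<le> C" "\<forall>n\<ge>1. c * rate n \<le> l2norm (g n) \<and> l2norm (g n) \<le> C * rate n"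
    using assms unfolding same_order_def by blast
  then show thesis by (intro that[of c C]) auto
qed

section \<open>The characterizations of consistency and inconsistency\<close>

text \<open>For large n the component is the projection onto the first \<open>C * k n\<close>
  coordinates, where consistency places a fixed share of the energy; Pythagoras holds for any
  projection. The care goes into the finitely many other n, where the component must still be
  nonzero and lie in the same ball.\<close>

lemma maxiset_component:
  assumes s: "s = r / (2 - 4 * r)" and P0: "0 < P0" and f: "\<forall>n\<ge>1. f n \<in> L2"
    and ford: "same_order rate (\<lambda>n. l2norm (f n))"
    and con: "consistent M w \<sigma> (quad_stat \<phi> \<kappa> \<sigma>) f"
  shows "\<exists>\<gamma>>0. \<exists>f1 :: nat \<Rightarrow> real \<Rightarrow> real.
     (\<forall>n\<ge>1. f1 n \<in> scale_set \<gamma> (besov_ball \<phi> s P0)) \<and>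
     same_order rate (\<lambda>n. l2norm (f1 n)) \<and>
     (\<forall>n\<ge>1. (l2norm (f n))\<^sup>2 = (l2norm (f1 n))\<^sup>2 + (l2norm (\<lambda>t. f n t - f1 n t))\<^sup>2)"
proof -
  have s0: "0 < s" using r by (simp add: s)
  obtain c0 C0 where c0: "0 < c0" and f_lo: "\<And>n. n \<ge> 1 \<Longrightarrow> c0 * rate n \<le> l2norm (f n)"
    and f_up: "\<And>n. n \<ge> 1 \<Longrightarrow> l2norm (f n) \<le> C0 * rate n"
    by (rule same_order_rateD[OF ford]) blast
  obtain C c where C: "C \<ge> (2::nat)" "0 < c"
    "\<forall>\<^sub>F n in sequentially. c * (rate n)\<^sup>2 \<le> energy \<phi> (C * k n) (f n)"
    by (rule consistentD[OF f f_up con]) auto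
  have ex: "\<exists>m. 0 < energy \<phi> m (f n)" if n: "n \<ge> 1" for n
  proof -
    have "0 < c0 * rate n" using c0 rate_pos[OF n] by simp
    then have "0 < (l2norm (f n))\<^sup>2" using f_lo[OF n] by simp
    from order_tendstoD(1)[OF energy_tendsto this] f n
    show ?thesis by (auto dest: eventually_happens'[OF sequentially_bot])
  qed
  \<comment> \<open>At an exceptional n some projection of \<open>f n\<close> is nonzero because
    \<open>f n\<close> has positive norm, and any such index will do.\<close>
  define m where "m n = (if c * (rate n)\<^sup>2 \<le> energy \<phi> (C * k n) (f n) then C * k n
    else (SOME m. 0 < energy \<phi> m (f n)))" for n
  define f1 where "f1 n = proj \<phi> (m n) (f n)" for n
  have m_ev: "\<forall>\<^sub>F n in sequentially. m n = C * k n"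
    using C(3) by eventually_elim (simp add: m_def)
  have m_pos: "0 < energy \<phi> (m n) (f n) / (rate n)\<^sup>2" if n: "n \<ge> 1" for n
  proof -
    have "0 < energy \<phi> (m n) (f n)"
    proof (cases "c * (rate n)\<^sup>2 \<le> energy \<phi> (C * k n) (f n)")
      case True
      have "0 < c * (rate n)\<^sup>2" using C(2) rate_pos[OF n] by simp
      with True show ?thesis by (simp add: m_def)
    qed (use someI_ex[OF ex[OF n]] in \<open>simp add: m_def\<close>)
    then show ?thesis using rate_pos[OF n] by simp
  qed
  have "\<forall>\<^sub>F n in sequentially. c \<le> energy \<phi> (m n) (f n) / (rate n)\<^sup>2"
    using C(3) m_ev eventually_ge_at_top[of 1]
  proof eventually_elim
    case (elim n)
    then show ?case using rate_pos[OF elim(3)] by (simp add: pos_le_divide_eq)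
  qed
  then obtain c' where c': "0 < c'" "\<And>n. n \<ge> 1 \<Longrightarrow> c' \<le> energy \<phi> (m n) (f n) / (rate n)\<^sup>2"
    using m_pos by (rule eventually_bounded_below_imp_bounded_below[OF C(2)]) blast+
  have lo: "c' * (rate n)\<^sup>2 \<le> (l2norm (f1 n))\<^sup>2" if "n \<ge> 1" for n
    using c'(2)[OF that] rate_pos[OF that] by (simp add: f1_def norm_proj field_simps)
  have up: "l2norm (f1 n) \<le> C0 * rate n" if n: "n \<ge> 1" for n
  proof -
    have "(l2norm (f1 n))\<^sup>2 \<le> (l2norm (f n))\<^sup>2"
      unfolding f1_def norm_proj using f n by (intro energy_le) auto
    then have "l2norm (f1 n) \<le> l2norm (f n)" by (rule power2_le_imp_le) simp
    then show ?thesis using f_up[OF n] by linarith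
  qed
  obtain G where G: "\<And>n. n \<ge> 1 \<Longrightarrow> real (C * k n) powr (2 * s) * energy \<phi> (C * k n) (f n) \<le> G"
    by (rule proj_ball_bound[OF s f f_up]) auto
  have "\<forall>\<^sub>F n in sequentially. real (m n) powr (2 * s) * energy \<phi> (m n) (f n) \<le> G"
    using m_ev eventually_ge_at_top[of 1]
  proof eventually_elim
    case (elim n)
    show ?case unfolding elim(1) by (rule G[OF elim(2)])
  qed
  then obtain G' where G': "0 < G'" "\<And>n. real (m n) powr (2 * s) * energy \<phi> (m n) (f n) \<le> G'"
    by (rule eventually_bounded_imp_bounded) blast
  define \<gamma> where "\<gamma> = sqrt (G' / P0)"
  have \<gamma>: "0 < \<gamma>" "\<gamma>\<^sup>2 * P0 = G'" using G'(1) P0 by (simp_all add: \<gamma>_def)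
  have "f1 n \<in> scale_set \<gamma> (besov_ball \<phi> s P0)" if n: "n \<ge> 1" for n
    unfolding f1_def using f n G'(2)[of n] by (intro proj_in_ball \<gamma>(1) s0 P0) (auto simp: \<gamma>(2))
  moreover have "same_order rate (\<lambda>n. l2norm (f1 n))"
    by (rule same_order_rateI[OF c'(1) lo up])
  moreover have "(l2norm (f n))\<^sup>2 = (l2norm (f1 n))\<^sup>2 + (l2norm (\<lambda>t. f n t - f1 n t))\<^sup>2" if "n \<ge> 1" for n
    using f that by (simp add: f1_def norm_sub_proj norm_proj)
  ultimately show ?thesis using \<gamma>(1) by blast
qed

text \<open>The orthogonality condition says that the inner product of \<open>f\<close> and
  \<open>f1\<close> is the squared norm of \<open>f1\<close>. The tail of \<open>f1\<close> accounts
  for at most half of its lower bound, so the head of \<open>f\<close> cannot be small.\<close>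

lemma consistent_of_component:
  assumes s: "s = r / (2 - 4 * r)" and P0: "0 < P0" and f: "\<forall>n\<ge>1. f n \<in> L2"
    and ford: "same_order rate (\<lambda>n. l2norm (f n))"
    and \<gamma>: "0 < \<gamma>" and ball: "\<forall>n\<ge>1. f1 n \<in> scale_set \<gamma> (besov_ball \<phi> s P0)"
    and f1ord: "same_order rate (\<lambda>n. l2norm (f1 n))"
    and orth: "\<forall>n\<ge>1. (l2norm (f n))\<^sup>2 = (l2norm (f1 n))\<^sup>2 + (l2norm (\<lambda>t. f n t - f1 n t))\<^sup>2"
  shows "consistent M w \<sigma> (quad_stat \<phi> \<kappa> \<sigma>) f"
proof -
  obtain C0 where C0: "0 < C0" and f_up: "\<And>n. n \<ge> 1 \<Longrightarrow> l2norm (f n) \<le> C0 * rate n"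
    by (rule same_order_rateD[OF ford]) blast
  obtain c1 C1 where c1: "0 < c1" "0 < C1" and f1_lo: "\<And>n. n \<ge> 1 \<Longrightarrow> c1 * rate n \<le> l2norm (f1 n)"
    and f1_up: "\<And>n. n \<ge> 1 \<Longrightarrow> l2norm (f1 n) \<le> C1 * rate n"
    by (rule same_order_rateD[OF f1ord]) blast
  \<comment> \<open>The bound C0 on \<open>f\<close> times the bound e on the tail of
    \<open>f1\<close> is then half of \<open>c1\<^sup>2\<close>, the lower bound for the squared
    norm of \<open>f1\<close> in units of the squared rate.\<close>
  define e where "e = c1\<^sup>2 / (2 * C0)"
  have e: "0 < e" using c1 C0 by (simp add: e_def)
  obtain C where C: "C \<ge> (2::nat)" "\<And>n g. n \<ge> 1 \<Longrightarrow> g \<in> scale_set \<gamma> (besov_ball \<phi> s P0) \<Longrightarrow>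
    (l2norm g)\<^sup>2 - energy \<phi> (C * k n) g \<le> e\<^sup>2 * (rate n)\<^sup>2"
    by (rule ball_tail[OF s P0 \<gamma>, of "e\<^sup>2"]) (use e in auto)
  define c where "c = c1\<^sup>2 / (2 * C1)"
  have c: "0 < c" using c1 by (simp add: c_def)
  have "c\<^sup>2 * (rate n)\<^sup>2 \<le> energy \<phi> (C * k n) (f n)" if n: "n \<ge> 1" for n
  proof -
    note p = rate_pos[OF n]
    have fL: "f n \<in> L2" and gL: "f1 n \<in> L2" using f ball n scaled_ball_iff[OF \<gamma>] by auto
    have "sqrt ((l2norm (f1 n))\<^sup>2 - energy \<phi> (C * k n) (f1 n)) \<le> e * rate n"
      using C(2)[OF n] ball n e p by (intro real_le_lsqrt) (auto simp: power_mult_distrib)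
    then have t: "l2norm (f n) * sqrt ((l2norm (f1 n))\<^sup>2 - energy \<phi> (C * k n) (f1 n)) \<le> (C0 * rate n) * (e * rate n)"
      using energy_le[OF gL] C0 p by (intro mult_mono f_up n) auto
    have h: "sqrt (energy \<phi> (C * k n) (f n)) * l2norm (f1 n) \<le> sqrt (energy \<phi> (C * k n) (f n)) * (C1 * rate n)"
      by (intro mult_left_mono f1_up n) simp
    have "(c1 * rate n)\<^sup>2 \<le> (l2norm (f1 n))\<^sup>2" using c1 p by (intro power_mono f1_lo n) simp
    also have "\<dots> = l2inner (f n) (f1 n)"
      using orth n l2norm_diff_sq[OF fL gL] by simp
    also have "\<dots> \<le> sqrt (energy \<phi> (C * k n) (f n)) * (C1 * rate n) + (C0 * rate n) * (e * rate n)"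
      using inner_split_bound[OF fL gL, of "C * k n"] t h by linarith
    also have "(C0 * rate n) * (e * rate n) = (c1 * rate n)\<^sup>2 / 2"
      using C0 by (simp add: e_def power2_eq_square)
    finally have "(c1 * rate n)\<^sup>2 / 2 \<le> sqrt (energy \<phi> (C * k n) (f n)) * (C1 * rate n)" by simp
    then have "c * rate n \<le> sqrt (energy \<phi> (C * k n) (f n))"
      using c1 p by (simp add: c_def field_simps power2_eq_square)
    then have "(c * rate n)\<^sup>2 \<le> (sqrt (energy \<phi> (C * k n) (f n)))\<^sup>2"
      using c p by (intro power_mono) auto
    then show ?thesis by (simp add: power_mult_distrib)
  qed
  then have "\<forall>\<^sub>F n in sequentially. c\<^sup>2 * (rate n)\<^sup>2 \<le> energy \<phi> (C * k n) (f n)"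
    using eventually_ge_at_top[of 1] by (rule eventually_mono[rotated])
  then show ?thesis using c by (intro consistentI[OF f C(1), of "c\<^sup>2"]) simp_all
qed

text \<open>Asymptotically \<open>f\<close> has little energy in the head and \<open>f1\<close>
  little beyond it. So the head of \<open>f1\<close> survives in the sum, and each of the two parts
  of the inner product contains a small factor.\<close>

lemma inconsistent_perturbation:
  assumes s: "s = r / (2 - 4 * r)" and P0: "0 < P0" and f: "\<forall>n\<ge>1. f n \<in> L2"
    and ford: "same_order rate (\<lambda>n. l2norm (f n))"
    and inc: "inconsistent M w \<sigma> (quad_stat \<phi> \<kappa> \<sigma>) f"
    and \<gamma>: "0 < \<gamma>" and ball: "\<forall>n\<ge>1. f1 n \<in> scale_set \<gamma> (besov_ball \<phi> s P0)"
    and f1ord: "same_order rate (\<lambda>n. l2norm (f1 n))"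
  shows "consistent M w \<sigma> (quad_stat \<phi> \<kappa> \<sigma>) (\<lambda>n t. f n t + f1 n t) \<and>
    (\<lambda>n. (l2norm (\<lambda>t. f n t + f1 n t))\<^sup>2 - ((l2norm (f n))\<^sup>2 + (l2norm (f1 n))\<^sup>2))
      \<in> o(\<lambda>n. real n powr (- 2 * r))"
proof
  obtain C0 where C0: "0 < C0" and f_up: "\<And>n. n \<ge> 1 \<Longrightarrow> l2norm (f n) \<le> C0 * rate n"
    by (rule same_order_rateD[OF ford]) blast
  obtain c1 C1 where c1: "0 < c1" "0 < C1" and f1_lo: "\<And>n. n \<ge> 1 \<Longrightarrow> c1 * rate n \<le> l2norm (f1 n)"
    and f1_up: "\<And>n. n \<ge> 1 \<Longrightarrow> l2norm (f1 n) \<le> C1 * rate n"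
    by (rule same_order_rateD[OF f1ord]) blast
  have gL: "\<forall>n\<ge>1. f1 n \<in> L2" using ball scaled_ball_iff[OF \<gamma>] by auto
  have low: "\<forall>\<^sub>F n in sequentially. energy \<phi> (C * k n) (f n) < e * (rate n)\<^sup>2"
    if "2 \<le> C" "0 < e" for C e
    using inc that inconsistent_iff_energy[OF f f_up] by auto
  show "consistent M w \<sigma> (quad_stat \<phi> \<kappa> \<sigma>) (\<lambda>n t. f n t + f1 n t)"
  proof -
    obtain C where C: "C \<ge> (2::nat)" "\<And>n g. n \<ge> 1 \<Longrightarrow> g \<in> scale_set \<gamma> (besov_ball \<phi> s P0) \<Longrightarrow>
      (l2norm g)\<^sup>2 - energy \<phi> (C * k n) g \<le> c1\<^sup>2 / 2 * (rate n)\<^sup>2"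
      by (rule ball_tail[OF s P0 \<gamma>, of "c1\<^sup>2 / 2"]) (use c1 in auto)
    \<comment> \<open>In units of the rate, the root of the head energy of \<open>f1\<close> is at
      least c1/2 and that of \<open>f\<close> at most c1/4; the difference remains for the
      sum.\<close>
    have "0 < (c1 / 4)\<^sup>2" using c1 by simp
    from low[OF C(1) this]
    have "\<forall>\<^sub>F n in sequentially. (c1 / 4)\<^sup>2 * (rate n)\<^sup>2 \<le> energy \<phi> (C * k n) (\<lambda>t. f n t + f1 n t)"
      using eventually_ge_at_top[of 1]
    proof eventually_elim
      case (elim n)
      note n = elim(2)
      note p = rate_pos[OF n]
      have "sqrt (energy \<phi> (C * k n) (f n)) \<le> c1 / 4 * rate n"
        using elim(1) c1 p by (intro real_le_lsqrt) (auto simp: power_mult_distrib power_divide)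
      moreover have "c1 / 2 * rate n \<le> sqrt (energy \<phi> (C * k n) (f1 n))"
      proof (rule real_le_rsqrt)
        have "(c1 * rate n)\<^sup>2 \<le> (l2norm (f1 n))\<^sup>2" using c1 p by (intro power_mono f1_lo n) simp
        moreover have "(l2norm (f1 n))\<^sup>2 - energy \<phi> (C * k n) (f1 n) \<le> c1\<^sup>2 / 2 * (rate n)\<^sup>2"
          using C(2)[OF n] ball n by auto
        moreover have "c1\<^sup>2 / 2 * (rate n)\<^sup>2 = (c1 * rate n)\<^sup>2 / 2"
          "(c1 / 2 * rate n)\<^sup>2 = (c1 * rate n)\<^sup>2 / 4"
          by (simp_all add: power_mult_distrib power_divide)
        ultimately show "(c1 / 2 * rate n)\<^sup>2 \<le> energy \<phi> (C * k n) (f1 n)"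
          using zero_le_power2[of "c1 * rate n"] by linarith
      qed
      moreover have "sqrt (energy \<phi> (C * k n) (f1 n))
          \<le> sqrt (energy \<phi> (C * k n) (\<lambda>t. f n t + f1 n t)) + sqrt (energy \<phi> (C * k n) (f n))"
        using f gL n by (intro sqrt_energy_add_ge) auto
      ultimately have "c1 / 4 * rate n \<le> sqrt (energy \<phi> (C * k n) (\<lambda>t. f n t + f1 n t))"
        by linarith
      then have "(c1 / 4 * rate n)\<^sup>2 \<le> (sqrt (energy \<phi> (C * k n) (\<lambda>t. f n t + f1 n t)))\<^sup>2"
        using c1 p by (intro power_mono) auto
      then show ?case by (simp add: power_mult_distrib power_divide)
    qed
    moreover have "\<forall>n\<ge>1. (\<lambda>t. f n t + f1 n t) \<in> L2" using f gL by (auto intro: L2_add)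
    ultimately show ?thesis using c1 C(1) by (intro consistentI[where c = "(c1 / 4)\<^sup>2"]) auto
  qed
  show "(\<lambda>n. (l2norm (\<lambda>t. f n t + f1 n t))\<^sup>2 - ((l2norm (f n))\<^sup>2 + (l2norm (f1 n))\<^sup>2))
      \<in> o(\<lambda>n. real n powr (- 2 * r))"
  proof (rule landau_o.smallI)
    fix c :: real assume c: "0 < c"
    \<comment> \<open>Each of the two parts of the inner product is allowed c/4, since the cross
      term is twice the inner product.\<close>
    define e where "e = c / (4 * C0)"
    define e' where "e' = c / (4 * C1)"
    have e: "0 < e" "0 < e'" using c c1 C0 by (simp_all add: e_def e'_def)
    obtain C where C: "C \<ge> (2::nat)" "\<And>n g. n \<ge> 1 \<Longrightarrow> g \<in> scale_set \<gamma> (besov_ball \<phi> s P0) \<Longrightarrow>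
      (l2norm g)\<^sup>2 - energy \<phi> (C * k n) g \<le> e\<^sup>2 * (rate n)\<^sup>2"
      by (rule ball_tail[OF s P0 \<gamma>, of "e\<^sup>2"]) (use e in auto)
    have "0 < e'\<^sup>2" using e by simp
    from low[OF C(1) this]
    show "\<forall>\<^sub>F n in sequentially.
      norm ((l2norm (\<lambda>t. f n t + f1 n t))\<^sup>2 - ((l2norm (f n))\<^sup>2 + (l2norm (f1 n))\<^sup>2))
        \<le> c * norm (real n powr (- 2 * r))"
      using eventually_ge_at_top[of 1]
    proof eventually_elim
      case (elim n)
      note n = elim(2)
      note p = rate_pos[OF n]
      have fL: "f n \<in> L2" and gLn: "f1 n \<in> L2" using f gL n by auto
      have "sqrt ((l2norm (f1 n))\<^sup>2 - energy \<phi> (C * k n) (f1 n)) \<le> e * rate n"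
        using C(2)[OF n] ball n e p by (intro real_le_lsqrt) (auto simp: power_mult_distrib)
      then have t: "l2norm (f n) * sqrt ((l2norm (f1 n))\<^sup>2 - energy \<phi> (C * k n) (f1 n)) \<le> (C0 * rate n) * (e * rate n)"
        using energy_le[OF gLn] C0 p by (intro mult_mono f_up n) auto
      have "sqrt (energy \<phi> (C * k n) (f n)) \<le> e' * rate n"
        using elim(1) e p by (intro real_le_lsqrt) (auto simp: power_mult_distrib)
      then have h: "sqrt (energy \<phi> (C * k n) (f n)) * l2norm (f1 n) \<le> (e' * rate n) * (C1 * rate n)"
        using e p by (intro mult_mono f1_up n) auto
      have "\<bar>l2inner (f n) (f1 n)\<bar> \<le> (e' * rate n) * (C1 * rate n) + (C0 * rate n) * (e * rate n)"
        using inner_split_bound[OF fL gLn, of "C * k n"] t h by linarith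
      also have "\<dots> = c / 2 * (rate n)\<^sup>2"
        using C0 c1 by (simp add: e_def e'_def power2_eq_square field_simps)
      finally show ?case
        using l2norm_add_sq[OF fL gLn] by (simp add: rate_sq abs_mult)
    qed
  qed
qed

text \<open>Wherever the head of \<open>f\<close> keeps a share e of the energy, its projection is
  used as perturbation. The cross term is then twice the head energy, which the assumed
  negligibility rules out for large n.\<close>

lemma inconsistent_of_perturbation:
  assumes s: "s = r / (2 - 4 * r)" and P0: "0 < P0" and f: "\<forall>n\<ge>1. f n \<in> L2"
    and ford: "same_order rate (\<lambda>n. l2norm (f n))"
    and pert: "\<And>\<gamma> f1. 0 < \<gamma> \<Longrightarrow> \<forall>n\<ge>1. f1 n \<in> scale_set \<gamma> (besov_ball \<phi> s P0) \<Longrightarrow>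
      same_order rate (\<lambda>n. l2norm (f1 n)) \<Longrightarrow>
      (\<lambda>n. (l2norm (\<lambda>t. f n t + f1 n t))\<^sup>2 - ((l2norm (f n))\<^sup>2 + (l2norm (f1 n))\<^sup>2))
        \<in> o(\<lambda>n. real n powr (- 2 * r))"
  shows "inconsistent M w \<sigma> (quad_stat \<phi> \<kappa> \<sigma>) f"
proof -
  have s0: "0 < s" using r by (simp add: s)
  obtain C0 where f_up: "\<And>n. n \<ge> 1 \<Longrightarrow> l2norm (f n) \<le> C0 * rate n"
    by (rule same_order_rateD[OF ford]) blast
  have "\<forall>\<^sub>F n in sequentially. energy \<phi> (C * k n) (f n) < e * (rate n)\<^sup>2"
    if C: "C \<ge> 2" and e: "0 < e" for C :: nat and e
  proof -
    define good where "good n \<longleftrightarrow> e * (rate n)\<^sup>2 \<le> energy \<phi> (C * k n) (f n)" for n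
    \<comment> \<open>At the other n a multiple of the first basis function with norm
      \<open>rate n\<close> is inserted, so that \<open>f1\<close> has the right order and stays in
      one ball at every n.\<close>
    define h where "h n = (if good n then f n else (\<lambda>t. rate n * \<phi> (Suc 0) t))" for n
    define m where "m n = (if good n then C * k n else 1)" for n
    define f1 where "f1 n = proj \<phi> (m n) (h n)" for n
    have hL: "h n \<in> L2" if "n \<ge> 1" for n
      using f that L2_scale[OF phi_L2] by (simp add: h_def)
    have bad: "energy \<phi> 1 (\<lambda>t. rate n * \<phi> (Suc 0) t) = (rate n)\<^sup>2" for n
      by (simp add: energy_def coef_def l2inner_scale phi_inner)
    obtain G where G: "\<And>n. n \<ge> 1 \<Longrightarrow> real (C * k n) powr (2 * s) * energy \<phi> (C * k n) (f n) \<le> G"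
      by (rule proj_ball_bound[OF s f f_up]) auto
    \<comment> \<open>The maximum with 1 covers the inserted functions: their only coordinate is the
      first, with square at most 1.\<close>
    define \<gamma> where "\<gamma> = sqrt (max G 1 / P0)"
    have \<gamma>: "0 < \<gamma>" "\<gamma>\<^sup>2 * P0 = max G 1" using P0 by (simp_all add: \<gamma>_def)
    have "real (m n) powr (2 * s) * energy \<phi> (m n) (h n) \<le> \<gamma>\<^sup>2 * P0" if n: "n \<ge> 1" for n
    proof (cases "good n")
      case True
      then show ?thesis unfolding \<gamma>(2) using G[OF n] by (simp add: m_def h_def)
    next
      case False
      have "(rate n)\<^sup>2 \<le> 1" using rate_pos[OF n] rate_le_1[OF n] by (simp add: power_le_one)
      then show ?thesis unfolding \<gamma>(2) m_def h_def using False bad by simp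
    qed
    then have ball: "\<forall>n\<ge>1. f1 n \<in> scale_set \<gamma> (besov_ball \<phi> s P0)"
      unfolding f1_def by (auto intro!: proj_in_ball hL \<gamma>(1) s0 P0)
    have norm1: "(l2norm (f1 n))\<^sup>2 = (if good n then energy \<phi> (C * k n) (f n) else (rate n)\<^sup>2)" for n
      using bad by (simp add: f1_def norm_proj m_def h_def)
    have "same_order rate (\<lambda>n. l2norm (f1 n))"
    proof (rule same_order_rateI)
      show "0 < min e 1" using e by simp
      fix n :: nat assume n: "n \<ge> 1"
      show "min e 1 * (rate n)\<^sup>2 \<le> (l2norm (f1 n))\<^sup>2"
      proof (cases "good n")
        case True
        have "min e 1 * (rate n)\<^sup>2 \<le> e * (rate n)\<^sup>2" by (rule mult_right_mono) auto
        with True show ?thesis by (simp add: norm1 good_def)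
      next
        case False
        have "min e 1 * (rate n)\<^sup>2 \<le> 1 * (rate n)\<^sup>2" by (rule mult_right_mono) auto
        with False show ?thesis by (simp add: norm1)
      qed
      have "(l2norm (f1 n))\<^sup>2 \<le> (max C0 1 * rate n)\<^sup>2"
      proof (cases "good n")
        case True
        have "energy \<phi> (C * k n) (f n) \<le> (l2norm (f n))\<^sup>2" using f n by (intro energy_le) auto
        also have "\<dots> \<le> (max C0 1 * rate n)\<^sup>2"
          using f_up[OF n] rate_pos[OF n]
          by (intro power_mono order_trans[OF f_up[OF n]] mult_right_mono) auto
        finally show ?thesis using True by (simp add: norm1)
      next
        case False
        have "(1 * rate n)\<^sup>2 \<le> (max C0 1 * rate n)\<^sup>2"
          using rate_pos[OF n] by (intro power_mono mult_right_mono) auto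
        with False show ?thesis by (simp add: norm1)
      qed
      then show "l2norm (f1 n) \<le> max C0 1 * rate n"
        by (rule power2_le_imp_le) (use rate_pos[OF n] in \<open>simp add: max_def\<close>)
    qed
    from landau_o.smallD[OF pert[OF \<gamma>(1) ball this] e]
    show ?thesis using eventually_ge_at_top[of 1]
    proof eventually_elim
      case (elim n)
      note n = elim(2)
      show ?case
      proof (rule ccontr)
        assume "\<not> energy \<phi> (C * k n) (f n) < e * (rate n)\<^sup>2"
        then have good: "good n" by (simp add: good_def)
        have fL: "f n \<in> L2" using f n by simp
        have f1: "f1 n = proj \<phi> (C * k n) (f n)" using good by (simp add: f1_def h_def m_def)
        \<comment> \<open>The small-o bound is used with constant e, while a good n makes twice the
          head energy at least 2 e times the squared rate.\<close>
        have "2 * energy \<phi> (C * k n) (f n) \<le> e * (rate n)\<^sup>2"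
          using elim(1) l2norm_add_sq[OF fL proj_L2, of "C * k n" "f n"]
          by (simp add: f1 inner_proj_self[OF fL] rate_sq)
        moreover have "0 < e * (rate n)\<^sup>2" using e rate_pos[OF n] by simp
        ultimately show False using good by (simp add: good_def)
      qed
    qed
  qed
  then show ?thesis using inconsistent_iff_energy[OF f f_up] by auto
qed

end

theorem theorem4p2:
  fixes M :: "'a measure" and w :: "(real \<Rightarrow> real) \<Rightarrow> 'a \<Rightarrow> real"
    and \<phi> :: "nat \<Rightarrow> real \<Rightarrow> real" and \<kappa> :: "nat \<Rightarrow> nat \<Rightarrow> real"
    and \<sigma> r s P0 :: real and U :: "(real \<Rightarrow> real) set"
    and f :: "nat \<Rightarrow> real \<Rightarrow> real"
  assumes sigma: "\<sigma> > 0"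
    and noise: "white_noise M w"
    and basis: "orthonormal_basis \<phi>"
    and summ: "kappa_summable \<kappa>"
    and A1: "A1 \<kappa>" and A2: "A2 \<kappa> \<sigma>" and A3: "A3 \<kappa>" and A4: "A4 \<kappa>" and A5: "A5 \<kappa> \<sigma>"
    and r: "0 < r" "r < 1/2" and s: "s = r / (2 - 4 * r)"
    and kn: "same_order (\<lambda>n. real (kn \<kappa> n)) (\<lambda>n. real n powr (2 - 4 * r))"
    and P0: "P0 > 0" and U: "U = besov_ball \<phi> s P0"
    and f_L2: "\<forall>n\<ge>1. f n \<in> L2"
    and f_order: "same_order (\<lambda>n. real n powr (- r)) (\<lambda>n. l2norm (f n))"
  shows "(consistent M w \<sigma> (quad_stat \<phi> \<kappa> \<sigma>) f \<longleftrightarrow>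
            (\<exists>\<gamma>>0. \<exists>f1 :: nat \<Rightarrow> real \<Rightarrow> real.
               (\<forall>n\<ge>1. f1 n \<in> scale_set \<gamma> U) \<and>
               same_order (\<lambda>n. real n powr (- r)) (\<lambda>n. l2norm (f1 n)) \<and>
               (\<forall>n\<ge>1. (l2norm (f n))\<^sup>2 = (l2norm (f1 n))\<^sup>2 + (l2norm (\<lambda>t. f n t - f1 n t))\<^sup>2)))
         \<and>
         (inconsistent M w \<sigma> (quad_stat \<phi> \<kappa> \<sigma>) f \<longleftrightarrow>
            (\<forall>\<gamma>>0. \<forall>f1 :: nat \<Rightarrow> real \<Rightarrow> real.
               (\<forall>n\<ge>1. f1 n \<in> scale_set \<gamma> U) \<and>
               same_order (\<lambda>n. real n powr (- r)) (\<lambda>n. l2norm (f1 n)) \<longrightarrow>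
               consistent M w \<sigma> (quad_stat \<phi> \<kappa> \<sigma>) (\<lambda>n t. f n t + f1 n t) \<and>
               (\<lambda>n. (l2norm (\<lambda>t. f n t + f1 n t))\<^sup>2 - ((l2norm (f n))\<^sup>2 + (l2norm (f1 n))\<^sup>2))
                 \<in> o(\<lambda>n. real n powr (- 2 * r))))"
proof -
  interpret white_noise_model \<kappa> \<sigma> r \<phi> M w
    by unfold_locales (rule sigma summ A1 A2 A4 r kn basis noise)+
  have rate: "(\<lambda>n. real n powr (- r)) = rate" by (simp add: rate_def fun_eq_iff)
  note ford = f_order[unfolded rate]
  show ?thesis
    unfolding rate U
  proof (intro conjI iffI allI impI)
    assume "consistent M w \<sigma> (quad_stat \<phi> \<kappa> \<sigma>) f"
    from maxiset_component[OF s P0 f_L2 ford this]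
    show "\<exists>\<gamma>>0. \<exists>f1 :: nat \<Rightarrow> real \<Rightarrow> real.
       (\<forall>n\<ge>1. f1 n \<in> scale_set \<gamma> (besov_ball \<phi> s P0)) \<and>
       same_order rate (\<lambda>n. l2norm (f1 n)) \<and>
       (\<forall>n\<ge>1. (l2norm (f n))\<^sup>2 = (l2norm (f1 n))\<^sup>2 + (l2norm (\<lambda>t. f n t - f1 n t))\<^sup>2)" .
  next
    assume "\<exists>\<gamma>>0. \<exists>f1 :: nat \<Rightarrow> real \<Rightarrow> real.
       (\<forall>n\<ge>1. f1 n \<in> scale_set \<gamma> (besov_ball \<phi> s P0)) \<and>
       same_order rate (\<lambda>n. l2norm (f1 n)) \<and>
       (\<forall>n\<ge>1. (l2norm (f n))\<^sup>2 = (l2norm (f1 n))\<^sup>2 + (l2norm (\<lambda>t. f n t - f1 n t))\<^sup>2)"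
    then show "consistent M w \<sigma> (quad_stat \<phi> \<kappa> \<sigma>) f"
      using consistent_of_component[OF s P0 f_L2 ford] by blast
  next
    fix \<gamma> :: real and f1 :: "nat \<Rightarrow> real \<Rightarrow> real"
    assume inc: "inconsistent M w \<sigma> (quad_stat \<phi> \<kappa> \<sigma>) f" and \<gamma>: "0 < \<gamma>"
      and f1: "(\<forall>n\<ge>1. f1 n \<in> scale_set \<gamma> (besov_ball \<phi> s P0)) \<and> same_order rate (\<lambda>n. l2norm (f1 n))"
    note pert = inconsistent_perturbation[OF s P0 f_L2 ford inc \<gamma> conjunct1[OF f1] conjunct2[OF f1]]
    show "consistent M w \<sigma> (quad_stat \<phi> \<kappa> \<sigma>) (\<lambda>n t. f n t + f1 n t)"
      by (rule conjunct1[OF pert])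
    show "(\<lambda>n. (l2norm (\<lambda>t. f n t + f1 n t))\<^sup>2 - ((l2norm (f n))\<^sup>2 + (l2norm (f1 n))\<^sup>2))
        \<in> o(\<lambda>n. real n powr (- 2 * r))"
      by (rule conjunct2[OF pert])
  next
    assume "\<forall>\<gamma>>0. \<forall>f1 :: nat \<Rightarrow> real \<Rightarrow> real.
      (\<forall>n\<ge>1. f1 n \<in> scale_set \<gamma> (besov_ball \<phi> s P0)) \<and> same_order rate (\<lambda>n. l2norm (f1 n)) \<longrightarrow>
      consistent M w \<sigma> (quad_stat \<phi> \<kappa> \<sigma>) (\<lambda>n t. f n t + f1 n t) \<and>
      (\<lambda>n. (l2norm (\<lambda>t. f n t + f1 n t))\<^sup>2 - ((l2norm (f n))\<^sup>2 + (l2norm (f1 n))\<^sup>2))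
        \<in> o(\<lambda>n. real n powr (- 2 * r))"
    then show "inconsistent M w \<sigma> (quad_stat \<phi> \<kappa> \<sigma>) f"
      by (intro inconsistent_of_perturbation[OF s P0 f_L2 ford]) blast
  qed
qed

end
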